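(* Let $F$ be a field of characteristic $0$, let $H$ be a Hopf algebra over $F$ with an $\mathrm{ad}$-invariant left integral $t\in H^*$ such that $t(1)=1$, and let $L$ be a finite dimensional $H$-comodule Lie algebra over $F$. Suppose the nilpotent radical $N$ and the solvable radical $R$ of $L$ are $H$-subcomodules. Let $B$ be a semisimple $H$-coinvariant subalgebra of $L$ such that $L=B\oplus R$. Then there exists an $H$-subcomodule $S$ of $L$ such that $R=S\oplus N$ and $[B,S]=0$. Moreover, $L=B\oplus S\oplus N$.
   Context: Here $H$ may be infinite dimensional, $H^*=\mathrm{Hom}_F(H,F)$, and Sweedler notation is used: $\Delta(a)=a_{(1)}\otimes a_{(2)}$ for the comultiplication; $\varepsilon$ and $S$ (as a map on $H$) are the counit and antipode of $H$. An element $t\in H^*$ is a left integral on $H$ if $t(a_{(2)})a_{(1)}=t(a)1$ for all $a\in H$. A left integral $t$ is $\mathrm{ad}$-invariant if $t(a_{(1)}\,b\,S(a_{(2)}))=\varepsilon(a)t(b)$ for all $a,b\in H$. A Lie algebra $L$ that is a right $H$-comodule via $\rho\colon L\to L\otimes H$, $\rho(a)=a_{(0)}\otimes a_{(1)}$, is an $H$-comodule Lie algebra if $\rho([a,b])=[a_{(0)},b_{(0)}]\otimes a_{(1)}b_{(1)}$ for all $a,b\in L$. A subspace $W\subseteq L$ is an $H$-subcomodule ($H$-coinvariant) if $\rho(W)\subseteq W\otimes H$. The solvable (nilpotent) radical is the largest solvable (nilpotent) ideal of $L$. Direct sums are direct sums of subspaces. *)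

theory Defs
  imports Complex_Main "HOL-Library.Poly_Mapping"
begin

section \<open>Tensor products\<close>

text \<open>
  The tensor product of \<open>V\<close> and \<open>W\<close> is the free vector space on \<open>V \<times> W\<close> modulo
  the bilinear relations.  An element of it is written in Sweedler style as a list
  \<open>[(v1, w1), \<dots>, (vn, wn)]\<close> standing for the sum of the \<open>vi \<otimes> wi\<close>; every element
  has this form because scalars can be absorbed into the first component.  Two lists denote the
  same element of the tensor product iff they are related by \<open>tensor_eq\<close>.  A map into a
  tensor product is therefore given by a choice of representing lists, and all its properties
  are stated modulo \<open>tensor_eq\<close>.  Threefold tensor products are treated alike, with lists of
  triples.
\<close>

definition free_scale :: "'f::field \<Rightarrow> ('x \<Rightarrow>\<^sub>0 'f) \<Rightarrow> ('x \<Rightarrow>\<^sub>0 'f)" where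
  "free_scale c = Poly_Mapping.map ((*) c)"

lemma lookup_free_scale: "Poly_Mapping.lookup (free_scale c p) x = c * Poly_Mapping.lookup p x"
  by (simp add: free_scale_def Poly_Mapping.map.rep_eq when_def)

lemma vector_space_free_scale: "vector_space free_scale"
  by unfold_locales
    (auto intro!: poly_mapping_eqI simp: lookup_free_scale lookup_add algebra_simps)

definition formal_sum :: "'x list \<Rightarrow> ('x \<Rightarrow>\<^sub>0 'f::field)" where
  "formal_sum xs = (\<Sum>x\<leftarrow>xs. Poly_Mapping.single x 1)"

text \<open>The relations that make the map \<open>e\<close> into a free vector space linear.\<close>

definition linear_relations ::
  "('f::field \<Rightarrow> 'v::ab_group_add \<Rightarrow> 'v) \<Rightarrow> ('v \<Rightarrow> ('x \<Rightarrow>\<^sub>0 'f)) \<Rightarrow> ('x \<Rightarrow>\<^sub>0 'f) set" where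
  "linear_relations s e =
     {e (v + v') - e v - e v' | v v'. True} \<union> {e (s c v) - free_scale c (e v) | c v. True}"

definition tensor_relations ::
  "('f::field \<Rightarrow> 'v::ab_group_add \<Rightarrow> 'v) \<Rightarrow> ('f \<Rightarrow> 'w::ab_group_add \<Rightarrow> 'w)
    \<Rightarrow> ('v \<times> 'w \<Rightarrow>\<^sub>0 'f) set" where
  "tensor_relations sV sW =
     (\<Union>w. linear_relations sV (\<lambda>v. Poly_Mapping.single (v, w) 1)) \<union>
     (\<Union>v. linear_relations sW (\<lambda>w. Poly_Mapping.single (v, w) 1))"

definition tensor_eq ::
  "('f::field \<Rightarrow> 'v::ab_group_add \<Rightarrow> 'v) \<Rightarrow> ('f \<Rightarrow> 'w::ab_group_add \<Rightarrow> 'w)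
    \<Rightarrow> ('v \<times> 'w) list \<Rightarrow> ('v \<times> 'w) list \<Rightarrow> bool" where
  "tensor_eq sV sW xs ys \<longleftrightarrow>
     formal_sum xs - formal_sum ys \<in> module.span free_scale (tensor_relations sV sW)"

definition tensor3_relations ::
  "('f::field \<Rightarrow> 'u::ab_group_add \<Rightarrow> 'u) \<Rightarrow> ('f \<Rightarrow> 'v::ab_group_add \<Rightarrow> 'v)
    \<Rightarrow> ('f \<Rightarrow> 'w::ab_group_add \<Rightarrow> 'w) \<Rightarrow> ('u \<times> 'v \<times> 'w \<Rightarrow>\<^sub>0 'f) set" where
  "tensor3_relations sU sV sW =
     (\<Union>v w. linear_relations sU (\<lambda>u. Poly_Mapping.single (u, v, w) 1)) \<union>
     (\<Union>u w. linear_relations sV (\<lambda>v. Poly_Mapping.single (u, v, w) 1)) \<union>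
     (\<Union>u v. linear_relations sW (\<lambda>w. Poly_Mapping.single (u, v, w) 1))"

definition tensor3_eq ::
  "('f::field \<Rightarrow> 'u::ab_group_add \<Rightarrow> 'u) \<Rightarrow> ('f \<Rightarrow> 'v::ab_group_add \<Rightarrow> 'v)
    \<Rightarrow> ('f \<Rightarrow> 'w::ab_group_add \<Rightarrow> 'w) \<Rightarrow> ('u \<times> 'v \<times> 'w) list \<Rightarrow> ('u \<times> 'v \<times> 'w) list \<Rightarrow> bool"
  where
  "tensor3_eq sU sV sW xs ys \<longleftrightarrow>
     formal_sum xs - formal_sum ys \<in> module.span free_scale (tensor3_relations sU sV sW)"

text \<open>\<open>\<rho>\<close>, given by representing lists, is a linear map from \<open>U\<close> to the tensor product
  of \<open>V\<close> and \<open>W\<close>.\<close>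

definition tensor_linear ::
  "('f::field \<Rightarrow> 'u::ab_group_add \<Rightarrow> 'u) \<Rightarrow> ('f \<Rightarrow> 'v::ab_group_add \<Rightarrow> 'v)
    \<Rightarrow> ('f \<Rightarrow> 'w::ab_group_add \<Rightarrow> 'w) \<Rightarrow> ('u \<Rightarrow> ('v \<times> 'w) list) \<Rightarrow> bool" where
  "tensor_linear sU sV sW \<rho> \<longleftrightarrow>
     (\<forall>a b. tensor_eq sV sW (\<rho> (a + b)) (\<rho> a @ \<rho> b)) \<and>
     (\<forall>c a. tensor_eq sV sW (\<rho> (sU c a)) [(sV c x, y). (x, y) \<leftarrow> \<rho> a])"


section \<open>Hopf algebras\<close>

locale unital_algebra = vector_space scale
  for scale :: "'f::field \<Rightarrow> 'h::ring_1 \<Rightarrow> 'h" +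
  assumes mult_scale_left: "scale c a * b = scale c (a * b)"
    and mult_scale_right: "a * scale c b = scale c (a * b)"

locale coalgebra = vector_space scale
  for scale :: "'f::field \<Rightarrow> 'h::ab_group_add \<Rightarrow> 'h" +
  fixes comult :: "'h \<Rightarrow> ('h \<times> 'h) list"
    and counit :: "'h \<Rightarrow> 'f"
  assumes comult_linear: "tensor_linear scale scale scale comult"
    and counit_linear: "Vector_Spaces.linear scale (*) counit"
    and coassoc: "tensor3_eq scale scale scale
          [(u, v, y). (x, y) \<leftarrow> comult a, (u, v) \<leftarrow> comult x]
          [(x, u, v). (x, y) \<leftarrow> comult a, (u, v) \<leftarrow> comult y]"
    and counit_left: "(\<Sum>(x, y)\<leftarrow>comult a. scale (counit x) y) = a"
    and counit_right: "(\<Sum>(x, y)\<leftarrow>comult a. scale (counit y) x) = a"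

locale hopf_algebra = unital_algebra scale + coalgebra scale comult counit
  for scale :: "'f::field \<Rightarrow> 'h::ring_1 \<Rightarrow> 'h"
    and comult :: "'h \<Rightarrow> ('h \<times> 'h) list"
    and counit :: "'h \<Rightarrow> 'f" +
  fixes antipode :: "'h \<Rightarrow> 'h"
  assumes comult_mult: "tensor_eq scale scale (comult (a * b))
          [(x * x', y * y'). (x, y) \<leftarrow> comult a, (x', y') \<leftarrow> comult b]"
    and comult_one: "tensor_eq scale scale (comult 1) [(1, 1)]"
    and counit_mult: "counit (a * b) = counit a * counit b"
    and counit_one: "counit 1 = 1"
    and antipode_linear: "Vector_Spaces.linear scale scale antipode"
    and antipode_left: "(\<Sum>(x, y)\<leftarrow>comult a. antipode x * y) = scale (counit a) 1"
    and antipode_right: "(\<Sum>(x, y)\<leftarrow>comult a. x * antipode y) = scale (counit a) 1"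
begin

definition left_integral :: "('h \<Rightarrow> 'f) \<Rightarrow> bool" where
  "left_integral t \<longleftrightarrow> Vector_Spaces.linear scale (*) t \<and>
     (\<forall>a. (\<Sum>(x, y)\<leftarrow>comult a. scale (t y) x) = scale (t a) 1)"

definition ad_invariant :: "('h \<Rightarrow> 'f) \<Rightarrow> bool" where
  "ad_invariant t \<longleftrightarrow>
     (\<forall>a b. t (\<Sum>(x, y)\<leftarrow>comult a. x * b * antipode y) = counit a * t b)"

end


section \<open>Lie algebras\<close>

locale lie_algebra = vector_space scale
  for scale :: "'f::field \<Rightarrow> 'l::ab_group_add \<Rightarrow> 'l" +
  fixes bracket :: "'l \<Rightarrow> 'l \<Rightarrow> 'l"
  assumes bracket_linear_left: "Vector_Spaces.linear scale scale (\<lambda>x. bracket x y)"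
    and bracket_linear_right: "Vector_Spaces.linear scale scale (\<lambda>y. bracket x y)"
    and bracket_self: "bracket x x = 0"
    and jacobi: "bracket x (bracket y z) + bracket y (bracket z x) + bracket z (bracket x y) = 0"
begin

definition bracket_space :: "'l set \<Rightarrow> 'l set \<Rightarrow> 'l set" where
  "bracket_space X Y = span {bracket x y | x y. x \<in> X \<and> y \<in> Y}"

fun derived_series :: "'l set \<Rightarrow> nat \<Rightarrow> 'l set" where
  "derived_series A 0 = A"
| "derived_series A (Suc n) = bracket_space (derived_series A n) (derived_series A n)"

fun lower_central_series :: "'l set \<Rightarrow> nat \<Rightarrow> 'l set" where
  "lower_central_series A 0 = A"
| "lower_central_series A (Suc n) = bracket_space A (lower_central_series A n)"

definition subalgebra :: "'l set \<Rightarrow> bool" where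
  "subalgebra A \<longleftrightarrow> subspace A \<and> (\<forall>x\<in>A. \<forall>y\<in>A. bracket x y \<in> A)"

definition ideal_of :: "'l set \<Rightarrow> 'l set \<Rightarrow> bool" where
  "ideal_of A I \<longleftrightarrow> subspace I \<and> I \<subseteq> A \<and> (\<forall>x\<in>A. \<forall>y\<in>I. bracket x y \<in> I)"

definition solvable :: "'l set \<Rightarrow> bool" where
  "solvable A \<longleftrightarrow> (\<exists>n. derived_series A n = {0})"

definition nilpotent :: "'l set \<Rightarrow> bool" where
  "nilpotent A \<longleftrightarrow> (\<exists>n. lower_central_series A n = {0})"

text \<open>The radicals of a subalgebra \<open>A\<close>; those of the whole Lie algebra are obtained with
  \<open>A = UNIV\<close>.\<close>

definition is_solvable_radical :: "'l set \<Rightarrow> 'l set \<Rightarrow> bool" where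
  "is_solvable_radical A R \<longleftrightarrow>
     ideal_of A R \<and> solvable R \<and> (\<forall>I. ideal_of A I \<and> solvable I \<longrightarrow> I \<subseteq> R)"

definition is_nilpotent_radical :: "'l set \<Rightarrow> 'l set \<Rightarrow> bool" where
  "is_nilpotent_radical A N \<longleftrightarrow>
     ideal_of A N \<and> nilpotent N \<and> (\<forall>I. ideal_of A I \<and> nilpotent I \<longrightarrow> I \<subseteq> N)"

definition semisimple :: "'l set \<Rightarrow> bool" where
  "semisimple A \<longleftrightarrow> is_solvable_radical A {0}"

end

context vector_space
begin

text \<open>\<open>W\<close> is the internal direct sum of the subspaces in the list: every element of \<open>W\<close> is
  a sum of elements of these subspaces in exactly one way.\<close>

definition internal_direct_sum :: "'b set \<Rightarrow> 'b set list \<Rightarrow> bool" where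
  "internal_direct_sum W Us \<longleftrightarrow>
     (\<forall>U\<in>set Us. subspace U) \<and> bij_betw sum_list (listset Us) W"

end


section \<open>Comodule Lie algebras\<close>

locale right_comodule =
  H: coalgebra scaleH comult counit + L: vector_space scaleL
  for scaleH :: "'f::field \<Rightarrow> 'h::ab_group_add \<Rightarrow> 'h"
    and comult :: "'h \<Rightarrow> ('h \<times> 'h) list"
    and counit :: "'h \<Rightarrow> 'f"
    and scaleL :: "'f \<Rightarrow> 'l::ab_group_add \<Rightarrow> 'l" +
  fixes coact :: "'l \<Rightarrow> ('l \<times> 'h) list"
  assumes coact_linear: "tensor_linear scaleL scaleL scaleH coact"
    and coact_coassoc: "tensor3_eq scaleL scaleH scaleH
          [(u, h, k). (x, k) \<leftarrow> coact a, (u, h) \<leftarrow> coact x]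
          [(x, h, k). (x, y) \<leftarrow> coact a, (h, k) \<leftarrow> comult y]"
    and coact_counit: "(\<Sum>(x, h)\<leftarrow>coact a. scaleL (counit h) x) = a"
begin

text \<open>The image of \<open>W \<otimes> H\<close> in \<open>L \<otimes> H\<close> consists of the tensors represented by a list
  with all first components in \<open>W\<close>; over a field it is isomorphic to \<open>W \<otimes> H\<close>.\<close>

definition subcomodule :: "'l set \<Rightarrow> bool" where
  "subcomodule W \<longleftrightarrow> L.subspace W \<and>
     (\<forall>a\<in>W. \<exists>xs. set xs \<subseteq> W \<times> UNIV \<and> tensor_eq scaleL scaleH (coact a) xs)"

end

locale comodule_lie_algebra =
  H: hopf_algebra scaleH comult counit antipode +
  L: lie_algebra scaleL bracket +
  right_comodule scaleH comult counit scaleL coact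
  for scaleH :: "'f::field \<Rightarrow> 'h::ring_1 \<Rightarrow> 'h"
    and comult :: "'h \<Rightarrow> ('h \<times> 'h) list"
    and counit :: "'h \<Rightarrow> 'f"
    and antipode :: "'h \<Rightarrow> 'h"
    and scaleL :: "'f \<Rightarrow> 'l::ab_group_add \<Rightarrow> 'l"
    and bracket :: "'l \<Rightarrow> 'l \<Rightarrow> 'l"
    and coact :: "'l \<Rightarrow> ('l \<times> 'h) list" +
  assumes coact_bracket: "tensor_eq scaleL scaleH (coact (bracket a b))
          [(bracket x y, h * k). (x, h) \<leftarrow> coact a, (y, k) \<leftarrow> coact b]"

end

theory Submission
  imports Defs "HOL-Computational_Algebra.Polynomial" "HOL-Library.Function_Algebras"
    "HOL-Algebra.Algebraic_Closure_Type"
begin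

text \<open>
  Since \<open>[L, R] \<subseteq> N\<close>, every \<open>r \<in> R\<close> gives a cocycle \<open>b \<mapsto> [b, r]\<close> of \<open>B\<close> with values
  in \<open>N\<close>; it is a coboundary by Whitehead's lemma, so \<open>R\<close> is the sum of \<open>N\<close> and the
  centralizer of \<open>B\<close> in \<open>R\<close>.  Hence there is a \<open>B\<close>-linear projection \<open>p\<close> of \<open>L\<close> onto \<open>N\<close>.
  The average \<open>v \<mapsto> t (p(v\<^sub>0)\<^sub>1 S(v\<^sub>1)) p(v\<^sub>0)\<^sub>0\<close> of \<open>p\<close> is still a projection onto \<open>N\<close>; it is
  colinear because \<open>t\<close> is a left integral and \<open>B\<close>-linear because \<open>t\<close> is ad-invariant.  The
  complement is its kernel in \<open>R\<close>.

  The inclusion \<open>[L, R] \<subseteq> N\<close> is obtained on chief factors, where the elements of a suitable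
  ideal have powers of trace zero and Engel's theorem applies.  Whitehead's lemma uses a
  Casimir operator \<open>c\<close> of the part of \<open>B\<close> acting faithfully on the module: modulo a
  coboundary, the cocycle takes values in the kernel of a power of \<open>c\<close>, a smaller module
  because \<open>c\<close> has nonzero trace.  The nondegeneracy of the trace form behind it is Cartan's
  criterion, which is proved over the algebraic closure.
\<close>

section \<open>Tensor products and multilinear maps\<close>

text \<open>\<open>average\<close> is the analogue of the mean of g p g^-1 over a group, with
  \<open>antipode\<close> for the inverse and \<open>t\<close> for the mean. Elements of L tensor H
  are only lists modulo \<open>tensor_eq\<close>, so identities between them are tested on bilinear
  and trilinear maps; scalar-valued bilinear maps suffice to return to an equality of tensors. The
  projection \<open>p\<close> commutes with B alone, whereas the coaction spreads an element of B
  over a list; coinvariance of B allows this list to be chosen in B.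

  On the Lie side every module is a subspace of L under \<open>bracket\<close>, and every
  subquotient is a pair of such subspaces. The inclusion [L, R] \<subseteq> N is proved by traces
  instead of Lie's theorem, which would need eigenvalues; eigenvalues enter only in Cartan's
  criterion, so scalars are extended only there. B need not act faithfully on the module of the
  cocycle, whereas a Casimir operator needs a faithful action. Hence B is split into the kernel of
  the action and its orthogonal ideal; the kernel, being perfect, annihilates the cocycle as
  well.\<close>

definition tensor_sum :: "('v \<Rightarrow> 'w \<Rightarrow> 'z::comm_monoid_add) \<Rightarrow> ('v \<times> 'w) list \<Rightarrow> 'z" where
  "tensor_sum f xs = (\<Sum>(x, y)\<leftarrow>xs. f x y)"

lemma tensor_sum_simps [simp]:
  "tensor_sum f [] = 0"
  "tensor_sum f ((x, y) # xs) = f x y + tensor_sum f xs"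
  "tensor_sum f (xs @ ys) = tensor_sum f xs + tensor_sum f ys"
  by (simp_all add: tensor_sum_def)

lemma tensor_sum_add: "tensor_sum (\<lambda>x y. f x y + g x y) xs = tensor_sum f xs + tensor_sum g xs"
  by (induction xs) (auto simp: ac_simps)

lemma tensor_sum_diff:
  "tensor_sum (\<lambda>x y. f x y - g x y :: 'z::ab_group_add) xs = tensor_sum f xs - tensor_sum g xs"
  by (induction xs) (auto simp: algebra_simps)

lemma tensor_sum_zero [simp]: "tensor_sum (\<lambda>x y. 0) xs = 0"
  by (induction xs) auto

lemma tensor_sum_cong:
  "(\<And>x y. (x, y) \<in> set xs \<Longrightarrow> f x y = g x y) \<Longrightarrow> tensor_sum f xs = tensor_sum g xs"
  by (induction xs) auto

lemma tensor_sum_swap: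
  "tensor_sum (\<lambda>x y. tensor_sum (f x y) ys) xs
    = tensor_sum (\<lambda>u v. tensor_sum (\<lambda>x y. f x y u v) xs) ys"
  by (induction xs) (auto simp: tensor_sum_add)

lemma tensor_sum_map:
  "tensor_sum f (map (\<lambda>(x, y). (g x y, h x y)) xs) = tensor_sum (\<lambda>x y. f (g x y) (h x y)) xs"
  by (induction xs) auto

lemma linearI:
  assumes "vector_space s1" "vector_space s2"
    and "\<And>x y. f (x + y) = f x + f y" "\<And>c x. f (s1 c x) = s2 c (f x)"
  shows "Vector_Spaces.linear s1 s2 f"
  using assms by (simp add: Vector_Spaces.linear_iff)

lemma linear_addD: "Vector_Spaces.linear s1 s2 f \<Longrightarrow> f (x + y) = f x + f y"
  and linear_scaleD: "Vector_Spaces.linear s1 s2 f \<Longrightarrow> f (s1 c x) = s2 c (f x)"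
  by (simp_all add: Vector_Spaces.linear_iff)

lemma linear_zeroD: "Vector_Spaces.linear s1 s2 f \<Longrightarrow> f 0 = 0"
  using linear_addD[of s1 s2 f 0 0] by simp

lemma linear_diffD:
  assumes "Vector_Spaces.linear s1 s2 f"
  shows "f (x - y) = f x - f y"
  using linear_addD[OF assms, of "x - y" y] by (simp add: algebra_simps)

lemma linear_tensor_sum:
  assumes "Vector_Spaces.linear s1 s2 f"
  shows "f (tensor_sum g xs) = tensor_sum (\<lambda>x y. f (g x y)) xs"
  by (induction xs) (auto simp: linear_addD[OF assms] linear_zeroD[OF assms])

definition bilinear_map where
  "bilinear_map sV sW sZ f \<longleftrightarrow>
     (\<forall>y. Vector_Spaces.linear sV sZ (\<lambda>x. f x y)) \<and> (\<forall>x. Vector_Spaces.linear sW sZ (f x))"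

definition trilinear_map where
  "trilinear_map sU sV sW sZ f \<longleftrightarrow>
     (\<forall>y z. Vector_Spaces.linear sU sZ (\<lambda>x. f x y z)) \<and>
     (\<forall>x z. Vector_Spaces.linear sV sZ (\<lambda>y. f x y z)) \<and>
     (\<forall>x y. Vector_Spaces.linear sW sZ (f x y))"

lemma bilinear_mapI:
  assumes "\<And>y. Vector_Spaces.linear sV sZ (\<lambda>x. f x y)" "\<And>x. Vector_Spaces.linear sW sZ (\<lambda>y. f x y)"
  shows "bilinear_map sV sW sZ f"
  using assms by (simp add: bilinear_map_def)

lemma trilinear_mapI:
  assumes "\<And>y z. Vector_Spaces.linear sU sZ (\<lambda>x. f x y z)"
    and "\<And>x z. Vector_Spaces.linear sV sZ (\<lambda>y. f x y z)"
    and "\<And>x y. Vector_Spaces.linear sW sZ (\<lambda>z. f x y z)"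
  shows "trilinear_map sU sV sW sZ f"
  using assms by (simp add: trilinear_map_def)

lemma linear_tensor_sum_param:
  assumes "vector_space s1" "vector_space s2" "\<And>x y. Vector_Spaces.linear s1 s2 (\<lambda>a. f a x y)"
  shows "Vector_Spaces.linear s1 s2 (\<lambda>a. tensor_sum (f a) xs)"
proof (induction xs)
  case Nil
  show ?case
    using assms vector_space_pair.linear_zero[of s1 s2] by (simp add: vector_space_pair_def)
next
  case (Cons a xs)
  obtain x y where "a = (x, y)" by force
  then show ?case
    using Cons assms by (simp add: Vector_Spaces.linear_iff) (simp add: ac_simps vector_space.vector_space_assms(1))
qed

lemma linear_compose2:
  assumes "Vector_Spaces.linear s2 s3 g" "Vector_Spaces.linear s1 s2 f"
  shows "Vector_Spaces.linear s1 s3 (\<lambda>x. g (f x))"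
  using assms by (simp add: Vector_Spaces.linear_iff)

section \<open>Linear maps on free vector spaces and on tensor products\<close>

definition free_extension ::
  "('f::field \<Rightarrow> 'z::ab_group_add \<Rightarrow> 'z) \<Rightarrow> ('x \<Rightarrow> 'z) \<Rightarrow> ('x \<Rightarrow>\<^sub>0 'f) \<Rightarrow> 'z" where
  "free_extension s g p = (\<Sum>x\<in>Poly_Mapping.keys p. s (Poly_Mapping.lookup p x) (g x))"

context
  fixes s :: "'f::field \<Rightarrow> 'z::ab_group_add \<Rightarrow> 'z"
  assumes vs: "vector_space s"
begin

interpretation vector_space s by (rule vs)

lemma free_extension_eq:
  fixes p :: "'x \<Rightarrow>\<^sub>0 'f"
  assumes "finite A" "Poly_Mapping.keys p \<subseteq> A"
  shows "free_extension s g p = (\<Sum>x\<in>A. s (Poly_Mapping.lookup p x) (g x))"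
  unfolding free_extension_def using assms
  by (intro sum.mono_neutral_left) (auto simp: in_keys_iff)

lemma linear_free_extension: "Vector_Spaces.linear free_scale s (free_extension s (g :: 'x \<Rightarrow> 'z))"
proof (rule linearI)
  fix p q :: "'x \<Rightarrow>\<^sub>0 'f"
  let ?A = "Poly_Mapping.keys p \<union> Poly_Mapping.keys q"
  have "Poly_Mapping.keys (p + q) \<subseteq> ?A"
    by (rule keys_add)
  then show "free_extension s g (p + q) = free_extension s g p + free_extension s g q"
    by (simp add: free_extension_eq[of ?A] lookup_add scale_left_distrib sum.distrib)
next
  fix c and p :: "'x \<Rightarrow>\<^sub>0 'f"
  have "Poly_Mapping.keys (free_scale c p) \<subseteq> Poly_Mapping.keys p"
    by (auto simp: in_keys_iff lookup_free_scale)
  then show "free_extension s g (free_scale c p) = s c (free_extension s g p)"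
    by (simp add: free_extension_eq[of "Poly_Mapping.keys p"] lookup_free_scale scale_sum_right)
qed (auto simp: vector_space_free_scale vector_space_axioms)

lemma free_extension_single [simp]: "free_extension s g (Poly_Mapping.single x 1) = g x"
  by (simp add: free_extension_def)

lemma free_extension_formal_sum: "free_extension s g (formal_sum xs) = (\<Sum>x\<leftarrow>xs. g x)"
  by (induction xs) (auto simp: formal_sum_def linear_addD[OF linear_free_extension]
      linear_zeroD[OF linear_free_extension])

lemma free_extension_zero_on_span:
  fixes p :: "'x \<Rightarrow>\<^sub>0 'f"
  assumes "\<And>r. r \<in> Rel \<Longrightarrow> free_extension s g r = 0" "p \<in> module.span free_scale Rel"
  shows "free_extension s g p = 0"
proof -
  interpret V: vector_space_pair "free_scale :: 'f \<Rightarrow> ('x \<Rightarrow>\<^sub>0 'f) \<Rightarrow> _" s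
    by (simp add: vector_space_pair_def vector_space_free_scale vector_space_axioms)
  show ?thesis
    using V.linear_eq_0_on_span[OF linear_free_extension, of Rel g p] assms by blast
qed

lemma free_extension_linear_relations:
  assumes "Vector_Spaces.linear s' s (\<lambda>v. g (e v))"
    and "r \<in> linear_relations s' (\<lambda>v. Poly_Mapping.single (e v) 1)"
  shows "free_extension s g r = 0"
  using assms unfolding linear_relations_def
  by (auto simp: linear_diffD[OF linear_free_extension] linear_scaleD[OF linear_free_extension]
      linear_addD[OF assms(1)] linear_scaleD[OF assms(1)])

text \<open>The linear extension of \<open>f\<close> to the free vector space kills the bilinear
  relations, hence their span. Thus \<open>tensor_sum f\<close> is the linear map that
  \<open>f\<close> induces on the tensor product.\<close>

lemma tensor_eq_tensor_sum:
  assumes "tensor_eq sV sW xs ys" "bilinear_map sV sW s f"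
  shows "tensor_sum f xs = tensor_sum f ys"
proof -
  let ?g = "\<lambda>(x, y). f x y"
  have "free_extension s ?g (formal_sum xs - formal_sum ys) = 0"
  proof (rule free_extension_zero_on_span)
    show "formal_sum xs - formal_sum ys \<in> module.span free_scale (tensor_relations sV sW)"
      using assms(1) by (simp add: tensor_eq_def)
    fix r assume "r \<in> tensor_relations sV sW"
    then show "free_extension s ?g r = 0"
      using assms(2) unfolding tensor_relations_def bilinear_map_def
      by (auto intro: free_extension_linear_relations[of sV ?g "\<lambda>v. (v, _)"]
          free_extension_linear_relations[of sW ?g "\<lambda>w. (_, w)"])
  qed
  then show ?thesis
    by (simp add: linear_diffD[OF linear_free_extension] free_extension_formal_sum tensor_sum_def)
qed

lemma tensor3_eq_sum:
  assumes "tensor3_eq sU sV sW xs ys" "trilinear_map sU sV sW s f"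
  shows "(\<Sum>(x, y, z)\<leftarrow>xs. f x y z) = (\<Sum>(x, y, z)\<leftarrow>ys. f x y z)"
proof -
  let ?g = "\<lambda>(x, y, z). f x y z"
  have "free_extension s ?g (formal_sum xs - formal_sum ys) = 0"
  proof (rule free_extension_zero_on_span)
    show "formal_sum xs - formal_sum ys \<in> module.span free_scale (tensor3_relations sU sV sW)"
      using assms(1) by (simp add: tensor3_eq_def)
    fix r assume "r \<in> tensor3_relations sU sV sW"
    then show "free_extension s ?g r = 0"
      using assms(2) unfolding tensor3_relations_def trilinear_map_def
      by (auto intro: free_extension_linear_relations[of sU ?g "\<lambda>u. (u, _, _)"]
          free_extension_linear_relations[of sV ?g "\<lambda>v. (_, v, _)"]
          free_extension_linear_relations[of sW ?g "\<lambda>w. (_, _, w)"])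
  qed
  then show ?thesis
    by (simp add: linear_diffD[OF linear_free_extension] free_extension_formal_sum)
qed

end

text \<open>If the formal sums differ modulo the relations, some functional on the free vector space
  is 1 on their difference and 0 on all relations. Restricted to single pairs it is a bilinear form
  that tells the two lists apart.\<close>

lemma tensor_eqI:
  fixes sV :: "'f::field \<Rightarrow> 'v::ab_group_add \<Rightarrow> 'v" and sW :: "'f \<Rightarrow> 'w::ab_group_add \<Rightarrow> 'w"
  assumes vs: "vector_space sV" "vector_space sW"
    and eq: "\<And>f. bilinear_map sV sW (*) f \<Longrightarrow> tensor_sum f xs = tensor_sum f ys"
  shows "tensor_eq sV sW xs ys"
proof (rule ccontr)
  let ?d = "formal_sum xs - formal_sum ys :: ('v \<times> 'w) \<Rightarrow>\<^sub>0 'f"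
  let ?Rel = "tensor_relations sV sW"
  interpret F: vector_space "(*) :: 'f \<Rightarrow> 'f \<Rightarrow> 'f"
    by unfold_locales (simp_all add: algebra_simps)
  interpret V: vector_space_pair "free_scale :: 'f \<Rightarrow> ('v \<times> 'w \<Rightarrow>\<^sub>0 'f) \<Rightarrow> _" "(*) :: 'f \<Rightarrow> 'f \<Rightarrow> 'f"
    by (simp add: vector_space_pair_def vector_space_free_scale F.vector_space_axioms)
  assume "\<not> tensor_eq sV sW xs ys"
  then have d: "?d \<notin> V.vs1.span ?Rel"
    by (simp add: tensor_eq_def)
  \<comment> \<open>Values of a functional can be prescribed only on an independent set, so the
    relations are thinned out to a maximal independent subset, which stays independent when the
    difference is added.\<close>
  obtain C where C: "C \<subseteq> ?Rel" "V.vs1.independent C" "?Rel \<subseteq> V.vs1.span C"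
    using V.vs1.maximal_independent_subset by blast
  have dC: "?d \<notin> V.vs1.span C"
    using d C(1) V.vs1.span_mono by blast
  then obtain \<xi> where \<xi>: "Vector_Spaces.linear free_scale (*) \<xi>"
      "\<forall>x\<in>insert ?d C. \<xi> x = (if x = ?d then 1 else 0)"
    using V.linear_independent_extend[OF V.vs1.independent_insertI[OF dC C(2)],
        of "\<lambda>x. if x = ?d then 1 else 0"] by blast
  have "\<xi> c = 0" if "c \<in> C" for c
    using \<xi>(2) that dC V.vs1.span_base by (metis insertCI)
  then have rel: "\<xi> r = 0" if "r \<in> ?Rel" for r
    using V.linear_eq_0_on_span[OF \<xi>(1)] C(3) that by blast
  let ?f = "\<lambda>x y. \<xi> (Poly_Mapping.single (x, y) 1)"
  have lin: "Vector_Spaces.linear s (*) (\<lambda>v. \<xi> (e v))"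
    if s: "vector_space s" and sub: "linear_relations s e \<subseteq> ?Rel" for s and e :: "'z::ab_group_add \<Rightarrow> _"
  proof (rule linearI[OF s F.vector_space_axioms])
    fix x y
    have "\<xi> (e (x + y) - e x - e y) = 0"
      by (rule rel, rule subsetD[OF sub]) (auto simp: linear_relations_def)
    then show "\<xi> (e (x + y)) = \<xi> (e x) + \<xi> (e y)"
      unfolding linear_diffD[OF \<xi>(1)] by (simp add: algebra_simps)
  next
    fix c x
    have "\<xi> (e (s c x) - free_scale c (e x)) = 0"
      by (rule rel, rule subsetD[OF sub]) (auto simp: linear_relations_def)
    then show "\<xi> (e (s c x)) = c * \<xi> (e x)"
      unfolding linear_diffD[OF \<xi>(1)] linear_scaleD[OF \<xi>(1)] by simp
  qed
  have "bilinear_map sV sW (*) ?f"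
    by (intro bilinear_mapI lin vs) (auto simp: tensor_relations_def)
  from eq[OF this] have "tensor_sum ?f xs = tensor_sum ?f ys" .
  moreover have "\<xi> (formal_sum zs) = tensor_sum ?f zs" for zs
    by (induction zs) (auto simp: formal_sum_def linear_addD[OF \<xi>(1)] linear_zeroD[OF \<xi>(1)])
  ultimately have "\<xi> ?d = 0"
    by (simp add: linear_diffD[OF \<xi>(1)])
  then show False
    using \<xi>(2) by simp
qed

section \<open>Hopf algebras\<close>

lemma tensor_sum_mult_right: "tensor_sum (\<lambda>x y. f x y * (c :: 'a::semiring_0)) xs = tensor_sum f xs * c"
  by (induction xs) (auto simp: algebra_simps)

lemma tensor_sum_mult_left: "tensor_sum (\<lambda>x y. (c :: 'a::semiring_0) * f x y) xs = c * tensor_sum f xs"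
  by (induction xs) (auto simp: algebra_simps)

lemma (in vector_space) tensor_sum_scale:
  "tensor_sum (\<lambda>x y. scale c (f x y)) xs = scale c (tensor_sum f xs)"
  "tensor_sum (\<lambda>x y. scale (g x y) v) xs = scale (tensor_sum g xs) v"
  by (induction xs) (auto simp: algebra_simps)

lemma vector_space_self: "vector_space ((*) :: 'f::field \<Rightarrow> 'f \<Rightarrow> 'f)"
  by unfold_locales (simp_all add: algebra_simps)

lemma bilinear_mapD:
  assumes "bilinear_map sV sW sZ f"
  shows "f (x + x') y = f x y + f x' y" "f (sV c x) y = sZ c (f x y)"
    "f x (y + y') = f x y + f x y'" "f x (sW c y) = sZ c (f x y)"
    "vector_space sV" "vector_space sW" "vector_space sZ"
  using assms by (simp_all add: bilinear_map_def Vector_Spaces.linear_iff)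

lemma trilinear_mapD:
  assumes "trilinear_map sU sV sW sZ f"
  shows "bilinear_map sU sV sZ (\<lambda>x y. f x y z)" "bilinear_map sV sW sZ (\<lambda>y z. f x y z)"
  using assms by (simp_all add: bilinear_map_def trilinear_map_def)

lemma tensor_linear_sum:
  assumes "tensor_linear sU sV sW \<rho>" "bilinear_map sV sW sZ f" "vector_space sU"
  shows "Vector_Spaces.linear sU sZ (\<lambda>a. tensor_sum f (\<rho> a))"
proof (rule linearI)
  note f = bilinear_mapD[OF assms(2)]
  interpret Z: vector_space sZ by (rule f)
  show "vector_space sU" "vector_space sZ" by (rule assms f)+
  show "tensor_sum f (\<rho> (x + y)) = tensor_sum f (\<rho> x) + tensor_sum f (\<rho> y)" for x y
    using tensor_eq_tensor_sum[OF f(7) _ assms(2), of "\<rho> (x + y)" "\<rho> x @ \<rho> y"] assms(1)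
    by (simp add: tensor_linear_def)
  show "tensor_sum f (\<rho> (sU c x)) = sZ c (tensor_sum f (\<rho> x))" for c x
  proof -
    have "tensor_sum f (\<rho> (sU c x)) = tensor_sum f (map (\<lambda>(x, y). (sV c x, y)) (\<rho> x))"
      using tensor_eq_tensor_sum[OF f(7) _ assms(2)] assms(1)
      by (simp add: tensor_linear_def)
    then show ?thesis
      by (simp add: tensor_sum_map[of f "\<lambda>x y. sV c x" "\<lambda>x y. y"] f Z.tensor_sum_scale)
  qed
qed

lemma sum_list_concat_triples:
  "(\<Sum>(u, v, w)\<leftarrow>[(u, v, y). (x, y) \<leftarrow> xs, (u, v) \<leftarrow> r x]. f u v w)
     = tensor_sum (\<lambda>x y. tensor_sum (\<lambda>u v. f u v y) (r x)) xs"
  "(\<Sum>(u, v, w)\<leftarrow>[(x, u, v). (x, y) \<leftarrow> xs, (u, v) \<leftarrow> r' y]. f u v w)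
     = tensor_sum (\<lambda>x y. tensor_sum (\<lambda>u v. f x u v) (r' y)) xs"
  by (induction xs) (auto simp: tensor_sum_def comp_def case_prod_unfold)

context coalgebra
begin

lemma linear_comult:
  "bilinear_map scale scale s f \<Longrightarrow> Vector_Spaces.linear scale s (\<lambda>a. tensor_sum f (comult a))"
  by (rule tensor_linear_sum[OF comult_linear _ vector_space_axioms])

lemma coassoc_sum:
  assumes "trilinear_map scale scale scale s f" "vector_space s"
  shows "tensor_sum (\<lambda>x y. tensor_sum (\<lambda>u v. f u v y) (comult x)) (comult a)
    = tensor_sum (\<lambda>x y. tensor_sum (\<lambda>u v. f x u v) (comult y)) (comult a)"
  using tensor3_eq_sum[OF assms(2) coassoc assms(1)] unfolding sum_list_concat_triples .

lemma counit_sum_left: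
  assumes "Vector_Spaces.linear scale s g"
  shows "tensor_sum (\<lambda>x y. s (counit x) (g y)) (comult a) = g a"
proof -
  have "g a = g (tensor_sum (\<lambda>x y. scale (counit x) y) (comult a))"
    using counit_left[of a] by (simp add: tensor_sum_def)
  then show ?thesis
    by (simp add: linear_tensor_sum[OF assms] linear_scaleD[OF assms])
qed

lemma counit_sum_right:
  assumes "Vector_Spaces.linear scale s g"
  shows "tensor_sum (\<lambda>x y. s (counit y) (g x)) (comult a) = g a"
proof -
  have "g a = g (tensor_sum (\<lambda>x y. scale (counit y) x) (comult a))"
    using counit_right[of a] by (simp add: tensor_sum_def)
  then show ?thesis
    by (simp add: linear_tensor_sum[OF assms] linear_scaleD[OF assms])
qed

end

context hopf_algebra
begin

lemmas antipode_add = linear_addD[OF antipode_linear]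
  and antipode_scale = linear_scaleD[OF antipode_linear]

lemmas linear_simps = antipode_add antipode_scale mult_scale_left mult_scale_right distrib_left
  distrib_right scale_right_distrib scale_left_distrib scale_left_commute

lemma comult_mult_sum:
  assumes "bilinear_map scale scale s f"
  shows "tensor_sum f (comult (a * b))
    = tensor_sum (\<lambda>x y. tensor_sum (\<lambda>x' y'. f (x * x') (y * y')) (comult b)) (comult a)"
proof -
  have eq: "tensor_sum f [(x * x', y * y'). (x, y) \<leftarrow> xs, (x', y') \<leftarrow> ys]
    = tensor_sum (\<lambda>x y. tensor_sum (\<lambda>x' y'. f (x * x') (y * y')) ys) xs" for xs ys
    by (induction xs) (auto simp: tensor_sum_def comp_def case_prod_unfold)
  show ?thesis
    using tensor_eq_tensor_sum[OF bilinear_mapD(7)[OF assms] comult_mult assms] by (simp add: eq)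
qed

lemma antipode_sum_left: "tensor_sum (\<lambda>x y. antipode x * y) (comult a) = scale (counit a) 1"
  and antipode_sum_right: "tensor_sum (\<lambda>x y. x * antipode y) (comult a) = scale (counit a) 1"
  using antipode_left antipode_right by (simp_all add: tensor_sum_def)

lemma linear_tensor_sum_comult:
  assumes "\<And>x y. Vector_Spaces.linear scale s (\<lambda>a. f a x y)" "vector_space s"
  shows "Vector_Spaces.linear scale s (\<lambda>a. tensor_sum (f a) xs)"
  by (rule linear_tensor_sum_param[OF vector_space_axioms assms(2,1)])

lemma linear_selfI:
  assumes "\<And>x y. f (x + y) = f x + f y" "\<And>c x. f (scale c x) = scale c (f x)"
  shows "Vector_Spaces.linear scale scale f"
  using assms by (simp add: Vector_Spaces.linear_iff vector_space_axioms)

text \<open>Both sides are convolution inverses of the multiplication map of H. \<open>F\<close> is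
  the summand of the triple convolution of S(ab), ab and S(b)S(a), with the splitting of
  \<open>b\<close> carried out and that of \<open>a\<close> left open. Associating the splitting of
  \<open>a\<close> in two ways yields the two sides.\<close>

lemma antipode_mult: "antipode (a * b) = antipode b * antipode a"
proof -
  let ?S = antipode
  define F where "F p1 p2 q = tensor_sum (\<lambda>u v. tensor_sum (\<lambda>u1 u2.
      ?S (p1 * u1) * (p2 * u2) * (?S v * ?S q)) (comult u)) (comult b)" for p1 p2 q
  have tri: "trilinear_map scale scale scale scale F"
    unfolding F_def
    by (intro trilinear_mapI linear_tensor_sum_comult linear_selfI vector_space_axioms)
      (simp_all add: linear_simps)
  have "tensor_sum (\<lambda>p q. tensor_sum (\<lambda>p1 p2. F p1 p2 q) (comult p)) (comult a)
      = tensor_sum (\<lambda>p q. tensor_sum (\<lambda>u v. 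
          tensor_sum (\<lambda>p1 p2. tensor_sum (\<lambda>u1 u2. ?S (p1 * u1) * (p2 * u2)) (comult u)) (comult p) * (?S v * ?S q)) (comult b)) (comult a)"
    unfolding F_def tensor_sum_mult_right[symmetric]
    by (subst tensor_sum_swap[of _ "comult b"]) simp
  also have "\<dots> = tensor_sum (\<lambda>p q. tensor_sum (\<lambda>u v. 
          scale (counit (p * u)) 1 * (?S v * ?S q)) (comult b)) (comult a)"
    unfolding antipode_sum_left[symmetric]
    by (subst comult_mult_sum[of scale]) 
      (auto intro!: bilinear_mapI linear_selfI simp: linear_simps)
  also have "\<dots> = tensor_sum (\<lambda>p q. scale (counit p) (tensor_sum (\<lambda>u v. 
          scale (counit u) (?S v)) (comult b) * ?S q)) (comult a)"
    by (simp add: counit_mult mult_scale_left tensor_sum_scale flip: tensor_sum_mult_right mult.assoc scale_scale)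
  also have "\<dots> = ?S b * ?S a"
    by (simp add: counit_sum_left[OF antipode_linear])
      (rule counit_sum_left, rule linear_selfI, simp_all add: linear_simps)
  finally have 1: "tensor_sum (\<lambda>p q. tensor_sum (\<lambda>p1 p2. F p1 p2 q) (comult p)) (comult a) = ?S b * ?S a" .

  \<comment> \<open>Coassociativity in \<open>b\<close> moves the splitting onto the last two
    factors; there it collapses to the counit, and the first factor is left with all of
    \<open>b\<close>.\<close>
  have F2: "F p q1 q2 = ?S (p * b) * (q1 * ?S q2)" for p q1 q2
  proof -
    have "F p q1 q2 = tensor_sum (\<lambda>u v. tensor_sum (\<lambda>v1 v2.
      ?S (p * u) * (q1 * v1) * (?S v2 * ?S q2)) (comult v)) (comult b)"
      unfolding F_def
      by (rule coassoc_sum[of scale "\<lambda>u1 u2 v. ?S (p * u1) * (q1 * u2) * (?S v * ?S q2)"])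
        (auto intro!: trilinear_mapI linear_selfI vector_space_axioms simp: linear_simps)
    also have "\<dots> = tensor_sum (\<lambda>u v. ?S (p * u) * (q1 * (tensor_sum (\<lambda>v1 v2. v1 * ?S v2) (comult v) * ?S q2))) (comult b)"
      unfolding tensor_sum_mult_right[symmetric] tensor_sum_mult_left[symmetric] by (simp add: mult.assoc)
    also have "\<dots> = tensor_sum (\<lambda>u v. scale (counit v) (?S (p * u) * (q1 * ?S q2))) (comult b)"
      by (simp add: antipode_sum_right mult_scale_left mult_scale_right)
    also have "\<dots> = ?S (p * b) * (q1 * ?S q2)"
      by (rule counit_sum_right, rule linear_selfI, simp_all add: linear_simps)
    finally show ?thesis .
  qed
  have "tensor_sum (\<lambda>p q. tensor_sum (\<lambda>q1 q2. F p q1 q2) (comult q)) (comult a)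
     = tensor_sum (\<lambda>p q. scale (counit q) (?S (p * b))) (comult a)"
    unfolding F2 tensor_sum_mult_left by (simp add: antipode_sum_right mult_scale_right)
  also have "\<dots> = ?S (a * b)"
    by (rule counit_sum_right, rule linear_selfI, simp_all add: linear_simps)
  finally show ?thesis
    using 1 coassoc_sum[OF tri vector_space_axioms] by simp
qed

text \<open>In Sweedler notation t(h_2 S(k)) h_1 = t(h S(k_1)) k_2, the identity behind colinearity
  of the average. With \<Phi>(a, k) for the left side, \<open>key\<close> gives t(h S(k_1)) k_2 =
  \<Phi>(h S(k_1) k_2, k_3), and S(k_1) k_2 cancels. In this way the coproduct of S(k) never has to
  be computed.\<close>

lemma left_integral_antipode:
  assumes "left_integral t"
  shows "tensor_sum (\<lambda>x y. scale (t (y * antipode k)) x) (comult h)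
    = tensor_sum (\<lambda>x y. scale (t (h * antipode x)) y) (comult k)"
proof -
  let ?S = antipode
  have t: "Vector_Spaces.linear scale (*) t"
    and int: "tensor_sum (\<lambda>x y. scale (t y) x) (comult a) = scale (t a) 1" for a
    using assms by (simp_all add: left_integral_def tensor_sum_def)
  note t_simps = linear_addD[OF t] linear_scaleD[OF t]
  define \<Phi> where "\<Phi> a k = tensor_sum (\<lambda>x y. scale (t (y * ?S k)) x) (comult a)" for a k
  have bi: "bilinear_map scale scale scale (\<lambda>x y. scale (t (y * ?S k)) x)" for k
    by (auto intro!: bilinear_mapI linear_selfI simp: linear_simps t_simps)
  have \<Phi>: "Vector_Spaces.linear scale scale (\<lambda>a. \<Phi> a k)" for k
    unfolding \<Phi>_def by (rule linear_comult[OF bi])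
  have \<Phi>': "Vector_Spaces.linear scale scale (\<lambda>k. \<Phi> a k)" for a
    unfolding \<Phi>_def
    by (intro linear_tensor_sum_comult linear_selfI vector_space_axioms)
      (simp_all add: linear_simps t_simps)
  \<comment> \<open>That is, t(p_2 y_2 S(y_3)) p_1 y_1 = t(p_2) p_1 y = t(p) y, by the antipode
    axiom and then the integral property.\<close>
  have key: "tensor_sum (\<lambda>u w. \<Phi> (p * u) w) (comult y) = scale (t p) y" for p y
  proof -
    have "tensor_sum (\<lambda>u w. \<Phi> (p * u) w) (comult y) = tensor_sum (\<lambda>u w.
       tensor_sum (\<lambda>p1 p2. tensor_sum (\<lambda>u1 u2. scale (t (p2 * u2 * ?S w)) (p1 * u1)) (comult u)) (comult p)) (comult y)"
      unfolding \<Phi>_def by (subst comult_mult_sum[OF bi]) simp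
    also have "\<dots> = tensor_sum (\<lambda>p1 p2. tensor_sum (\<lambda>u w.
       tensor_sum (\<lambda>u1 u2. scale (t (p2 * u2 * ?S w)) (p1 * u1)) (comult u)) (comult y)) (comult p)"
      by (rule tensor_sum_swap)
    also have "\<dots> = tensor_sum (\<lambda>p1 p2. tensor_sum (\<lambda>u w.
       tensor_sum (\<lambda>w1 w2. scale (t (p2 * w1 * ?S w2)) (p1 * u)) (comult w)) (comult y)) (comult p)"
      by (subst coassoc_sum[of scale "\<lambda>u1 u2 w. scale (t (_ * u2 * ?S w)) (_ * u1)"])
        (auto intro!: trilinear_mapI linear_selfI vector_space_axioms simp: linear_simps t_simps)
    also have "\<dots> = tensor_sum (\<lambda>p1 p2. tensor_sum (\<lambda>u w.
       scale (t (p2 * tensor_sum (\<lambda>w1 w2. w1 * ?S w2) (comult w))) (p1 * u)) (comult y)) (comult p)"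
      by (simp add: tensor_sum_scale linear_tensor_sum[OF t] mult.assoc flip: tensor_sum_mult_left)
    also have "\<dots> = tensor_sum (\<lambda>p1 p2. scale (t p2) (p1 * tensor_sum (\<lambda>u w. scale (counit w) u) (comult y))) (comult p)"
      by (simp add: antipode_sum_right mult_scale_right t_simps mult.commute scale_left_commute
           flip: tensor_sum_mult_left tensor_sum_scale scale_scale)
    also have "\<dots> = tensor_sum (\<lambda>p1 p2. scale (t p2) p1) (comult p) * y"
      using counit_sum_right[OF linear_id, of y]
      by (simp add: mult_scale_left flip: tensor_sum_mult_right)
    also have "\<dots> = scale (t p) y"
      by (simp add: int mult_scale_left)
    finally show ?thesis .
  qed
  have "tensor_sum (\<lambda>x y. scale (t (h * ?S x)) y) (comult k)
     = tensor_sum (\<lambda>x y. tensor_sum (\<lambda>u w. \<Phi> (h * ?S x * u) w) (comult y)) (comult k)"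
    by (simp add: key)
  also have "\<dots> = tensor_sum (\<lambda>x y. tensor_sum (\<lambda>u w. \<Phi> (h * ?S u * w) y) (comult x)) (comult k)"
    by (rule coassoc_sum[symmetric, of scale "\<lambda>x u w. \<Phi> (h * ?S x * u) w"])
      (auto intro!: trilinear_mapI linear_selfI vector_space_axioms
        simp: linear_simps linear_addD[OF \<Phi>] linear_addD[OF \<Phi>'] linear_scaleD[OF \<Phi>] linear_scaleD[OF \<Phi>'])
  also have "\<dots> = tensor_sum (\<lambda>x y. \<Phi> (h * tensor_sum (\<lambda>u w. ?S u * w) (comult x)) y) (comult k)"
    by (simp add: linear_tensor_sum[OF \<Phi>] mult.assoc flip: tensor_sum_mult_left)
  also have "\<dots> = tensor_sum (\<lambda>x y. scale (counit x) (\<Phi> h y)) (comult k)"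
    by (simp add: antipode_sum_left mult_scale_right linear_scaleD[OF \<Phi>])
  also have "\<dots> = \<Phi> h k"
    by (rule counit_sum_left[OF \<Phi>'])
  finally show ?thesis
    by (simp add: \<Phi>_def)
qed

end

section \<open>Averaging over a comodule\<close>

context right_comodule
begin

lemma linear_coact:
  "bilinear_map scaleL scaleH s f \<Longrightarrow> Vector_Spaces.linear scaleL s (\<lambda>a. tensor_sum f (coact a))"
  by (rule tensor_linear_sum[OF coact_linear _ L.vector_space_axioms])

lemma coact_coassoc_sum:
  assumes "trilinear_map scaleL scaleH scaleH s f" "vector_space s"
  shows "tensor_sum (\<lambda>x k. tensor_sum (\<lambda>u h. f u h k) (coact x)) (coact a)
    = tensor_sum (\<lambda>x y. tensor_sum (\<lambda>h k. f x h k) (comult y)) (coact a)"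
  using tensor3_eq_sum[OF assms(2) coact_coassoc assms(1)] unfolding sum_list_concat_triples .

lemma coact_counit_sum:
  assumes "Vector_Spaces.linear scaleL s g"
  shows "tensor_sum (\<lambda>x h. s (counit h) (g x)) (coact a) = g a"
proof -
  have "g a = g (tensor_sum (\<lambda>x h. scaleL (counit h) x) (coact a))"
    using coact_counit[of a] by (simp add: tensor_sum_def)
  then show ?thesis
    by (simp add: linear_tensor_sum[OF assms] linear_scaleD[OF assms])
qed

lemma subcomoduleE:
  assumes "subcomodule W" "a \<in> W"
  obtains xs where "set xs \<subseteq> W \<times> UNIV" "tensor_eq scaleL scaleH (coact a) xs"
  using assms unfolding subcomodule_def by blast

end

context comodule_lie_algebra
begin

lemmas bracket_simps =
  linear_addD[OF L.bracket_linear_left] linear_scaleD[OF L.bracket_linear_left]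
  linear_addD[OF L.bracket_linear_right] linear_scaleD[OF L.bracket_linear_right]

lemma coact_bracket_sum:
  assumes "bilinear_map scaleL scaleH s f"
  shows "tensor_sum f (coact (bracket a b))
    = tensor_sum (\<lambda>x h. tensor_sum (\<lambda>y k. f (bracket x y) (h * k)) (coact b)) (coact a)"
proof -
  have eq: "tensor_sum f [(bracket x y, h * k). (x, h) \<leftarrow> xs, (y, k) \<leftarrow> ys]
    = tensor_sum (\<lambda>x h. tensor_sum (\<lambda>y k. f (bracket x y) (h * k)) ys) xs" for xs ys
    by (induction xs) (auto simp: tensor_sum_def comp_def case_prod_unfold)
  show ?thesis
    using tensor_eq_tensor_sum[OF bilinear_mapD(7)[OF assms] coact_bracket assms] by (simp add: eq)
qed

lemma linear_tensor_sum_coact: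
  assumes "\<And>x y. Vector_Spaces.linear scaleL scaleL (\<lambda>a. f a x y)"
  shows "Vector_Spaces.linear scaleL scaleL (\<lambda>a. tensor_sum (f a) xs)"
  by (rule linear_tensor_sum_param[OF L.vector_space_axioms L.vector_space_axioms assms])

lemma linear_tensor_sum_coactH:
  assumes "\<And>x y. Vector_Spaces.linear scaleH scaleL (\<lambda>a. f a x y)"
  shows "Vector_Spaces.linear scaleH scaleL (\<lambda>a. tensor_sum (f a) xs)"
  by (rule linear_tensor_sum_param[OF H.vector_space_axioms L.vector_space_axioms assms])

lemma linear_LLI:
  assumes "\<And>x y. f (x + y) = f x + f y" "\<And>c x. f (scaleL c x) = scaleL c (f x)"
  shows "Vector_Spaces.linear scaleL scaleL f"
  using assms by (simp add: Vector_Spaces.linear_iff L.vector_space_axioms)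

lemma linear_HLI:
  assumes "\<And>x y. f (x + y) = f x + f y" "\<And>c x. f (scaleH c x) = scaleL c (f x)"
  shows "Vector_Spaces.linear scaleH scaleL f"
  using assms by (simp add: Vector_Spaces.linear_iff H.vector_space_axioms L.vector_space_axioms)

definition average :: "('h \<Rightarrow> 'f) \<Rightarrow> ('l \<Rightarrow> 'l) \<Rightarrow> 'l \<Rightarrow> 'l" where
  "average t p v = tensor_sum (\<lambda>y k.
     tensor_sum (\<lambda>x h. scaleL (t (h * antipode k)) x) (coact (p y))) (coact v)"

context
  fixes t :: "'h \<Rightarrow> 'f" and p :: "'l \<Rightarrow> 'l"
  assumes t: "Vector_Spaces.linear scaleH (*) t"
    and p: "Vector_Spaces.linear scaleL scaleL p"
begin

lemmas average_simps = linear_addD[OF t] linear_scaleD[OF t] linear_addD[OF p] linear_scaleD[OF p]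
  H.linear_simps bracket_simps L.scale_right_distrib L.scale_left_distrib L.scale_left_commute

lemma bilinear_pairing: "bilinear_map scaleL scaleH scaleL (\<lambda>x h. scaleL (t (h * antipode k)) x)"
  by (intro bilinear_mapI linear_LLI linear_HLI) (simp_all add: average_simps)

lemma linear_pairing_coact:
  "Vector_Spaces.linear scaleL scaleL
     (\<lambda>v. tensor_sum (\<lambda>x h. scaleL (t (h * antipode k)) x) (coact v))"
  by (rule linear_coact[OF bilinear_pairing])

lemma bilinear_average_summand:
  "bilinear_map scaleL scaleH scaleL
     (\<lambda>y k. tensor_sum (\<lambda>x h. scaleL (t (h * antipode k)) x) (coact (p y)))"
  by (intro bilinear_mapI linear_compose2[OF linear_pairing_coact p] linear_tensor_sum_coactH
      linear_HLI) (simp_all add: average_simps)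

lemma linear_average: "Vector_Spaces.linear scaleL scaleL (average t p)"
  unfolding average_def[abs_def] by (rule linear_coact[OF bilinear_average_summand])

lemma average_mem:
  assumes "subcomodule W" "range p \<subseteq> W"
  shows "average t p v \<in> W"
proof -
  have W: "L.subspace W"
    using assms(1) by (simp add: subcomodule_def)
  have sum: "tensor_sum f xs \<in> W" if "\<And>x y. (x, y) \<in> set xs \<Longrightarrow> f x y \<in> W"
    for f and xs :: "('l \<times> 'h) list"
    using that by (induction xs) (auto simp: L.subspace_0[OF W] intro!: L.subspace_add[OF W])
  have mem: "tensor_sum (\<lambda>x h. scaleL (t (h * antipode k)) x) (coact (p y)) \<in> W" for y k
  proof -
    obtain xs where xs: "set xs \<subseteq> W \<times> UNIV" "tensor_eq scaleL scaleH (coact (p y)) xs"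
      using subcomoduleE[OF assms(1)] assms(2) by blast
    show ?thesis
      unfolding tensor_eq_tensor_sum[OF L.vector_space_axioms xs(2) bilinear_pairing]
      using xs(1) by (intro sum L.subspace_scale[OF W]) auto
  qed
  show ?thesis
    unfolding average_def by (rule sum, rule mem)
qed

text \<open>Once the list for \<open>v\<close> has its first components in \<open>W\<close>, the
  inner \<open>p\<close> disappears. Coassociativity then makes the weights t(h_1 S(h_2)) =
  \<epsilon>(h) t(1), and \<open>t 1 = 1\<close> turns the sum into the counit axiom.\<close>

lemma average_ident:
  assumes "subcomodule W" "\<And>w. w \<in> W \<Longrightarrow> p w = w" "t 1 = 1" "v \<in> W"
  shows "average t p v = v"
proof -
  obtain xs where xs: "set xs \<subseteq> W \<times> UNIV" "tensor_eq scaleL scaleH (coact v) xs"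
    using subcomoduleE[OF assms(1,4)] by blast
  let ?f = "\<lambda>y k. tensor_sum (\<lambda>x h. scaleL (t (h * antipode k)) x) (coact y)"
  have bi: "bilinear_map scaleL scaleH scaleL ?f"
    by (intro bilinear_mapI linear_pairing_coact linear_tensor_sum_coactH linear_HLI)
      (simp_all add: average_simps)
  have "average t p v = tensor_sum (\<lambda>y k. ?f (p y) k) xs"
    unfolding average_def
    by (rule tensor_eq_tensor_sum[OF L.vector_space_axioms xs(2) bilinear_average_summand])
  also have "\<dots> = tensor_sum ?f xs"
    using xs(1) assms(2) by (intro tensor_sum_cong) auto
  also have "\<dots> = tensor_sum ?f (coact v)"
    by (rule tensor_eq_tensor_sum[OF L.vector_space_axioms xs(2) bi, symmetric])
  also have "\<dots> = tensor_sum (\<lambda>x y. tensor_sum (\<lambda>h k. scaleL (t (h * antipode k)) x) (comult y)) (coact v)"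
    by (rule coact_coassoc_sum)
      (auto intro!: trilinear_mapI linear_LLI linear_HLI L.vector_space_axioms simp: average_simps)
  also have "\<dots> = tensor_sum (\<lambda>x y. scaleL (t (tensor_sum (\<lambda>h k. h * antipode k) (comult y))) x) (coact v)"
    by (simp add: linear_tensor_sum[OF t] L.tensor_sum_scale)
  also have "\<dots> = tensor_sum (\<lambda>x y. scaleL (counit y) x) (coact v)"
    by (simp add: H.antipode_sum_right linear_scaleD[OF t] assms(3))
  also have "\<dots> = v"
    by (rule coact_counit_sum[OF L.linear_ident])
  finally show ?thesis .
qed

text \<open>This is colinearity of the average, tested on bilinear maps. Coassociativity for p(v_0)
  produces t(h_2 S(k)) h_1 with k = v_1. By \<open>left_integral_antipode\<close> this is t(h
  S(k_1)) k_2, and coassociativity for \<open>v\<close> absorbs k_1 into an average taken at v_0,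
  leaving the last tensor factor.\<close>

lemma coact_average:
  assumes int: "H.left_integral t" and f: "bilinear_map scaleL scaleH s f"
  shows "tensor_sum f (coact (average t p v)) = tensor_sum (\<lambda>y k. f (average t p y) k) (coact v)"
proof -
  let ?S = antipode
  note f_simps = bilinear_mapD[OF f]
  interpret Z: vector_space s by (rule f_simps)
  have lin: "Vector_Spaces.linear scaleL s (\<lambda>v. tensor_sum f (coact v))"
    by (rule linear_coact[OF f])
  have f1: "Vector_Spaces.linear scaleL s (\<lambda>x. f x k)" and f2: "Vector_Spaces.linear scaleH s (f x)" for k x
    using f by (auto simp: bilinear_map_def)
  define G where "G y x k = tensor_sum (\<lambda>u h. s (t (h * ?S x)) (f u k)) (coact (p y))" for y x k
  have "bilinear_map scaleL scaleH s (\<lambda>u h. s (t (h * ?S x)) (f u k))" for x k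
    by (intro bilinear_mapI linearI)
      (simp_all add: average_simps f_simps Z.scale_right_distrib Z.scale_left_distrib Z.scale_left_commute Z.vector_space_axioms
        L.vector_space_axioms H.vector_space_axioms)
  then have linG: "Vector_Spaces.linear scaleL s
      (\<lambda>y. tensor_sum (\<lambda>u h. s (t (h * ?S x)) (f u k)) (coact (p y)))" for x k
    by (rule linear_compose2[OF linear_coact p])
  have tri: "trilinear_map scaleL scaleH scaleH s G"
    unfolding G_def
    by (rule trilinear_mapI, rule linG;
        intro linear_tensor_sum_param H.vector_space_axioms Z.vector_space_axioms linearI)
      (simp_all add: average_simps f_simps Z.scale_right_distrib Z.scale_left_distrib Z.scale_left_commute)
  have "tensor_sum f (coact (average t p v)) = tensor_sum (\<lambda>y k. tensor_sum (\<lambda>x h.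
       tensor_sum (\<lambda>u g. s (t (h * ?S k)) (f u g)) (coact x)) (coact (p y))) (coact v)"
    by (simp add: average_def linear_tensor_sum[OF lin] linear_scaleD[OF lin] Z.tensor_sum_scale)
  also have "\<dots> = tensor_sum (\<lambda>y k. tensor_sum (\<lambda>x h.
       tensor_sum (\<lambda>h1 h2. s (t (h2 * ?S k)) (f x h1)) (comult h)) (coact (p y))) (coact v)"
    by (subst coact_coassoc_sum[where s = s])
      (auto intro!: trilinear_mapI linearI simp: average_simps f_simps Z.scale_right_distrib
        Z.scale_left_distrib Z.scale_left_commute Z.vector_space_axioms
        L.vector_space_axioms H.vector_space_axioms)
  also have "\<dots> = tensor_sum (\<lambda>y k. tensor_sum (\<lambda>x h.
       tensor_sum (\<lambda>k1 k2. s (t (h * ?S k1)) (f x k2)) (comult k)) (coact (p y))) (coact v)"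
  proof -
    have "tensor_sum (\<lambda>h1 h2. s (t (h2 * ?S k)) (f x h1)) (comult h)
      = f x (tensor_sum (\<lambda>h1 h2. scaleH (t (h2 * ?S k)) h1) (comult h))" for x h k
      by (simp add: linear_tensor_sum[OF f2] f_simps)
    also have "\<dots> x h k = f x (tensor_sum (\<lambda>k1 k2. scaleH (t (h * ?S k1)) k2) (comult k))" for x h k
      by (simp add: H.left_integral_antipode[OF int])
    also have "\<dots> x h k = tensor_sum (\<lambda>k1 k2. s (t (h * ?S k1)) (f x k2)) (comult k)" for x h k
      by (simp add: linear_tensor_sum[OF f2] f_simps)
    finally show ?thesis by simp
  qed
  also have "\<dots> = tensor_sum (\<lambda>y k. tensor_sum (\<lambda>k1 k2. G y k1 k2) (comult k)) (coact v)"
    unfolding G_def by (subst tensor_sum_swap) simp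
  also have "\<dots> = tensor_sum (\<lambda>y k. tensor_sum (\<lambda>y' k'. G y' k' k) (coact y)) (coact v)"
    by (rule coact_coassoc_sum[symmetric, OF tri Z.vector_space_axioms])
  also have "\<dots> = tensor_sum (\<lambda>y k. f (average t p y) k) (coact v)"
    by (simp add: average_def G_def linear_tensor_sum[OF f1] f_simps)
  finally show ?thesis .
qed

text \<open>The map v \<mapsto> v - \<open>average t p v\<close> is colinear, so applying it to the
  first components of a list for \<open>w\<close> gives a list for the image of
  \<open>w\<close>.\<close>

lemma subcomodule_complement:
  assumes int: "H.left_integral t" and W: "subcomodule W"
  shows "subcomodule ((\<lambda>w. w - average t p w) ` W)"
  unfolding subcomodule_def
proof (intro conjI ballI)
  let ?q = "\<lambda>w. w - average t p w"
  have q: "Vector_Spaces.linear scaleL scaleL ?q"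
    by (intro linear_LLI) (simp_all add: linear_addD[OF linear_average] linear_scaleD[OF linear_average]
        L.scale_right_diff_distrib)
  then interpret q: Vector_Spaces.linear scaleL scaleL ?q .
  show "L.subspace (?q ` W)"
    using W q.subspace_image by (simp add: subcomodule_def)
  fix a assume "a \<in> ?q ` W"
  then obtain w where w: "w \<in> W" "a = ?q w" by blast
  obtain xs where xs: "set xs \<subseteq> W \<times> UNIV" "tensor_eq scaleL scaleH (coact w) xs"
    using subcomoduleE[OF W w(1)] by blast
  show "\<exists>ys. set ys \<subseteq> ?q ` W \<times> UNIV \<and> tensor_eq scaleL scaleH (coact a) ys"
  proof (intro exI conjI)
    show "set (map (\<lambda>(x, h). (?q x, h)) xs) \<subseteq> ?q ` W \<times> UNIV"
      using xs(1) by auto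
    show "tensor_eq scaleL scaleH (coact a) (map (\<lambda>(x, h). (?q x, h)) xs)"
    proof (rule tensor_eqI[OF L.vector_space_axioms H.vector_space_axioms])
      fix f :: "'l \<Rightarrow> 'h \<Rightarrow> 'f" assume f: "bilinear_map scaleL scaleH (*) f"
      have f1: "f (x - y) k = f x k - f y k" for x y k
        by (rule linear_diffD[of scaleL "(*)" "\<lambda>x. f x k"]) (use f in \<open>simp add: bilinear_map_def\<close>)
      have "Vector_Spaces.linear scaleL (*) (\<lambda>x. f x h)" for h
        using f by (simp add: bilinear_map_def)
      from linear_compose2[OF this q] have fq: "bilinear_map scaleL scaleH (*) (\<lambda>x h. f (?q x) h)"
        using f by (simp add: bilinear_map_def)
      have "tensor_sum f (coact a) = tensor_sum (\<lambda>x h. f (?q x) h) (coact w)"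
        by (simp add: w(2) linear_diffD[OF linear_coact[OF f]] coact_average[OF int f] f1 tensor_sum_diff)
      also have "\<dots> = tensor_sum (\<lambda>x h. f (?q x) h) xs"
        by (rule tensor_eq_tensor_sum[OF vector_space_self xs(2) fq])
      finally show "tensor_sum f (coact a) = tensor_sum f (map (\<lambda>(x, h). (?q x, h)) xs)"
        by (simp add: tensor_sum_map[of f "\<lambda>x h. ?q x" "\<lambda>x h. h"])
    qed
  qed
qed

text \<open>The coaction of [b, v] and antimultiplicativity of S conjugate the argument of
  \<open>t\<close> to b_1 (g S(k)) S(b_2), and ad-invariance replaces this by \<epsilon>(b_1) g
  S(k). Pulling \<open>p\<close> past the bracket needs first arguments in \<open>B\<close>;
  therefore \<open>coact b\<close> is exchanged for the list \<open>xs\<close> over \<open>B\<close>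
  and afterwards restored.\<close>

lemma average_bracket:
  assumes ad: "H.ad_invariant t" and B: "subcomodule B"
    and pB: "\<And>b v. b \<in> B \<Longrightarrow> p (bracket b v) = bracket b (p v)"
    and b: "b \<in> B"
  shows "average t p (bracket b v) = bracket b (average t p v)"
proof -
  let ?S = antipode
  let ?Q = "\<lambda>y k. tensor_sum (\<lambda>x h. scaleL (t (h * ?S k)) x) (coact (p y))"
  define E where "E b' h' h = tensor_sum (\<lambda>y k. tensor_sum (\<lambda>x g.
    scaleL (t (h' * (g * ?S k) * ?S h)) (bracket b' x)) (coact (p y))) (coact v)" for b' h' h
  have tri: "trilinear_map scaleL scaleH scaleH scaleL E"
    unfolding E_def
    by (intro trilinear_mapI linear_tensor_sum_coact linear_tensor_sum_coactH linear_LLI linear_HLI)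
      (simp_all add: average_simps)
  note Q = bilinear_mapD[OF bilinear_average_summand]
  have bi1: "bilinear_map scaleL scaleH scaleL (\<lambda>x h. tensor_sum (\<lambda>y k. ?Q (bracket x y) (h * k)) (coact v))"
    by (intro bilinear_mapI linear_tensor_sum_coact linear_tensor_sum_coactH linear_LLI linear_HLI;
      subst bracket_simps H.mult_scale_left distrib_right; rule Q)
  have bi2: "bilinear_map scaleL scaleH scaleL (\<lambda>x h. tensor_sum (\<lambda>b' h'. E b' h' h) (coact x))"
    using tri trilinear_mapD(1)[OF tri]
    by (intro bilinear_mapI linear_coact linear_tensor_sum_coactH) (auto simp: trilinear_map_def)
  obtain xs where xs: "set xs \<subseteq> B \<times> UNIV" "tensor_eq scaleL scaleH (coact b) xs"
    using subcomoduleE[OF B b] by blast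
  have QE: "tensor_sum (\<lambda>y k. ?Q (bracket x y) (h * k)) (coact v)
      = tensor_sum (\<lambda>b' h'. E b' h' h) (coact x)" if "x \<in> B" for x h
  proof -
    have "?Q (bracket x y) (h * k) = tensor_sum (\<lambda>b' h'. tensor_sum (\<lambda>u g.
       scaleL (t (h' * (g * ?S k) * ?S h)) (bracket b' u)) (coact (p y))) (coact x)" for y k
      unfolding pB[OF that] by (subst coact_bracket_sum[OF bilinear_pairing])
        (simp add: H.antipode_mult mult.assoc)
    then show ?thesis
      unfolding E_def by (simp add: tensor_sum_swap[of _ "coact x"])
  qed
  have ad': "t (tensor_sum (\<lambda>x y. x * c * ?S y) (comult a)) = counit a * t c" for a c
    using ad by (simp add: H.ad_invariant_def tensor_sum_def)
  have E: "tensor_sum (E b') (comult y) = scaleL (counit y) (bracket b' (average t p v))" for b' y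
  proof -
    have "tensor_sum (E b') (comult y) = tensor_sum (\<lambda>y' k. tensor_sum (\<lambda>x g.
       scaleL (t (tensor_sum (\<lambda>h' h. h' * (g * ?S k) * ?S h) (comult y))) (bracket b' x)) (coact (p y'))) (coact v)"
      unfolding E_def[abs_def]
      by (simp add: tensor_sum_swap[of _ _ "comult y"] linear_tensor_sum[OF t] L.tensor_sum_scale)
    also have "\<dots> = scaleL (counit y) (bracket b' (average t p v))"
      by (simp add: ad' average_def linear_tensor_sum[OF L.bracket_linear_right] bracket_simps
         flip: L.tensor_sum_scale L.scale_scale)
    finally show ?thesis .
  qed
  have "average t p (bracket b v) = tensor_sum (\<lambda>x h. tensor_sum (\<lambda>y k. ?Q (bracket x y) (h * k)) (coact v)) (coact b)"
    unfolding average_def by (rule coact_bracket_sum[OF bilinear_average_summand])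
  also have "\<dots> = tensor_sum (\<lambda>x h. tensor_sum (\<lambda>y k. ?Q (bracket x y) (h * k)) (coact v)) xs"
    by (rule tensor_eq_tensor_sum[OF L.vector_space_axioms xs(2) bi1])
  also have "\<dots> = tensor_sum (\<lambda>x h. tensor_sum (\<lambda>b' h'. E b' h' h) (coact x)) xs"
    using xs(1) by (intro tensor_sum_cong QE) auto
  also have "\<dots> = tensor_sum (\<lambda>x h. tensor_sum (\<lambda>b' h'. E b' h' h) (coact x)) (coact b)"
    by (rule tensor_eq_tensor_sum[OF L.vector_space_axioms xs(2) bi2, symmetric])
  also have "\<dots> = tensor_sum (\<lambda>x y. tensor_sum (E x) (comult y)) (coact b)"
    by (rule coact_coassoc_sum[OF tri L.vector_space_axioms])
  also have "\<dots> = bracket b (average t p v)"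
    unfolding E by (rule coact_counit_sum[OF L.bracket_linear_left])
  finally show ?thesis .
qed

end

end

section \<open>Traces on quotients\<close>

lemma linear_sumD:
  assumes "Vector_Spaces.linear s1 s2 f"
  shows "f (sum g I) = (\<Sum>i\<in>I. f (g i))"
  by (induction I rule: infinite_finite_induct)
    (simp_all add: linear_addD[OF assms] linear_zeroD[OF assms])

locale linear_space = vector_space scale
  for scale :: "'f::field \<Rightarrow> 'v::ab_group_add \<Rightarrow> 'v"
begin

abbreviation lin :: "('v \<Rightarrow> 'v) \<Rightarrow> bool" where
  "lin \<equiv> Vector_Spaces.linear scale scale"

lemma linI:
  assumes "\<And>x y. f (x + y) = f x + f y" "\<And>c x. f (scale c x) = scale c (f x)"
  shows "lin f"
  using assms by (simp add: Vector_Spaces.linear_iff vector_space_axioms)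

lemma lin_compose: "lin f \<Longrightarrow> lin g \<Longrightarrow> lin (\<lambda>v. f (g v))"
  by (simp add: Vector_Spaces.linear_iff)

lemma lin_funpow: "lin f \<Longrightarrow> lin (f ^^ n)"
  by (induction n) (auto simp: Vector_Spaces.linear_iff vector_space_axioms)

lemma lin_add: "lin f \<Longrightarrow> lin g \<Longrightarrow> lin (\<lambda>v. f v + g v)"
  by (simp add: Vector_Spaces.linear_iff scale_right_distrib algebra_simps)

lemma lin_diff: "lin f \<Longrightarrow> lin g \<Longrightarrow> lin (\<lambda>v. f v - g v)"
  by (simp add: Vector_Spaces.linear_iff scale_right_diff_distrib algebra_simps)

lemma lin_scale: "lin f \<Longrightarrow> lin (\<lambda>v. scale c (f v))"
  by (simp add: Vector_Spaces.linear_iff scale_right_distrib scale_left_commute)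

lemma lin_zero: "lin (\<lambda>v. 0)"
  by (simp add: Vector_Spaces.linear_iff vector_space_axioms)

lemma lin_sum: "(\<And>i. i \<in> I \<Longrightarrow> lin (f i)) \<Longrightarrow> lin (\<lambda>v. \<Sum>i\<in>I. f i v)"
  by (induction I rule: infinite_finite_induct) (auto intro: lin_add lin_zero)

lemma span_image_subset:
  assumes "lin f" "\<And>b. b \<in> B \<Longrightarrow> f b \<in> S" "subspace S" "v \<in> span B"
  shows "f v \<in> S"
  using assms(4)
proof (induction rule: span_induct_alt)
  case base
  show ?case by (simp add: linear_zeroD[OF assms(1)] subspace_0[OF assms(3)])
next
  case (step c x y)
  then show ?case
    using assms by (simp add: linear_addD[OF assms(1)] linear_scaleD[OF assms(1)] subspace_add subspace_scale)
qed

text \<open>A frame is a pair of bases of subspaces \<open>U \<subseteq> V\<close>; it serves to handle the quotient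
  \<open>V / U\<close> without forming it.\<close>

definition frame :: "'v set \<Rightarrow> 'v set \<Rightarrow> bool" where
  "frame A B \<longleftrightarrow> A \<subseteq> B \<and> finite B \<and> independent B"

definition endo :: "'v set \<Rightarrow> 'v set \<Rightarrow> ('v \<Rightarrow> 'v) \<Rightarrow> bool" where
  "endo A B f \<longleftrightarrow> lin f \<and> (\<forall>v\<in>span B. f v \<in> span B) \<and> (\<forall>v\<in>span A. f v \<in> span A)"

text \<open>The trace of the endomorphism induced on \<open>span B / span A\<close>, which has the
  classes of \<open>B - A\<close> as a basis.\<close>

definition rtrace :: "'v set \<Rightarrow> 'v set \<Rightarrow> ('v \<Rightarrow> 'v) \<Rightarrow> 'f" where
  "rtrace A B f = (\<Sum>b\<in>B - A. representation B (f b) b)"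

lemma frameD: "frame A B \<Longrightarrow> A \<subseteq> B" "frame A B \<Longrightarrow> finite B" "frame A B \<Longrightarrow> independent B"
  "frame A B \<Longrightarrow> finite A" "frame A B \<Longrightarrow> independent A" "frame A B \<Longrightarrow> span A \<subseteq> span B"
  by (auto simp: frame_def intro: finite_subset dependent_mono dest: span_mono)

lemma representation_outside:
  assumes "frame A B" "v \<in> span A" "b \<in> B - A"
  shows "representation B v b = 0"
  using representation_extend[of B v A] representation_ne_zero[of A v b] assms
  by (auto simp: frame_def)

lemma rtrace_zero:
  assumes "frame A B" "\<And>v. v \<in> span B \<Longrightarrow> f v \<in> span A"
  shows "rtrace A B f = 0"
  unfolding rtrace_def using assms
  by (intro sum.neutral) (auto intro: representation_outside span_base)

lemma rtrace_add:
  assumes "frame A B" "endo A B f" "endo A B g"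
  shows "rtrace A B (\<lambda>v. f v + g v) = rtrace A B f + rtrace A B g"
  unfolding rtrace_def sum.distrib[symmetric] using assms
  by (intro sum.cong refl) (simp add: endo_def frame_def representation_add span_base)

lemma rtrace_diff:
  assumes "frame A B" "endo A B f" "endo A B g"
  shows "rtrace A B (\<lambda>v. f v - g v) = rtrace A B f - rtrace A B g"
  unfolding rtrace_def sum_subtractf[symmetric] using assms
  by (intro sum.cong refl) (simp add: endo_def frame_def representation_diff span_base)

lemma rtrace_scale:
  assumes "frame A B" "endo A B f"
  shows "rtrace A B (\<lambda>v. scale c (f v)) = c * rtrace A B f"
  unfolding rtrace_def sum_distrib_left using assms
  by (intro sum.cong refl) (simp add: endo_def frame_def representation_scale span_base)

lemma rtrace_cong:
  assumes "\<And>v. v \<in> span B \<Longrightarrow> f v = g v"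
  shows "rtrace A B f = rtrace A B g"
  unfolding rtrace_def using assms by (intro sum.cong refl) (simp add: span_base)

lemma endo_compose: "endo A B f \<Longrightarrow> endo A B g \<Longrightarrow> endo A B (\<lambda>v. f (g v))"
  and endo_add: "endo A B f \<Longrightarrow> endo A B g \<Longrightarrow> endo A B (\<lambda>v. f v + g v)"
  and endo_diff: "endo A B f \<Longrightarrow> endo A B g \<Longrightarrow> endo A B (\<lambda>v. f v - g v)"
  and endo_scale: "endo A B f \<Longrightarrow> endo A B (\<lambda>v. scale c (f v))"
  and endo_ident: "endo A B (\<lambda>v. v)"
  and endo_zero: "endo A B (\<lambda>v. 0)"
  by (auto simp: endo_def span_add span_diff span_scale span_zero linear_ident
      intro: lin_compose lin_add lin_diff lin_scale lin_zero)

lemma endo_sum: "(\<And>i. i \<in> I \<Longrightarrow> endo A B (f i)) \<Longrightarrow> endo A B (\<lambda>v. \<Sum>i\<in>I. f i v)"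
  by (induction I rule: infinite_finite_induct) (auto intro: endo_add endo_zero)

lemma endo_funpow: "endo A B f \<Longrightarrow> endo A B (f ^^ n)"
proof (induction n)
  case 0
  then show ?case using endo_ident by (simp add: id_def)
next
  case (Suc n)
  then show ?case using endo_compose[of A B f "f ^^ n"] by (simp add: comp_def)
qed

lemma rtrace_sum:
  assumes "frame A B" "\<And>i. i \<in> I \<Longrightarrow> endo A B (f i)"
  shows "rtrace A B (\<lambda>v. \<Sum>i\<in>I. f i v) = (\<Sum>i\<in>I. rtrace A B (f i))"
  using assms(2)
proof (induction I rule: infinite_finite_induct)
  case (insert x F)
  then show ?case by (simp add: rtrace_add[OF assms(1)] endo_sum)
qed (simp_all add: rtrace_zero[OF assms(1)] span_zero)

text \<open>The matrix product formula on the quotients. Two frames are allowed so that it covers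
  both commutation under the trace, with equal frames, and independence of the basis, with one of
  the maps the identity.\<close>

lemma rtrace_compose:
  assumes fr: "frame A B" "frame A' B'"
    and f: "lin f" "\<And>v. v \<in> span B' \<Longrightarrow> f v \<in> span B" "\<And>v. v \<in> span A' \<Longrightarrow> f v \<in> span A"
    and g: "\<And>v. v \<in> span B \<Longrightarrow> g v \<in> span B'"
  shows "rtrace A B (\<lambda>v. f (g v))
    = (\<Sum>b\<in>B - A. \<Sum>c\<in>B' - A'. representation B' (g b) c * representation B (f c) b)"
  unfolding rtrace_def
proof (intro sum.cong refl)
  fix b assume b: "b \<in> B - A"
  have fc: "f c \<in> span B" if "c \<in> B'" for c
    using f(2) that span_base by blast
  have "f (g b) = (\<Sum>c\<in>B'. scale (representation B' (g b) c) (f c))"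
    using sum_representation_eq[of B' "g b" B'] g[of b] b fr
    by (simp add: frame_def span_base flip: linear_scaleD[OF f(1)] linear_sumD[OF f(1)])
  then have "representation B (f (g b)) b
      = (\<Sum>c\<in>B'. representation B' (g b) c * representation B (f c) b)"
    using fr fc by (simp add: representation_sum representation_scale span_scale frame_def)
  \<comment> \<open>Terms with \<open>c\<close> in \<open>A'\<close> vanish: \<open>f\<close> maps
    \<open>c\<close> into \<open>span A\<close>, where coefficients at elements of
    \<open>B - A\<close> are 0.\<close>
  also have "\<dots> = (\<Sum>c\<in>B' - A'. representation B' (g b) c * representation B (f c) b)"
  proof (rule sum.mono_neutral_right)
    show "\<forall>c\<in>B' - (B' - A'). representation B' (g b) c * representation B (f c) b = 0"
      using b f(3) span_base[of _ A'] by (auto simp: representation_outside[OF fr(1)])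
  qed (use fr in \<open>auto simp: frame_def\<close>)
  finally show "representation B (f (g b)) b
      = (\<Sum>c\<in>B' - A'. representation B' (g b) c * representation B (f c) b)" .
qed

lemma rtrace_comm:
  assumes fr: "frame A B" and "endo A B f" "endo A B g"
  shows "rtrace A B (\<lambda>v. f (g v)) = rtrace A B (\<lambda>v. g (f v))"
  using assms
  by (subst (1 2) rtrace_compose[OF fr fr]) (auto simp: endo_def mult.commute intro: sum.swap)

lemma rtrace_basis:
  assumes fr: "frame A B" "frame A' B'" and eq: "span A = span A'" "span B = span B'"
    and f: "endo A B f"
  shows "rtrace A B f = rtrace A' B' f"
proof -
  have "rtrace A B (\<lambda>v. f v)
      = (\<Sum>b\<in>B - A. \<Sum>c\<in>B' - A'. representation B' b c * representation B (f c) b)"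
    using f eq rtrace_compose[OF fr, of f "\<lambda>v. v"] by (simp add: endo_def)
  also have "\<dots> = (\<Sum>c\<in>B' - A'. \<Sum>b\<in>B - A. representation B (f c) b * representation B' b c)"
    by (subst sum.swap) (simp add: mult.commute)
  also have "\<dots> = rtrace A' B' (\<lambda>v. f v)"
    using f eq rtrace_compose[OF fr(2,1), of "\<lambda>v. v" f] linear_ident by (simp add: endo_def)
  finally show ?thesis by simp
qed

lemma rtrace_chain:
  assumes "frame A B" "frame B C" "endo A B f"
  shows "rtrace A C f = rtrace A B f + rtrace B C f"
proof -
  have C: "C - A = (B - A) \<union> (C - B)" "(B - A) \<inter> (C - B) = {}" "finite (B - A)" "finite (C - B)"
    using assms by (auto simp: frame_def)
  have "representation C (f b) b = representation B (f b) b" if "b \<in> B - A" for b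
    using representation_extend[of C "f b" B] assms that
    by (auto simp: frame_def endo_def span_base)
  then show ?thesis
    unfolding rtrace_def C(1) by (subst sum.union_disjoint) (use C in auto)
qed

lemma basis_extend:
  assumes "finite D" "S \<subseteq> span D" "frame {} A" "span A \<subseteq> S" "subspace S"
  obtains B where "frame A B" "span B = S"
proof -
  have "A \<subseteq> S"
    using assms(4) span_superset by blast
  moreover have "independent A"
    using assms(3) by (simp add: frame_def)
  ultimately obtain B where B: "A \<subseteq> B" "B \<subseteq> S" "independent B" "S \<subseteq> span B"
    using maximal_independent_subset_extend by metis
  have "finite B"
    using independent_span_bound[OF assms(1) B(3)] B(2) assms(2) by blast
  moreover have "span B = S"
    using B span_minimal[OF B(2) assms(5)] by blast
  ultimately show ?thesis
    using B that by (auto simp: frame_def)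
qed

lemma frame_empty: "frame {} A \<longleftrightarrow> finite A \<and> independent A"
  by (simp add: frame_def)

text \<open>Inserts U + f(V) between U = \<open>span A\<close> and V = \<open>span B\<close>. A
  basis of this middle space need not lie in \<open>B\<close>, so V receives a new basis
  \<open>B'\<close>, and traces are carried over by \<open>rtrace_basis\<close>. The strict
  inequality makes induction on dim V/U possible.\<close>

lemma frame_insert_image:
  assumes fr: "frame A B" and f: "endo A B f"
  obtains A' B' where "frame A A'" "frame A' B'" "span B' = span B"
    "span A' = span (A \<union> f ` span B)" "card (A' - A) \<le> card (B - A)"
    "span A' \<noteq> span B \<Longrightarrow> card (A' - A) < card (B - A)"
proof -
  have sub: "span (A \<union> f ` span B) \<subseteq> span B"
    using f fr by (intro span_minimal) (auto simp: endo_def frame_def span_base)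
  obtain A' where A': "frame A A'" "span A' = span (A \<union> f ` span B)"
    by (rule basis_extend[OF frameD(2)[OF fr] sub, of A])
      (use fr span_mono[of A "A \<union> f ` span B"] in \<open>auto simp: frame_empty frameD\<close>)
  obtain B' where B': "frame A' B'" "span B' = span B"
    by (rule basis_extend[OF frameD(2)[OF fr], of "span B" A'])
      (use A' sub in \<open>auto simp: frame_empty frameD\<close>)
  have "card B' = card B"
    using B' fr by (metis dim_eq_card_independent dim_span frameD(3))
  moreover have "card (A' - A) = card A' - card A" "card (B - A) = card B - card A"
    using A'(1) fr by (simp_all add: card_Diff_subset frameD)
  moreover have "card A' \<le> card B'" "card A \<le> card A'"
    using frameD(1,2)[OF B'(1)] frameD(1,2)[OF A'(1)] by (simp_all add: card_mono)
  moreover have "card A' < card B'" if "span A' \<noteq> span B"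
  proof -
    have "A' \<subset> B'"
      using B' that frameD(1) by blast
    then show ?thesis
      using frameD(2)[OF B'(1)] by (rule psubset_card_mono[rotated])
  qed
  ultimately have "card (A' - A) \<le> card (B - A)" "span A' \<noteq> span B \<Longrightarrow> card (A' - A) < card (B - A)"
    by auto
  then show ?thesis
    using A' B' that by blast
qed

lemma funpow_mem: "(\<And>v. v \<in> S \<Longrightarrow> f v \<in> S) \<Longrightarrow> v \<in> S \<Longrightarrow> (f ^^ n) v \<in> S"
  by (induction n) auto

text \<open>Induction on \<open>n\<close>, with U' = U + f^n(V) inserted. Since f^(n+1) maps V into
  U, \<open>f\<close> is zero on U'/U; and f^n is zero on V/U'.\<close>

lemma rtrace_nilpotent:
  assumes "frame A B" "endo A B f" "\<And>v. v \<in> span B \<Longrightarrow> (f ^^ n) v \<in> span A"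
  shows "rtrace A B f = 0"
  using assms
proof (induction n arbitrary: A B)
  case 0
  then show ?case
    by (intro rtrace_zero) (auto simp: endo_def dest: frameD)
next
  case (Suc n)
  have fn: "endo A B (f ^^ n)"
    by (rule endo_funpow[OF Suc.prems(2)])
  obtain A' B' where AB: "frame A A'" "frame A' B'" "span B' = span B"
    "span A' = span (A \<union> (f ^^ n) ` span B)"
    using frame_insert_image[OF Suc.prems(1) fn] by metis
  have fA': "f v \<in> span A" if "v \<in> span A'" for v
    using that unfolding AB(4)
    by (rule span_image_subset[rotated 3])
      (use Suc.prems in \<open>auto simp: endo_def span_base\<close>)
  have "endo A A' f" "endo A' B' f"
    using Suc.prems(2) fA' frameD(6)[OF AB(1)] AB(3) by (auto simp: endo_def)
  have "rtrace A' B' f = 0"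
    by (rule Suc.IH[OF AB(2) \<open>endo A' B' f\<close>]) (auto simp: AB span_base)
  moreover have "rtrace A A' f = 0"
    by (rule rtrace_zero[OF AB(1) fA'])
  moreover have "frame A B'"
    using AB by (auto simp: frame_def)
  ultimately show ?case
    using rtrace_basis[OF Suc.prems(1) \<open>frame A B'\<close> refl AB(3)[symmetric] Suc.prems(2)]
      rtrace_chain[OF AB(1,2) \<open>endo A A' f\<close>] by simp
qed

section \<open>Polynomials in an operator\<close>

definition poly_op :: "'f poly \<Rightarrow> ('v \<Rightarrow> 'v) \<Rightarrow> 'v \<Rightarrow> 'v" where
  "poly_op p f v = (\<Sum>i\<le>degree p. scale (coeff p i) ((f ^^ i) v))"

lemma poly_op_eq: "degree p \<le> n \<Longrightarrow> poly_op p f v = (\<Sum>i\<le>n. scale (coeff p i) ((f ^^ i) v))"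
  unfolding poly_op_def by (intro sum.mono_neutral_left) (auto simp: coeff_eq_0)

lemma poly_op_add: "poly_op (p + q) f v = poly_op p f v + poly_op q f v"
  using poly_op_eq[of p "max (degree p) (degree q)"] poly_op_eq[of q "max (degree p) (degree q)"]
    poly_op_eq[OF degree_add_le_max, of p q]
  by (simp add: scale_left_distrib sum.distrib)

lemma poly_op_smult: "poly_op (smult c p) f v = scale c (poly_op p f v)"
  using poly_op_eq[of "smult c p" "degree p"] by (simp add: poly_op_def scale_sum_right degree_smult_le)

lemma poly_op_0 [simp]: "poly_op 0 f v = 0"
  by (simp add: poly_op_def)

lemma poly_op_pCons:
  assumes "lin f"
  shows "poly_op (pCons a p) f v = scale a v + f (poly_op p f v)"
proof -
  have "poly_op (pCons a p) f v
      = (\<Sum>i\<le>Suc (degree p). scale (coeff (pCons a p) i) ((f ^^ i) v))"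
    by (rule poly_op_eq) (simp add: degree_pCons_le)
  then show ?thesis
    by (simp add: sum.atMost_Suc_shift poly_op_def linear_sumD[OF assms] linear_scaleD[OF assms]
        del: sum.atMost_Suc)
qed

lemma endo_poly_op: "endo A B f \<Longrightarrow> endo A B (poly_op p f)"
  unfolding poly_op_def[abs_def] by (intro endo_sum endo_scale endo_funpow)

lemma lin_poly_op: "lin f \<Longrightarrow> lin (poly_op p f)"
  unfolding poly_op_def[abs_def] by (intro lin_sum lin_scale lin_funpow)

lemma poly_op_mult:
  assumes "lin f"
  shows "poly_op (p * q) f v = poly_op p f (poly_op q f v)"
  by (induction p) (simp_all add: poly_op_pCons[OF assms] poly_op_add poly_op_smult)

lemma poly_op_commute:
  assumes "lin f"
  shows "poly_op p f (poly_op q f v) = poly_op q f (poly_op p f v)"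
  by (metis assms mult.commute poly_op_mult)

lemma poly_op_monom: "lin f \<Longrightarrow> poly_op (monom c n) f v = scale c ((f ^^ n) v)"
proof (induction n)
  case 0
  then show ?case by (simp add: monom_0 poly_op_pCons linear_zeroD)
next
  case (Suc n)
  then show ?case by (simp add: monom_Suc poly_op_pCons linear_scaleD)
qed

lemma poly_op_sum: "poly_op (sum g I) f v = (\<Sum>i\<in>I. poly_op (g i) f v)"
  by (induction I rule: infinite_finite_induct) (auto simp: poly_op_add)

text \<open>The vectors f^i v with i \<le> \<open>card B\<close> exceed the dimension, so they are
  linearly dependent. \<open>dependent\<close> speaks of sets, which is why a repetition among the
  iterates is treated apart.\<close>

lemma annihilating_poly_vector:
  assumes f: "lin f" "\<And>v. v \<in> span B \<Longrightarrow> f v \<in> span B" and B: "finite B" and v: "v \<in> span B"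
  obtains p where "p \<noteq> 0" "poly_op p f v = 0"
proof (cases "inj_on (\<lambda>i. (f ^^ i) v) {..card B}")
  case False
  then obtain i j where ij: "i < j" "(f ^^ i) v = (f ^^ j) v"
    unfolding inj_on_def by (metis linorder_neqE_nat)
  let ?p = "monom 1 i + monom (-1) j :: 'f poly"
  have "coeff ?p i \<noteq> 0"
    using ij by (simp add: coeff_add)
  then have "?p \<noteq> 0" by fastforce
  moreover have "poly_op ?p f v = 0"
    using ij by (simp add: poly_op_add poly_op_monom[OF f(1)])
  ultimately show ?thesis by (rule that)
next
  case True
  let ?S = "(\<lambda>i. (f ^^ i) v) ` {..card B}"
  have "?S \<subseteq> span B"
    using funpow_mem[of "span B" f v] f v by blast
  moreover have "card ?S > card B"
    using True by (simp add: card_image)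
  ultimately have "dependent ?S"
    using independent_span_bound[OF B] by fastforce
  then obtain u where u: "\<exists>w\<in>?S. u w \<noteq> 0" "(\<Sum>w\<in>?S. scale (u w) w) = 0"
    by (auto simp: dependent_finite)
  let ?p = "\<Sum>i\<le>card B. monom (u ((f ^^ i) v)) i"
  obtain i where i: "i \<le> card B" "u ((f ^^ i) v) \<noteq> 0"
    using u(1) by auto
  have "coeff ?p i = u ((f ^^ i) v)"
    using i by (simp add: coeff_sum)
  then have "?p \<noteq> 0"
    using i by fastforce
  moreover have "poly_op ?p f v = 0"
    using u(2) True by (simp add: poly_op_sum poly_op_monom[OF f(1)] sum.reindex)
  ultimately show ?thesis by (rule that)
qed

lemma annihilating_poly:
  assumes f: "lin f" "\<And>v. v \<in> span B \<Longrightarrow> f v \<in> span B" and B: "finite B"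
  obtains p where "p \<noteq> 0" "\<And>v. v \<in> span B \<Longrightarrow> poly_op p f v = 0"
proof -
  have "\<exists>p. p \<noteq> 0 \<and> (\<forall>v\<in>C. poly_op p f v = 0)" if "finite C" "C \<subseteq> span B" for C
    using that
  proof (induction rule: finite_induct)
    case empty
    show ?case by (rule exI[of _ 1]) simp
  next
    case (insert c C)
    obtain p where p: "p \<noteq> 0" "\<forall>v\<in>C. poly_op p f v = 0"
      using insert by auto
    obtain q where q: "q \<noteq> 0" "poly_op q f c = 0"
      using annihilating_poly_vector[OF f B] insert.prems by blast
    have "poly_op (q * p) f v = 0" if "v \<in> insert c C" for v
    proof (cases "v = c")
      case True
      then show ?thesis
        by (metis f(1) linear_zeroD lin_poly_op mult.commute poly_op_mult q(2))
    next
      case False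
      then show ?thesis
        using that p by (metis f(1) linear_zeroD lin_poly_op poly_op_mult insertE)
    qed
    then show ?case
      using p q by (intro exI[of _ "q * p"]) auto
  qed
  from this[OF B] obtain p where p: "p \<noteq> 0" "\<forall>v\<in>B. poly_op p f v = 0"
    using span_superset by blast
  have "poly_op p f v = 0" if "v \<in> span B" for v
    using span_image_subset[OF lin_poly_op[OF f(1)] _ subspace_single_0 that] p(2) by blast
  then show ?thesis
    using p(1) that by blast
qed

end

locale linear_space_char_0 = linear_space scale
  for scale :: "'f::field_char_0 \<Rightarrow> 'v::ab_group_add \<Rightarrow> 'v"
begin

lemma rtrace_ident: "frame A B \<Longrightarrow> rtrace A B (\<lambda>v. v) = of_nat (card (B - A))"
  by (simp add: rtrace_def frame_def representation_basis)

text \<open>In the surjective case the constant term of a minimal polynomial is nonzero,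
  but its trace only sees the dimension.\<close>

lemma nilpotent_if_rtrace_funpow_zero:
  assumes "frame A B" "endo A B f" "\<And>k. k \<ge> 1 \<Longrightarrow> rtrace A B (f ^^ k) = 0"
  shows "\<exists>n. \<forall>v\<in>span B. (f ^^ n) v \<in> span A"
  using assms
proof (induction "card (B - A)" arbitrary: B rule: less_induct)
  case less
  note fr = less.prems(1) and f = less.prems(2)
  have lin: "lin f" and fB: "\<And>v. v \<in> span B \<Longrightarrow> f v \<in> span B"
    using f by (auto simp: endo_def)
  obtain A' B' where AB: "frame A A'" "frame A' B'" "span B' = span B"
    "span A' = span (A \<union> f ` span B)" "span A' \<noteq> span B \<Longrightarrow> card (A' - A) < card (B - A)"
    using frame_insert_image[OF fr f] by metis
  have sub: "span A' \<subseteq> span B"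
    using AB by (metis frameD(6))
  have fA': "f v \<in> span A'" if "v \<in> span B" for v
    using that AB(4) span_base by auto
  show ?case
  proof (cases "span A' = span B")
    case False
    have f': "endo A A' f" "endo A' B' f"
      using f fA' sub AB(3) by (auto simp: endo_def)
    have "frame A B'"
      using AB by (auto simp: frame_def)
    \<comment> \<open>Since \<open>f\<close> maps V into U', its powers are zero on V/U', so their
      whole trace is the one on U'/U.\<close>
    have "rtrace A A' (f ^^ k) = 0" if k: "k \<ge> 1" for k
    proof -
      obtain m where m: "k = Suc m" using k by (cases k) auto
      have "rtrace A' B' (f ^^ k) = 0"
        using AB(3) fA' funpow_mem[of "span B" f] fB by (intro rtrace_zero[OF AB(2)]) (simp add: m)
      then show ?thesis
        using rtrace_basis[OF fr \<open>frame A B'\<close> refl AB(3)[symmetric] endo_funpow[OF f]]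
          rtrace_chain[OF AB(1,2) endo_funpow[OF f'(1)]] less.prems(3)[OF k] by simp
    qed
    then obtain n where "\<forall>v\<in>span A'. (f ^^ n) v \<in> span A"
      using less.hyps[OF AB(5)[OF False] AB(1) f'(1)] by blast
    then have "\<forall>v\<in>span B. (f ^^ Suc n) v \<in> span A"
      using fA' by (simp add: funpow_swap1)
    then show ?thesis by blast
  next
    case True
    let ?P = "\<lambda>p. p \<noteq> 0 \<and> (\<forall>v\<in>span B. poly_op p f v \<in> span A)"
    obtain p0 where "p0 \<noteq> 0" "\<And>v. v \<in> span B \<Longrightarrow> poly_op p0 f v = 0"
      using annihilating_poly[OF lin fB frameD(2)[OF fr]] by metis
    then have "?P p0" by (simp add: span_zero)
    then obtain p where p: "?P p" and min: "\<And>q. ?P q \<Longrightarrow> degree p \<le> degree q"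
      using arg_min_nat_lemma[of ?P p0 degree] by blast
    obtain c q where q: "p = pCons c q" by (cases p)
    \<comment> \<open>If c = 0, then p(f) = q(f) f; as V = U + f(V), already q(f) would map V into
      U, against minimality of the degree.\<close>
    have "c \<noteq> 0"
    proof
      assume "c = 0"
      then have "q \<noteq> 0" using p q by auto
      have "poly_op q f v \<in> span A" if "v \<in> span (A \<union> f ` span B)" for v
      proof (rule span_image_subset[OF lin_poly_op[OF lin] _ subspace_span that])
        fix b assume "b \<in> A \<union> f ` span B"
        then show "poly_op q f b \<in> span A"
        proof
          assume "b \<in> A"
          then show ?thesis
            using endo_poly_op[OF f, of q] by (simp add: endo_def span_base)
        next
          assume "b \<in> f ` span B"
          then obtain v where v: "v \<in> span B" "b = f v" by blast
          have "poly_op p f v = f (poly_op q f v)"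
            by (simp add: q \<open>c = 0\<close> poly_op_pCons[OF lin])
          also have "\<dots> = poly_op q f b"
            using poly_op_commute[OF lin, of "monom 1 1" q v] by (simp add: poly_op_monom[OF lin] v(2))
          finally have eq: "poly_op p f v = poly_op q f b" .
          have "poly_op p f v \<in> span A"
            using p v(1) by blast
          then show ?thesis
            unfolding eq .
        qed
      qed
      moreover have "span (A \<union> f ` span B) = span B"
        using True AB(4) by metis
      ultimately have "?P q"
        using \<open>q \<noteq> 0\<close> by blast
      then show False
        using min[of q] q \<open>q \<noteq> 0\<close> by simp
    qed
    have "0 = rtrace A B (poly_op p f)"
      using p by (intro rtrace_zero[OF fr, symmetric]) auto
    also have "\<dots> = (\<Sum>i\<le>degree p. coeff p i * rtrace A B (f ^^ i))"
      unfolding poly_op_def[abs_def]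
      by (simp add: rtrace_sum[OF fr] rtrace_scale[OF fr] endo_scale endo_funpow[OF f])
    also have "\<dots> = (\<Sum>i\<le>degree p. if i = 0 then c * of_nat (card (B - A)) else 0)"
      using rtrace_ident[OF fr] less.prems(3) by (intro sum.cong refl) (auto simp: q id_def)
    also have "\<dots> = c * of_nat (card (B - A))"
      by simp
    finally have "B - A = {}"
      using \<open>c \<noteq> 0\<close> frameD(2)[OF fr] by simp
    then have "A = B"
      using frameD(1)[OF fr] by blast
    then show ?thesis
      by (intro exI[of _ 0]) simp
  qed
qed

end

section \<open>Generalized eigenspaces\<close>

context linear_space
begin

text \<open>The binomial expansion of an iterated commutator, with the coefficients forgotten: for
  nilpotency only the exponents matter. The parameter \<open>act\<close> admits both operators,
  where it is the identity, and Lie algebra elements acting through \<open>bracket\<close>.\<close>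

lemma commutator_iterate:
  assumes P: "lin P" and D: "\<And>f v. act (D f) v = P (act f v) - act f (Q v)"
  shows "act ((D ^^ n) f) v \<in> span {(P ^^ i) (act f ((Q ^^ j) v)) | i j. i + j = n}"
proof (induction n arbitrary: f)
  case 0
  show ?case by (rule span_base) auto
next
  case (Suc n)
  let ?S = "span {(P ^^ i) (act f ((Q ^^ j) v)) | i j. i + j = Suc n}"
  have "act ((D ^^ n) (D f)) v \<in> span {(P ^^ i) (act (D f) ((Q ^^ j) v)) | i j. i + j = n}"
    by (rule Suc.IH)
  also have "\<dots> \<subseteq> ?S"
  proof (intro span_minimal subsetI)
    fix w assume "w \<in> {(P ^^ i) (act (D f) ((Q ^^ j) v)) | i j. i + j = n}"
    then obtain i j where ij: "i + j = n" "w = (P ^^ i) (act (D f) ((Q ^^ j) v))" by blast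
    have "w = (P ^^ Suc i) (act f ((Q ^^ j) v)) - (P ^^ i) (act f ((Q ^^ Suc j) v))"
      by (simp add: ij(2) D linear_diffD[OF lin_funpow[OF P]] funpow_swap1)
    moreover have "(P ^^ Suc i) (act f ((Q ^^ j) v)) \<in> ?S"
      using ij(1) by (intro span_base CollectI exI[of _ "Suc i"] exI[of _ j]) simp
    moreover have "(P ^^ i) (act f ((Q ^^ Suc j) v)) \<in> ?S"
      using ij(1) by (intro span_base CollectI exI[of _ i] exI[of _ "Suc j"]) simp
    ultimately show "w \<in> ?S" by (simp add: span_diff)
  qed simp
  finally show ?case by (simp add: funpow_swap1)
qed

definition shift :: "('v \<Rightarrow> 'v) \<Rightarrow> 'f \<Rightarrow> 'v \<Rightarrow> 'v" where
  "shift T a v = T v - scale a v"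

lemma lin_shift: "lin T \<Longrightarrow> lin (shift T a)"
  unfolding shift_def[abs_def] by (intro lin_diff lin_scale linear_ident)

lemma shift_commute: "lin T \<Longrightarrow> shift T a (shift T b v) = shift T b (shift T a v)"
  by (simp add: shift_def linear_diffD linear_scaleD scale_right_diff_distrib scale_left_commute)

lemma shift_funpow_commute: "lin T \<Longrightarrow> (shift T a ^^ n) (shift T b v) = shift T b ((shift T a ^^ n) v)"
  by (induction n) (simp_all add: shift_commute)

lemma funpow_zero_mono:
  assumes "lin f" "(f ^^ m) v = 0" "m \<le> n"
  shows "(f ^^ n) v = 0"
proof -
  have "(f ^^ n) v = (f ^^ (n - m)) ((f ^^ m) v)"
    using assms(3) by (metis comp_apply funpow_add le_add_diff_inverse2)
  then show ?thesis
    by (simp add: assms(2) linear_zeroD[OF lin_funpow[OF assms(1)]])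
qed

text \<open>T - b and T - a differ by the nonzero scalar a - b. Modulo \<open>W\<close>, a vector
  killed by T - b and by a power of T - a is therefore 0.\<close>

lemma shift_mem_cancel:
  assumes T: "lin T" and W: "subspace W" "\<And>w. w \<in> W \<Longrightarrow> T w \<in> W" and ab: "a \<noteq> b"
    and "(shift T a ^^ n) v \<in> W" "shift T b v \<in> W"
  shows "v \<in> W"
  using assms(5,6)
proof (induction n arbitrary: v)
  case (Suc n)
  have sW: "shift T c w \<in> W" if "w \<in> W" for c w
    using that W by (simp add: shift_def subspace_diff subspace_scale)
  have "shift T a v \<in> W"
  proof (rule Suc.IH)
    show "(shift T a ^^ n) (shift T a v) \<in> W"
      using Suc.prems(1) by (simp add: funpow_swap1)
    show "shift T b (shift T a v) \<in> W"
      using sW[OF Suc.prems(2)] by (simp add: shift_commute[OF T])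
  qed
  then have "shift T b v - shift T a v \<in> W"
    using Suc.prems(2) W(1) by (simp add: subspace_diff)
  then have "scale (a - b) v \<in> W"
    by (simp add: shift_def scale_left_diff_distrib)
  then have "scale (inverse (a - b)) (scale (a - b) v) \<in> W"
    using W(1) by (rule subspace_scale[rotated])
  then show ?case
    using ab by simp
qed simp

text \<open>Induction on the sum of the exponents. Applying T - c lowers the exponent at
  \<open>c\<close>; the components at other eigenvalues are recovered by
  \<open>shift_mem_cancel\<close>, that at \<open>c\<close> by subtraction. It serves with
  \<open>W = {0}\<close> for uniqueness of the decomposition, and on spaces of operators.\<close>

lemma generalized_eigencomponents_mem:
  assumes T: "lin T" and W: "subspace W" "\<And>w. w \<in> W \<Longrightarrow> T w \<in> W" and S: "finite S"
    and k: "\<And>a. a \<in> S \<Longrightarrow> (shift T a ^^ n a) (k a) \<in> W" "(\<Sum>a\<in>S. k a) \<in> W" and a: "a \<in> S"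
  shows "k a \<in> W"
  using k a
proof (induction "\<Sum>a\<in>S. n a" arbitrary: n k a rule: less_induct)
  case less
  have sW: "shift T c w \<in> W" if "w \<in> W" for c w
    using that W by (simp add: shift_def subspace_diff subspace_scale)
  show ?case
  proof (cases "\<forall>a\<in>S. n a = 0")
    case True
    then show ?thesis using less.prems(1)[OF less.prems(3)] less.prems(3) by simp
  next
    case False
    then obtain c m where c: "c \<in> S" "n c = Suc m" using not0_implies_Suc by blast
    let ?n = "n(c := m)" and ?k = "\<lambda>a. shift T c (k a)"
    have 1: "(\<Sum>a\<in>S. ?n a) < (\<Sum>a\<in>S. n a)"
      using S c by (intro sum_strict_mono_ex1) auto
    have 2: "(shift T a ^^ ?n a) (?k a) \<in> W" if "a \<in> S" for a
    proof (cases "a = c")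
      case True
      then show ?thesis
        using less.prems(1)[OF that] c(2) by (simp add: funpow_swap1)
    next
      case False
      then show ?thesis
        using sW[OF less.prems(1)[OF that]] by (simp add: shift_funpow_commute[OF T])
    qed
    have 3: "(\<Sum>a\<in>S. ?k a) \<in> W"
      using sW[OF less.prems(2)] by (simp add: linear_sumD[OF lin_shift[OF T]])
    have kW: "?k a \<in> W" if "a \<in> S" for a
      using 1 2 3 that by (rule less.hyps)
    have other: "k a \<in> W" if "a \<in> S" "a \<noteq> c" for a
      using shift_mem_cancel[OF T W that(2) less.prems(1)[OF that(1)] kW[OF that(1)]] by simp
    have "k c = (\<Sum>a\<in>S. k a) - (\<Sum>a\<in>S - {c}. k a)"
      using S c(1) by (simp add: sum.remove)
    moreover have "(\<Sum>a\<in>S - {c}. k a) \<in> W"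
      using other by (intro subspace_sum[OF W(1)]) auto
    ultimately have "k c \<in> W"
      using subspace_diff[OF W(1) less.prems(2)] by simp
    then show ?thesis
      using other less.prems(3) by (cases "a = c") auto
  qed
qed

text \<open>On the generalized eigenspace of \<open>b\<close>, T - a is the nonzero scalar b - a
  plus the nilpotent T - b, hence invertible there; the preimage is built recursively.\<close>

lemma shift_surj:
  assumes T: "lin T" and V: "subspace V" "\<And>v. v \<in> V \<Longrightarrow> T v \<in> V" and ab: "a \<noteq> b"
    and "v \<in> V" "(shift T b ^^ n) v = 0"
  shows "\<exists>u\<in>V. (shift T b ^^ n) u = 0 \<and> shift T a u = v"
  using assms(5,6)
proof (induction n arbitrary: v)
  case 0
  then show ?case
    using V(1) by (intro bexI[of _ 0]) (simp_all add: linear_zeroD[OF lin_shift[OF T]])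
next
  case (Suc n)
  have "shift T b v \<in> V"
    using Suc.prems(1) V by (simp add: shift_def subspace_diff subspace_scale)
  then obtain u where u: "u \<in> V" "(shift T b ^^ n) u = 0" "shift T a u = shift T b v"
    using Suc.IH[of "shift T b v"] Suc.prems(2) by (auto simp: funpow_swap1)
  \<comment> \<open>By the choice of \<open>u\<close>, (T - a)(v - u) = (T - a) v - (T - b) v = (b -
    a) v.\<close>
  let ?w = "scale (inverse (b - a)) (v - u)"
  have "shift T a (v - u) = scale (b - a) v"
    using u(3) by (simp add: linear_diffD[OF lin_shift[OF T]]) (simp add: shift_def algebra_simps)
  then have "shift T a ?w = v"
    using ab by (simp add: linear_scaleD[OF lin_shift[OF T]])
  moreover have "(shift T b ^^ Suc n) u = 0"
    using u(2) by (simp add: linear_zeroD[OF lin_shift[OF T]])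
  then have "(shift T b ^^ Suc n) ?w = 0"
    using Suc.prems(2)
    by (simp only: linear_scaleD[OF lin_funpow[OF lin_shift[OF T]]]
        linear_diffD[OF lin_funpow[OF lin_shift[OF T]]]) simp
  ultimately show ?case
    using V(1) u(1) Suc.prems(1) by (intro bexI[of _ ?w]) (auto intro: subspace_scale subspace_diff)
qed

end

locale linear_space_alg_closed = linear_space_char_0 scale
  for scale :: "'f::{alg_closed_field, field_char_0} \<Rightarrow> 'v::ab_group_add \<Rightarrow> 'v"
begin

text \<open>Let p be of least degree with p(x) v in the span of the generalized eigenvectors, a a
  root of p and p = (X - a) q. Then w = q(x) v is outside the span, but (x - a) w is inside. Writing
  (x - a) w = (x - a) u + e with e a generalized eigenvector for a makes w - u a generalized
  eigenvector, so w lies in the span after all.\<close>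

lemma span_generalized_eigenvectors:
  assumes x: "lin x" "\<And>v. v \<in> span B \<Longrightarrow> x v \<in> span B" and B: "finite B"
  shows "span B \<subseteq> span {v \<in> span B. \<exists>a n. (shift x a ^^ n) v = 0}" (is "_ \<subseteq> span ?E")
proof
  fix v assume v: "v \<in> span B"
  show "v \<in> span ?E"
  proof (rule ccontr)
    assume nv: "v \<notin> span ?E"
    let ?P = "\<lambda>p. p \<noteq> 0 \<and> poly_op p x v \<in> span ?E"
    obtain p0 where "p0 \<noteq> 0" "poly_op p0 x v = 0"
      using annihilating_poly_vector[OF x B v] by metis
    then have "?P p0" by (simp add: span_zero)
    then obtain p where p: "?P p" and min: "\<And>q. ?P q \<Longrightarrow> degree p \<le> degree q"
      using arg_min_nat_lemma[of ?P p0 degree] by blast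
    have "degree p > 0"
    proof (rule ccontr)
      assume "\<not> degree p > 0"
      then obtain c where c: "p = [:c:]"
        by (metis degree_eq_zeroE neq0_conv)
      have "scale c v \<in> span ?E"
        using p c by (simp add: poly_op_pCons[OF x(1)] linear_zeroD[OF x(1)])
      then have "scale (inverse c) (scale c v) \<in> span ?E"
        by (rule span_scale)
      then show False
        using nv p c by simp
    qed
    then obtain a where "poly p a = 0"
      using alg_closed_imp_poly_has_root by blast
    then obtain q where q: "p = [:-a, 1:] * q"
      by (auto simp: poly_eq_0_iff_dvd)
    then have "q \<noteq> 0"
      using p by auto
    then have "degree p = Suc (degree q)"
      unfolding q by (subst degree_mult_eq) simp_all
    define w where "w = poly_op q x v"
    have wE: "w \<notin> span ?E"
      using min[of q] \<open>q \<noteq> 0\<close> \<open>degree p = Suc (degree q)\<close> by (auto simp: w_def)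
    have "endo {} B x"
      using x by (simp add: endo_def linear_zeroD)
    then have wB: "w \<in> span B"
      using endo_poly_op[of "{}" B x q] v by (simp add: endo_def w_def)
    have "poly_op p x v = shift x a w"
      by (simp only: q poly_op_mult[OF x(1)] w_def)
        (simp add: poly_op_pCons[OF x(1)] linear_zeroD[OF x(1)] shift_def)
    then have "shift x a w \<in> span ?E"
      using p by simp
    \<comment> \<open>Summands for eigenvalues other than \<open>a\<close> are in the image of x - a
      by \<open>shift_surj\<close>; those for \<open>a\<close> are collected in
      \<open>e\<close>.\<close>
    moreover have "\<exists>u e n. u \<in> span ?E \<and> e \<in> span B \<and> (shift x a ^^ n) e = 0 \<and> z = shift x a u + e"
      if "z \<in> span ?E" for z
      using that
    proof (induction rule: span_induct_alt)
      case base
      show ?case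
        by (intro exI[of _ 0]) (simp add: span_zero linear_zeroD[OF lin_shift[OF x(1)]])
    next
      case (step c z y)
      obtain u e n where u: "u \<in> span ?E" "e \<in> span B" "(shift x a ^^ n) e = 0" "y = shift x a u + e"
        using step.IH by blast
      obtain b m where z: "z \<in> span B" "(shift x b ^^ m) z = 0"
        using step.hyps by blast
      note L = lin_shift[OF x(1)] lin_funpow[OF lin_shift[OF x(1)]]
      show ?case
      proof (cases "a = b")
        case True
        have "(shift x a ^^ max m n) e = 0" "(shift x a ^^ max m n) z = 0"
          using funpow_zero_mono[OF L(1)] u(3) z(2) True by (metis max.cobounded1 max.cobounded2)+
        then have "(shift x a ^^ max m n) (scale c z + e) = 0"
          by (simp add: linear_addD[OF L(2)] linear_scaleD[OF L(2)])
        then show ?thesis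
          using u z by (intro exI[of _ u] exI[of _ "scale c z + e"] exI[of _ "max m n"])
            (auto intro: span_add span_scale)
      next
        case False
        obtain z' where z': "z' \<in> span B" "(shift x b ^^ m) z' = 0" "shift x a z' = z"
          using shift_surj[OF x(1) subspace_span x(2) False z] by blast
        then have "z' \<in> span ?E"
          by (intro span_base) auto
        then show ?thesis
          using u z' by (intro exI[of _ "scale c z' + u"] exI[of _ e] exI[of _ n])
            (auto simp: linear_addD[OF L(1)] linear_scaleD[OF L(1)] intro: span_add span_scale)
      qed
    qed
    ultimately obtain u e n where u: "u \<in> span ?E" "e \<in> span B" "(shift x a ^^ n) e = 0"
      "shift x a w = shift x a u + e" by blast
    have "span ?E \<subseteq> span B"
      by (rule span_minimal) auto
    moreover have "shift x a (w - u) = e"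
      by (simp add: linear_diffD[OF lin_shift[OF x(1)]] u(4))
    then have "(shift x a ^^ Suc n) (w - u) = 0"
      by (simp only: funpow_Suc_right comp_apply u(3))
    ultimately have "w - u \<in> ?E"
      using wB u(1) by (blast intro: span_diff)
    then have "(w - u) + u \<in> span ?E"
      by (rule span_add[OF span_base u(1)])
    then show False
      using wE by simp
  qed
qed

lemma generalized_eigenbasis:
  assumes x: "lin x" "\<And>v. v \<in> span B \<Longrightarrow> x v \<in> span B" and B: "finite B"
  obtains C a N where "frame {} C" "span C = span B" "\<And>c. c \<in> C \<Longrightarrow> (shift x (a c) ^^ N) c = 0"
proof -
  let ?E = "{v \<in> span B. \<exists>a n. (shift x a ^^ n) v = 0}"
  obtain C where C: "C \<subseteq> ?E" "independent C" "?E \<subseteq> span C"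
    using maximal_independent_subset by blast
  have "span B \<subseteq> span C"
    using span_generalized_eigenvectors[OF assms] span_minimal[OF C(3)] by simp
  moreover have "span C \<subseteq> span B"
    using C(1) by (intro span_minimal) auto
  ultimately have span: "span C = span B"
    by simp
  have fin: "finite C"
    using independent_span_bound[OF B C(2)] C(1) by blast
  have "\<forall>c\<in>C. \<exists>a n. (shift x a ^^ n) c = 0"
    using C(1) by blast
  then obtain a n where an: "\<And>c. c \<in> C \<Longrightarrow> (shift x (a c) ^^ n c) c = 0"
    by metis
  show ?thesis
  proof (rule that)
    show "frame {} C"
      using fin C(2) by (simp add: frame_def)
    show "(shift x (a c) ^^ Max (n ` C)) c = 0" if "c \<in> C" for c
      using funpow_zero_mono[OF lin_shift[OF x(1)] an[OF that]] that fin by simp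
  qed (rule span)
qed

end

text \<open>The field is regarded as a vector space over the rationals, where \<open>{c}\<close> is
  independent. Rational values are what later allow the conclusion that squares summing to 0 are all
  0.\<close>

lemma rat_functional:
  fixes c :: "'f::field_char_0"
  assumes "c \<noteq> 0"
  obtains \<phi> :: "'f \<Rightarrow> rat" where "\<And>x y. \<phi> (x + y) = \<phi> x + \<phi> y" "\<And>q x. \<phi> (of_rat q * x) = q * \<phi> x"
    "\<phi> c \<noteq> 0"
proof -
  interpret P: vector_space_pair "\<lambda>q (x :: 'f). of_rat q * x" "(*) :: rat \<Rightarrow> rat \<Rightarrow> rat"
    by unfold_locales (simp_all add: algebra_simps of_rat_add of_rat_mult)
  have "P.vs1.independent {c}"
    using assms by simp
  then obtain \<phi> where \<phi>: "Vector_Spaces.linear (\<lambda>q x. of_rat q * x) (*) \<phi>" "\<forall>x\<in>{c}. \<phi> x = 1"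
    using P.linear_independent_extend[of "{c}" "\<lambda>_. 1"] by blast
  then show ?thesis
    using that[of \<phi>] linear_addD[OF \<phi>(1)] linear_scaleD[OF \<phi>(1)] by simp
qed

lemma sum_fun_apply: "(\<Sum>i\<in>I. f i) v = (\<Sum>i\<in>I. f i v)"
  by (induction I rule: infinite_finite_induct) auto

lemma (in linear_space) lin_zero_on_span:
  assumes "lin f" "\<And>c. c \<in> C \<Longrightarrow> f c = 0" "v \<in> span C"
  shows "f v = 0"
  using span_image_subset[OF assms(1) _ subspace_single_0 assms(3)] assms(2) by blast

lemma (in linear_space) lin_extend:
  assumes "independent C"
  obtains g where "lin g" "\<And>c. c \<in> C \<Longrightarrow> g c = h c"
proof -
  interpret P: vector_space_pair scale scale
    by (simp add: vector_space_pair_def vector_space_axioms)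
  show ?thesis
    using P.linear_independent_extend[OF assms, of h] that by blast
qed

context linear_space_alg_closed
begin

text \<open>The operators \<open>y\<close> that matter arise from the semisimple part of \<open>x\<close> by applying a
  \<open>\<rat>\<close>-linear functional \<open>\<phi>\<close> to the eigenvalues: \<open>K\<close> is the sum of its generalized
  eigenspaces under \<open>[x, -]\<close>, and \<open>[y, -]\<close> is scalar on each.  Applying \<open>\<phi>\<close> to the trace
  of \<open>x y\<close> gives a sum of squares.\<close>

lemma nilpotent_if_rtrace_commutant_zero:
  assumes B: "frame {} B" and x: "endo {} B x"
    and K0: "(\<lambda>v. 0) \<in> K" and K_add: "\<And>f g. f \<in> K \<Longrightarrow> g \<in> K \<Longrightarrow> (\<lambda>v. f v + g v) \<in> K"
    and K_scale: "\<And>c f. f \<in> K \<Longrightarrow> (\<lambda>v. scale c (f v)) \<in> K"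
    and K_endo: "\<And>k. k \<in> K \<Longrightarrow> endo {} B k"
    and K_x: "\<And>k. k \<in> K \<Longrightarrow> \<exists>k'\<in>K. \<forall>v\<in>span B. x (k v) - k (x v) = k' v"
    and tr: "\<And>y. endo {} B y \<Longrightarrow>
       (\<And>k. k \<in> K \<Longrightarrow> \<exists>k'\<in>K. \<forall>v\<in>span B. y (k v) - k (y v) = k' v) \<Longrightarrow>
       rtrace {} B (\<lambda>v. x (y v)) = 0"
  shows "\<exists>n. \<forall>v\<in>span B. (x ^^ n) v = 0"
proof -
  have xl: "lin x" and xB: "\<And>v. v \<in> span B \<Longrightarrow> x v \<in> span B"
    using x by (auto simp: endo_def)
  obtain C a N where fr: "frame {} C" and spC: "span C = span B"
    and C: "\<And>c. c \<in> C \<Longrightarrow> (shift x (a c) ^^ N) c = 0"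
    using generalized_eigenbasis[OF xl xB frameD(2)[OF B]] by metis
  note indep = frameD(3)[OF fr] and fin = frameD(2)[OF fr]
  define V where "V = span C"
  have V: "subspace V" and CV: "\<And>c. c \<in> C \<Longrightarrow> c \<in> V"
    by (auto simp: V_def span_base)
  define S where "S = a ` C"
  have "\<exists>p. lin p \<and> (\<forall>c\<in>C. p c = (if a c = \<mu> then c else 0))" for \<mu>
    using lin_extend[OF indep, of "\<lambda>c. if a c = \<mu> then c else 0"] by metis
  then obtain \<pi> where \<pi>: "\<And>\<mu>. lin (\<pi> \<mu>)" "\<And>\<mu> c. c \<in> C \<Longrightarrow> \<pi> \<mu> c = (if a c = \<mu> then c else 0)"
    by metis
  define E where "E \<mu> = {v \<in> V. (shift x \<mu> ^^ N) v = 0}" for \<mu>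
  note shN = lin_funpow[OF lin_shift[OF xl]]
  have E: "subspace (E \<mu>)" for \<mu>
    unfolding E_def subspace_def using V
    by (auto simp: subspace_def linear_addD[OF shN] linear_scaleD[OF shN] linear_zeroD[OF shN])
  have \<pi>E: "\<pi> \<mu> v \<in> E \<mu>" if "v \<in> V" for \<mu> v
    using that unfolding V_def
    by (rule span_image_subset[OF \<pi>(1) _ E, rotated])
      (use C CV subspace_0[OF E] in \<open>auto simp: \<pi>(2) E_def\<close>)
  have EV: "v \<in> V" if "v \<in> E \<mu>" for v \<mu>
    using that by (simp add: E_def)
  have CE: "c \<in> E (a c)" if "c \<in> C" for c
    using that C CV by (simp add: E_def)
  have finS: "finite S"
    by (simp add: S_def fin)
  have \<pi>_sum: "(\<Sum>\<mu>\<in>S. \<pi> \<mu> v) = v" if "v \<in> V" for v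
  proof -
    have "(\<Sum>\<mu>\<in>S. \<pi> \<mu> v) - v = 0"
    proof (rule lin_zero_on_span[of "\<lambda>v. (\<Sum>\<mu>\<in>S. \<pi> \<mu> v) - v" C])
      show "lin (\<lambda>v. (\<Sum>\<mu>\<in>S. \<pi> \<mu> v) - v)"
        by (intro lin_diff lin_sum \<pi> linear_ident)
    qed (use that finS in \<open>auto simp: \<pi>(2) S_def V_def\<close>)
    then show ?thesis by simp
  qed
  have \<pi>_out: "\<pi> \<mu> v = 0" if "v \<in> V" "\<mu> \<notin> S" for v \<mu>
    by (rule lin_zero_on_span[OF \<pi>(1)]) (use that in \<open>auto simp: \<pi>(2) S_def V_def\<close>)
  \<comment> \<open>The differences \<open>?k\<close> are generalized eigenvectors for distinct
    eigenvalues with sum 0, hence 0. The index \<nu> is inserted because it need not be an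
    eigenvalue.\<close>
  have \<pi>_on: "\<pi> \<mu> v = (if \<mu> = \<nu> then v else 0)" if v: "v \<in> E \<nu>" for v \<mu> \<nu>
  proof -
    let ?k = "\<lambda>\<mu>. \<pi> \<mu> v - (if \<mu> = \<nu> then v else 0)"
    have "?k \<mu> \<in> {0}" if "\<mu> \<in> insert \<nu> S" for \<mu>
    proof (rule generalized_eigencomponents_mem[OF xl, where S = "insert \<nu> S" and n = "\<lambda>_. N"
            and k = ?k and a = \<mu> and W = "{0}"])
      show "(\<Sum>\<mu>\<in>insert \<nu> S. ?k \<mu>) \<in> {0}"
        using finS \<pi>_sum[OF EV[OF v]] \<pi>_out[OF EV[OF v], of \<nu>]
        by (cases "\<nu> \<in> S") (simp_all add: sum_subtractf insert_absorb)
      show "(shift x \<mu> ^^ N) (?k \<mu>) \<in> {0}" for \<mu>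
        using v \<pi>E[OF EV[OF v], of \<mu>] by (auto simp: E_def linear_diffD[OF shN] linear_zeroD[OF shN])
    qed (use that finS in \<open>auto simp: linear_zeroD[OF xl]\<close>)
    then show ?thesis
      using \<pi>_out[OF EV[OF v], of \<mu>] \<pi>_out[OF EV[OF v], of \<nu>] by (cases "\<mu> \<in> insert \<nu> S") auto
  qed
  have shE: "shift x \<mu> v \<in> E \<mu>" if "v \<in> E \<mu>" for v \<mu>
  proof -
    have "shift x \<mu> v \<in> V"
      using that V xB by (auto simp: E_def shift_def V_def spC intro: span_diff span_scale)
    then show ?thesis
      using that by (auto simp: E_def shift_funpow_commute[OF xl] linear_zeroD[OF lin_shift[OF xl]])
  qed
  have shE_zero: "(shift x \<mu> ^^ j) v = 0" if "v \<in> E \<mu>" "N \<le> j" for v \<mu> j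
    by (rule funpow_zero_mono[OF lin_shift[OF xl] _ that(2)]) (use that(1) in \<open>simp add: E_def\<close>)
  \<comment> \<open>\<open>diag g\<close> is the scalar g \<mu> on each \<open>E \<mu>\<close>; for
    \<open>g\<close> the identity it is the semisimple part of \<open>x\<close>.\<close>
  define diag where "diag g v = (\<Sum>\<mu>\<in>S. scale (g \<mu>) (\<pi> \<mu> v))" for g :: "'f \<Rightarrow> 'f" and v
  have diag_lin: "lin (diag g)" for g
    unfolding diag_def[abs_def] by (intro lin_sum lin_scale \<pi>)
  have diag_E: "diag g v = scale (g \<mu>) v" if "v \<in> E \<mu>" for g v \<mu>
  proof (cases "\<mu> \<in> S")
    case True
    then show ?thesis
      using finS by (simp add: diag_def \<pi>_on[OF that] if_distrib[of "scale _"] cong: if_cong)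
  next
    case False
    then have "v = 0"
      using \<pi>_out[OF EV[OF that] False] \<pi>_on[OF that, of \<mu>] by simp
    then show ?thesis
      by (simp add: linear_zeroD[OF diag_lin])
  qed
  have diag_endo: "endo {} C (diag g)" for g
    unfolding endo_def
  proof (intro conjI ballI diag_lin)
    fix v assume "v \<in> span C"
    then show "diag g v \<in> span C"
      unfolding diag_def using \<pi>E[of v] EV by (fold V_def) (intro subspace_sum[OF V] subspace_scale[OF V], blast)
  qed (simp add: linear_zeroD[OF diag_lin])

  \<comment> \<open>The operator k splits into parts \<open>comp \<mu>\<close> mapping each
    \<open>E \<nu>\<close> into E(\<mu> + \<nu>). These are generalized eigenvectors of [x, -] for
    distinct \<mu>, so invariance of \<open>K\<close> under [x, -] puts every part into
    \<open>K\<close>, up to agreement on V. For additive \<open>g\<close>,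
    [\<open>diag g\<close>, -] multiplies the part of weight \<mu> by g \<mu>.\<close>
  have diag_K: "\<exists>k'\<in>K. \<forall>v\<in>V. diag g (k v) - k (diag g v) = k' v"
    if k: "k \<in> K" and g: "\<And>s t. g (s - t) = g s - g t" for k g
  proof -
    have kl: "lin k" and kV: "\<And>v. v \<in> V \<Longrightarrow> k v \<in> V"
      using K_endo[OF k] by (auto simp: endo_def V_def spC)
    let ?sc = "\<lambda>c (f :: 'v \<Rightarrow> 'v) v. scale c (f v)"
    interpret Op: linear_space ?sc
      by unfold_locales (auto simp: scale_right_distrib scale_left_distrib)
    define T where "T f v = x (f v) - f (x v)" for f :: "'v \<Rightarrow> 'v" and v
    have Tl: "Op.lin T"
      by (rule Op.linI) (auto simp: T_def linear_addD[OF xl] linear_scaleD[OF xl] scale_right_diff_distrib)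
    \<comment> \<open>Elements of \<open>K\<close> are functions on the whole space, but the
      hypotheses control commutators only on V; so membership in \<open>K\<close> is relaxed to
      agreement on V.\<close>
    define W where "W = {f. \<exists>k\<in>K. \<forall>v\<in>V. f v = k v}"
    have W: "Op.subspace W"
    proof (rule Op.subspaceI)
      show "0 \<in> W"
        using K0 by (auto simp: W_def)
      show "f + h \<in> W" if fW: "f \<in> W" and hW: "h \<in> W" for f h
      proof -
        obtain f' where f: "f' \<in> K" "\<forall>v\<in>V. f v = f' v"
          using fW unfolding W_def by blast
        obtain h' where h: "h' \<in> K" "\<forall>v\<in>V. h v = h' v"
          using hW unfolding W_def by blast
        show ?thesis
          using f(2) h(2) unfolding W_def by (intro CollectI bexI[OF _ K_add[OF f(1) h(1)]]) simp
      qed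
      show "?sc c f \<in> W" if fW: "f \<in> W" for c f
      proof -
        obtain f' where f: "f' \<in> K" "\<forall>v\<in>V. f v = f' v"
          using fW unfolding W_def by blast
        show ?thesis
          using f(2) unfolding W_def by (intro CollectI bexI[OF _ K_scale[OF f(1), of c]]) simp
      qed
    qed
    have TW: "T f \<in> W" if fW: "f \<in> W" for f
    proof -
      obtain f' where f: "f' \<in> K" "\<forall>v\<in>V. f v = f' v"
        using fW unfolding W_def by blast
      obtain k' where k': "k' \<in> K" "\<forall>v\<in>V. x (f' v) - f' (x v) = k' v"
        using K_x[OF f(1)] by (auto simp: V_def spC)
      have "x v \<in> V" if "v \<in> V" for v
        using that xB by (simp add: V_def spC)
      then show ?thesis
        using k' f(2) unfolding W_def T_def by (intro CollectI bexI[OF _ k'(1)]) auto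
    qed
    define comp where "comp \<mu> v = (\<Sum>\<nu>\<in>S. \<pi> (\<mu> + \<nu>) (k (\<pi> \<nu> v)))" for \<mu> v
    have comp_lin: "lin (comp \<mu>)" for \<mu>
      unfolding comp_def[abs_def] by (intro lin_sum lin_compose[OF \<pi>(1)] lin_compose[OF kl] \<pi>(1))
    have comp_E: "comp \<mu> v = \<pi> (\<mu> + \<nu>) (k v)" if "v \<in> E \<nu>" "\<nu> \<in> S" for v \<mu> \<nu>
    proof -
      have "comp \<mu> v = (\<Sum>\<nu>'\<in>S. if \<nu>' = \<nu> then \<pi> (\<mu> + \<nu>) (k v) else 0)"
        unfolding comp_def
        by (intro sum.cong refl) (simp add: \<pi>_on[OF that(1)] linear_zeroD[OF kl] linear_zeroD[OF \<pi>(1)])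
      then show ?thesis
        using finS that(2) by simp
    qed
    \<comment> \<open>As k maps V to V, only differences of eigenvalues of \<open>x\<close> occur as
      weights.\<close>
    define M where "M = (\<lambda>(s, t). s - t) ` (S \<times> S)"
    have finM: "finite M"
      by (simp add: M_def finS)
    have reindex: "(\<Sum>\<mu>\<in>M. scale (h \<mu>) (\<pi> (\<mu> + \<nu>) w)) = (\<Sum>\<mu>\<in>S. scale (h (\<mu> - \<nu>)) (\<pi> \<mu> w))"
      if "\<nu> \<in> S" "w \<in> V" for h \<nu> w
    proof -
      have "(\<Sum>\<mu>\<in>M. scale (h \<mu>) (\<pi> (\<mu> + \<nu>) w)) = (\<Sum>\<mu>\<in>(\<lambda>\<mu>. \<mu> + \<nu>) ` M. scale (h (\<mu> - \<nu>)) (\<pi> \<mu> w))"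
        by (subst sum.reindex) (auto simp: inj_on_def)
      also have "\<dots> = (\<Sum>\<mu>\<in>S. scale (h (\<mu> - \<nu>)) (\<pi> \<mu> w))"
      proof (rule sum.mono_neutral_right)
        show "S \<subseteq> (\<lambda>\<mu>. \<mu> + \<nu>) ` M"
        proof
          fix s assume "s \<in> S"
          then have "s - \<nu> \<in> M" "s = (s - \<nu>) + \<nu>"
            using that(1) by (auto simp: M_def)
          then show "s \<in> (\<lambda>\<mu>. \<mu> + \<nu>) ` M" by blast
        qed
      qed (use finM \<pi>_out[OF that(2)] in auto)
      finally show ?thesis .
    qed
    \<comment> \<open>In a product (x - \<mu> - \<nu>)^i \<open>comp \<mu>\<close> (x - \<nu>)^j
      with i + j = 2N one of the exponents is at least N, and N is the exponent that kills both
      \<open>E \<nu>\<close> and E(\<mu> + \<nu>).\<close>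
    have nil: "((Op.shift T \<mu>) ^^ (2 * N)) (comp \<mu>) \<in> W" for \<mu>
    proof -
      have Tlin: "lin (T f)" if "lin f" for f
        unfolding T_def[abs_def] by (intro lin_diff lin_compose[OF xl] lin_compose[OF that] xl that)
      have shlin: "lin (Op.shift T \<mu> f)" if "lin f" for f
        unfolding Op.shift_def using lin_diff[OF Tlin[OF that] lin_scale[OF that, of \<mu>]]
        by (simp add: fun_diff_def)
      have powlin: "lin ((Op.shift T \<mu> ^^ n) f)" if "lin f" for f n
        using that by (induction n) (auto intro: shlin)
      have "((Op.shift T \<mu>) ^^ (2 * N)) (comp \<mu>) c = 0" if c: "c \<in> C" for c
      proof -
        define \<nu> where "\<nu> = a c"
        have c\<nu>: "c \<in> E \<nu>" and \<nu>S: "\<nu> \<in> S"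
          using c CE by (auto simp: \<nu>_def S_def)
        \<comment> \<open>For linear f the operator [x, f] - \<mu> f is (x - \<mu> - \<nu>) f - f (x
          - \<nu>). This distributes \<mu> so that both outer factors are nilpotent on the relevant
          eigenspaces.\<close>
        define D where "D f v = shift x (\<mu> + \<nu>) (f v) - f (shift x \<nu> v)" for f v
        have D: "Op.shift T \<mu> f = D f" if "lin f" for f
          by (rule ext) (simp add: Op.shift_def T_def D_def shift_def linear_diffD[OF that]
              linear_scaleD[OF that] scale_left_distrib algebra_simps)
        have "(Op.shift T \<mu> ^^ n) f = (D ^^ n) f" if "lin f" for n f
        proof (induction n)
          case (Suc n)
          then show ?case using D[OF powlin[OF that, of n]] by simp
        qed simp
        then have "((Op.shift T \<mu>) ^^ (2 * N)) (comp \<mu>) c = (D ^^ (2 * N)) (comp \<mu>) c"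
          by (simp add: comp_lin)
        also have "\<dots> \<in> span {(shift x (\<mu> + \<nu>) ^^ i) (comp \<mu> ((shift x \<nu> ^^ j) c)) | i j. i + j = 2 * N}"
          by (rule commutator_iterate[where act = "\<lambda>f. f"]) (simp_all add: lin_shift[OF xl] D_def)
        also have "\<dots> \<subseteq> span {0}"
        proof (intro span_mono subsetI)
          fix w assume "w \<in> {(shift x (\<mu> + \<nu>) ^^ i) (comp \<mu> ((shift x \<nu> ^^ j) c)) | i j. i + j = 2 * N}"
          then obtain i j where ij: "i + j = 2 * N" "w = (shift x (\<mu> + \<nu>) ^^ i) (comp \<mu> ((shift x \<nu> ^^ j) c))"
            by blast
          have cj: "(shift x \<nu> ^^ j) c \<in> E \<nu>"
            using funpow_mem[of "E \<nu>" "shift x \<nu>"] shE c\<nu> by blast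
          show "w \<in> {0}"
          proof (cases "N \<le> j")
            case True
            then have "(shift x \<nu> ^^ j) c = 0"
              using shE_zero[OF c\<nu>] by simp
            then show ?thesis
              by (simp add: ij(2) linear_zeroD[OF comp_lin] linear_zeroD[OF shN])
          next
            case False
            have "comp \<mu> ((shift x \<nu> ^^ j) c) \<in> E (\<mu> + \<nu>)"
              using comp_E[OF cj \<nu>S] \<pi>E kV EV[OF cj] by simp
            then show ?thesis
              using False ij shE_zero by simp
          qed
        qed
        finally show ?thesis by simp
      qed
      then have "((Op.shift T \<mu>) ^^ (2 * N)) (comp \<mu>) v = 0" if "v \<in> V" for v
        by (rule lin_zero_on_span[OF powlin[OF comp_lin] _ that[unfolded V_def]])
      then show ?thesis
        using K0 unfolding W_def by (intro CollectI bexI[OF _ K0]) simp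
    qed
    have comp_sum: "(\<Sum>\<mu>\<in>M. scale (h \<mu>) (comp \<mu> c)) = (\<Sum>\<mu>\<in>S. scale (h (\<mu> - a c)) (\<pi> \<mu> (k c)))"
      if "c \<in> C" for h c
      using comp_E[OF CE[OF that]] reindex[of "a c" "k c" h] that kV CV by (simp add: S_def)
    have "(\<Sum>\<mu>\<in>M. comp \<mu>) v = k v" if "v \<in> V" for v
    proof -
      have "(\<Sum>\<mu>\<in>M. comp \<mu> v) - k v = 0"
      proof (rule lin_zero_on_span[of "\<lambda>v. (\<Sum>\<mu>\<in>M. comp \<mu> v) - k v" C])
        show "lin (\<lambda>v. (\<Sum>\<mu>\<in>M. comp \<mu> v) - k v)"
          by (intro lin_diff lin_sum comp_lin kl)
        show "(\<Sum>\<mu>\<in>M. comp \<mu> c) - k c = 0" if "c \<in> C" for c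
          using comp_sum[OF that, of "\<lambda>_. 1"] \<pi>_sum[OF kV[OF CV[OF that]]] by simp
      qed (use that in \<open>simp add: V_def\<close>)
      then show ?thesis by (simp add: sum_fun_apply)
    qed
    then have "(\<Sum>\<mu>\<in>M. comp \<mu>) \<in> W"
      unfolding W_def using k by blast
    then have "comp \<mu> \<in> W" if "\<mu> \<in> M" for \<mu>
      using Op.generalized_eigencomponents_mem[OF Tl W TW finM, of "\<lambda>_. 2 * N" comp] nil that by blast
    then have "(\<Sum>\<mu>\<in>M. ?sc (g \<mu>) (comp \<mu>)) \<in> W"
      by (intro Op.subspace_sum[OF W] Op.subspace_scale[OF W])
    then obtain k' where k': "k' \<in> K" "\<forall>v\<in>V. (\<Sum>\<mu>\<in>M. scale (g \<mu>) (comp \<mu> v)) = k' v"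
      unfolding W_def by (auto simp: sum_fun_apply)
    moreover have "diag g (k v) - k (diag g v) = (\<Sum>\<mu>\<in>M. scale (g \<mu>) (comp \<mu> v))" if "v \<in> V" for v
    proof -
      have "diag g (k v) - k (diag g v) - (\<Sum>\<mu>\<in>M. scale (g \<mu>) (comp \<mu> v)) = 0"
      proof (rule lin_zero_on_span[of "\<lambda>v. diag g (k v) - k (diag g v) - (\<Sum>\<mu>\<in>M. scale (g \<mu>) (comp \<mu> v))" C])
        show "lin (\<lambda>v. diag g (k v) - k (diag g v) - (\<Sum>\<mu>\<in>M. scale (g \<mu>) (comp \<mu> v)))"
          by (intro lin_diff lin_sum lin_scale lin_compose[OF diag_lin] lin_compose[OF kl] comp_lin kl diag_lin)
        fix c assume c: "c \<in> C"
        have "k (diag g c) = (\<Sum>\<mu>\<in>S. scale (g (a c)) (\<pi> \<mu> (k c)))"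
          using \<pi>_sum[OF kV[OF CV[OF c]]]
          by (simp add: diag_E[OF CE[OF c]] linear_scaleD[OF kl] flip: scale_sum_right)
        then show "diag g (k c) - k (diag g c) - (\<Sum>\<mu>\<in>M. scale (g \<mu>) (comp \<mu> c)) = 0"
          by (simp add: comp_sum[OF c] diag_def g scale_left_diff_distrib flip: sum_subtractf)
      qed (use that in \<open>simp add: V_def\<close>)
      then show ?thesis by simp
    qed
    ultimately show ?thesis by metis
  qed

  have "a c = 0" if c: "c \<in> C" for c
  proof (rule ccontr)
    assume "a c \<noteq> 0"
    then obtain \<phi> :: "'f \<Rightarrow> rat" where \<phi>: "\<And>s t. \<phi> (s + t) = \<phi> s + \<phi> t"
      "\<And>q s. \<phi> (of_rat q * s) = q * \<phi> s" "\<phi> (a c) \<noteq> 0"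
      using rat_functional by metis
    have \<phi>_diff: "\<phi> (s - t) = \<phi> s - \<phi> t" for s t
      using \<phi>(1)[of "s - t" t] by simp
    define g :: "'f \<Rightarrow> 'f" where "g s = of_rat (\<phi> s)" for s
    have g: "g (s - t) = g s - g t" for s t
      by (simp add: g_def \<phi>_diff of_rat_diff)
    let ?y = "diag g"
    have y: "endo {} B ?y"
      using diag_endo[of g] spC by (simp add: endo_def)
    have "rtrace {} B (\<lambda>v. x (?y v)) = 0"
      by (rule tr[OF y]) (use diag_K[OF _ g] in \<open>auto simp: V_def spC\<close>)
    moreover have "endo {} B (\<lambda>v. x (?y v))"
      by (rule endo_compose[OF x y])
    ultimately have "rtrace {} C (\<lambda>v. x (?y v)) = 0"
      using rtrace_basis[OF fr B refl spC, of "\<lambda>v. x (?y v)"] spC by (simp add: endo_def)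
    \<comment> \<open>Replacing \<open>x\<close> by its semisimple part \<open>?s\<close> does not
      change the trace of x y: the difference acts on \<open>E \<mu>\<close> as g \<mu> times x -
      \<mu>, which is nilpotent.\<close>
    let ?s = "diag (\<lambda>\<mu>. \<mu>)"
    let ?n = "\<lambda>v. x (?y v) - ?s (?y v)"
    have xC: "endo {} C x"
      using x spC by (simp add: endo_def)
    note endos = endo_compose[OF xC diag_endo[of g]] endo_compose[OF diag_endo diag_endo[of g]]
    have n: "endo {} C ?n"
      by (rule endo_diff[OF endos])
    have nE: "?n v = scale (g \<mu>) (shift x \<mu> v)" if "v \<in> E \<mu>" for v \<mu>
      using that by (simp add: diag_E linear_scaleD[OF xl] linear_scaleD[OF diag_lin] shift_def
          scale_right_diff_distrib)
    have npow: "(?n ^^ i) v = scale (g \<mu> ^ i) ((shift x \<mu> ^^ i) v)" if "v \<in> E \<mu>" for v \<mu> i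
    proof (induction i)
      case (Suc i)
      have "(shift x \<mu> ^^ i) v \<in> E \<mu>"
        using funpow_mem[of "E \<mu>" "shift x \<mu>"] shE that by blast
      then have "?n (scale (g \<mu> ^ i) ((shift x \<mu> ^^ i) v)) = scale (g \<mu>) (shift x \<mu> (scale (g \<mu> ^ i) ((shift x \<mu> ^^ i) v)))"
        by (intro nE subspace_scale[OF E])
      then show ?case
        by (simp add: Suc linear_scaleD[OF lin_shift[OF xl]])
    qed simp
    have "(?n ^^ N) c = 0" if "c \<in> C" for c
      using npow[OF CE[OF that], of N] shE_zero[OF CE[OF that], of N] by simp
    moreover have "lin (?n ^^ N)"
      using n by (intro lin_funpow) (simp add: endo_def)
    ultimately have "(?n ^^ N) v = 0" if "v \<in> span C" for v
      using lin_zero_on_span[of "?n ^^ N" C] that by blast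
    then have "rtrace {} C ?n = 0"
      by (intro rtrace_nilpotent[OF fr n, of N]) simp
    then have "rtrace {} C (\<lambda>v. ?s (?y v)) = 0"
      using \<open>rtrace {} C (\<lambda>v. x (?y v)) = 0\<close> rtrace_diff[OF fr endos] by simp
    moreover have "rtrace {} C (\<lambda>v. ?s (?y v)) = (\<Sum>c\<in>C. of_rat (\<phi> (a c)) * a c)"
      unfolding rtrace_def
      by (intro sum.cong) (simp_all add: diag_E[OF CE] linear_scaleD[OF diag_lin] indep
          representation_scale span_base representation_basis g_def)
    ultimately have "(\<Sum>c\<in>C. of_rat (\<phi> (a c)) * a c) = 0" by simp
    then have "\<phi> (\<Sum>c\<in>C. of_rat (\<phi> (a c)) * a c) = 0"
      using \<phi>(1)[of 0 0] by simp
    moreover have "\<phi> (\<Sum>c\<in>D. h c) = (\<Sum>c\<in>D. \<phi> (h c))" for D and h :: "'v \<Rightarrow> 'f"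
      using \<phi>(1)[of 0 0] by (induction D rule: infinite_finite_induct) (auto simp: \<phi>(1))
    ultimately have "(\<Sum>c\<in>C. \<phi> (a c) * \<phi> (a c)) = 0"
      by (simp add: \<phi>(2))
    then have "\<phi> (a c) * \<phi> (a c) = 0"
      using fin c by (subst (asm) sum_nonneg_eq_0_iff) auto
    then show False
      using \<phi>(3) by simp
  qed
  then have "(x ^^ N) c = 0" if "c \<in> C" for c
    using C[OF that] that by (simp add: shift_def[abs_def])
  then have "(x ^^ N) v = 0" if "v \<in> span B" for v
    by (rule lin_zero_on_span[OF lin_funpow[OF xl] _ that[folded spC]])
  then show ?thesis by blast
qed

end

section \<open>Engel's theorem\<close>

locale fd_lie_algebra =
  lie_algebra scale bracket + linear_space_char_0 scale + finite_dimensional_vector_space scale Basis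
  for scale :: "'f::field_char_0 \<Rightarrow> 'l::ab_group_add \<Rightarrow> 'l"
    and bracket :: "'l \<Rightarrow> 'l \<Rightarrow> 'l"
    and Basis :: "'l set"
begin

lemmas bracket_add_left = linear_addD[OF bracket_linear_left]
  and bracket_add_right = linear_addD[OF bracket_linear_right]
  and bracket_diff_left = linear_diffD[OF bracket_linear_left]
  and bracket_diff_right = linear_diffD[OF bracket_linear_right]
  and bracket_scale_left = linear_scaleD[OF bracket_linear_left]
  and bracket_scale_right = linear_scaleD[OF bracket_linear_right]
  and bracket_zero_left [simp] = linear_zeroD[OF bracket_linear_left]
  and bracket_zero_right [simp] = linear_zeroD[OF bracket_linear_right]
  and bracket_sum_left = linear_sumD[OF bracket_linear_left]
  and bracket_sum_right = linear_sumD[OF bracket_linear_right]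

lemma bracket_antisym: "bracket y x = - bracket x y"
proof -
  have eq: "bracket (x + y) (x + y) = bracket x (x + y) + bracket y (x + y)"
    by (rule bracket_add_left)
  have "bracket y x + bracket x y = 0"
    using bracket_self[of "x + y"] unfolding eq by (simp add: bracket_add_right bracket_self add.commute)
  then show ?thesis
    by (rule eq_neg_iff_add_eq_0[THEN iffD2])
qed

lemma bracket_neg_right: "bracket x (- y) = - bracket x y"
  using bracket_diff_right[of x 0 y] by simp

lemma bracket_bracket_left: "bracket (bracket a b) v = bracket a (bracket b v) - bracket b (bracket a v)"
proof -
  have "bracket a (bracket b v) + bracket b (bracket v a) + bracket v (bracket a b) = 0"
    by (rule jacobi)
  then show ?thesis
    by (simp add: bracket_antisym[of v a] bracket_antisym[of v "bracket a b"] bracket_neg_right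
        algebra_simps)
qed

lemma bracket_bracket_right: "bracket a (bracket b v) = bracket (bracket a b) v + bracket b (bracket a v)"
  by (simp add: bracket_bracket_left)

definition stable :: "'l set \<Rightarrow> 'l set \<Rightarrow> bool" where
  "stable D V \<longleftrightarrow> (\<forall>x\<in>D. \<forall>v\<in>V. bracket x v \<in> V)"

lemma stableD: "stable D V \<Longrightarrow> x \<in> D \<Longrightarrow> v \<in> V \<Longrightarrow> bracket x v \<in> V"
  by (simp add: stable_def)

lemma stable_mono: "stable D V \<Longrightarrow> E \<subseteq> D \<Longrightarrow> stable E V"
  by (auto simp: stable_def)

lemma subalgebraD: "subalgebra A \<Longrightarrow> subspace A" "subalgebra A \<Longrightarrow> stable A A"
  by (auto simp: subalgebra_def stable_def)

lemma ideal_ofD: "ideal_of A I \<Longrightarrow> subspace I" "ideal_of A I \<Longrightarrow> I \<subseteq> A" "ideal_of A I \<Longrightarrow> stable A I"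
  by (auto simp: ideal_of_def stable_def)

lemma ideal_of_right:
  assumes "ideal_of A I" "x \<in> I" "a \<in> A"
  shows "bracket x a \<in> I"
  using assms bracket_antisym[of x a] by (simp add: ideal_of_def subspace_neg)

lemma ideal_subalgebra: "ideal_of A I \<Longrightarrow> subalgebra I"
  by (auto simp: ideal_of_def subalgebra_def)

lemma subspace_frame:
  assumes "subspace U" "subspace V" "U \<subseteq> V"
  obtains A B where "frame A B" "span A = U" "span B = V"
proof -
  obtain A where A: "frame {} A" "span A = U"
    by (rule basis_extend[OF finite_Basis, of U "{}"])
      (use assms in \<open>auto simp: frame_empty independent_empty subspace_0 span_Basis\<close>)
  obtain B where "frame A B" "span B = V"
    by (rule basis_extend[OF finite_Basis, of V A]) (use assms A in \<open>auto simp: span_Basis\<close>)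
  then show ?thesis
    using A that by blast
qed

lemma subspace_basis:
  assumes "subspace V"
  obtains B where "frame {} B" "span B = V"
  using subspace_frame[OF assms assms order_refl] that frame_empty frameD(2,3) by metis

lemma dim_less: "subspace U \<Longrightarrow> subspace V \<Longrightarrow> U \<subseteq> V \<Longrightarrow> U \<noteq> V \<Longrightarrow> dim U < dim V"
  using subspace_dim_equal[of U V] by fastforce

lemma maximal_subspace:
  assumes "P E0" "\<And>E. P E \<Longrightarrow> subspace E"
  obtains E where "P E" "\<And>E'. P E' \<Longrightarrow> E \<subseteq> E' \<Longrightarrow> E' = E"
proof -
  obtain E where E: "P E" "\<And>E'. P E' \<Longrightarrow> dim E' \<le> dim E"
    using ex_has_greatest_nat[of P E0 dim "Suc dimension"] assms(1) dim_subset_UNIV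
    by (metis le_imp_less_Suc)
  show ?thesis
  proof (rule that[OF E(1)])
    fix E' assume "P E'" "E \<subseteq> E'"
    then show "E' = E"
      using E assms(2) dim_less[of E E'] by (metis not_le)
  qed
qed

lemma subspace_bracket_into:
  "subspace V \<Longrightarrow> subspace U \<Longrightarrow> subspace {v \<in> V. \<forall>x\<in>D. bracket x v \<in> U}"
  by (auto simp: subspace_def bracket_add_right bracket_scale_right)

lemma subspace_bracket_into_left:
  "subspace D \<Longrightarrow> subspace U \<Longrightarrow> subspace {x \<in> D. \<forall>v\<in>V. bracket x v \<in> U}"
  by (auto simp: subspace_def bracket_add_left bracket_scale_left)

text \<open>Engel's theorem for the module V/U, by induction on dim D. Let \<open>N\<close> be the
  kernel of the action and \<open>E\<close> a maximal proper subalgebra containing \<open>N\<close>.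
  The induction hypothesis for \<open>E\<close> acting on D/E gives y normalizing \<open>E\<close>,
  so D = E + F y by maximality. The hypothesis for \<open>E\<close> acting on V/U gives v killed by
  \<open>E\<close>; the last iterate of y on v that is nonzero modulo U is killed by all of
  D.\<close>

lemma engel:
  assumes "subalgebra D" "subspace U" "subspace V" "U \<subseteq> V" "U \<noteq> V" "stable D U" "stable D V"
    and "\<And>x. x \<in> D \<Longrightarrow> \<exists>n. \<forall>v\<in>V. (bracket x ^^ n) v \<in> U"
  shows "\<exists>v\<in>V - U. \<forall>x\<in>D. bracket x v \<in> U"
  using assms
proof (induction "dim D" arbitrary: D U V rule: less_induct)
  case less
  note D = less.prems(1) and U = less.prems(2) and V = less.prems(3) and nil = less.prems(8)
  note stU = stableD[OF less.prems(6)] and stV = stableD[OF less.prems(7)]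
  define N where "N = {x \<in> D. \<forall>v\<in>V. bracket x v \<in> U}"
  show ?case
  proof (cases "N = D")
    case True
    then have "\<forall>x\<in>D. \<forall>v\<in>V. bracket x v \<in> U"
      unfolding N_def by blast
    then show ?thesis
      using less.prems(4,5) by blast
  next
    case False
    let ?P = "\<lambda>E. subalgebra E \<and> N \<subseteq> E \<and> E \<subseteq> D \<and> E \<noteq> D"
    have "subspace N"
      unfolding N_def by (rule subspace_bracket_into_left[OF subalgebraD(1)[OF D] U])
    moreover have "bracket x y \<in> N" if "x \<in> N" "y \<in> N" for x y
      using that stU stableD[OF subalgebraD(2)[OF D]]
      by (auto simp: N_def bracket_bracket_left intro!: subspace_diff[OF U])
    ultimately have "subalgebra N"
      by (simp add: subalgebra_def)
    then have "?P N"
      using False by (auto simp: N_def)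
    then obtain E where E: "?P E" and max: "\<And>E'. ?P E' \<Longrightarrow> E \<subseteq> E' \<Longrightarrow> E' = E"
      using maximal_subspace[of ?P N] subalgebraD(1) by metis
    have dim: "dim E < dim D"
      using E D by (intro dim_less subalgebraD(1)) auto
    have Ealg: "subalgebra E" and ED: "E \<subseteq> D" and NE: "N \<subseteq> E"
      using E by auto
    have "\<exists>n. \<forall>y\<in>D. (bracket x ^^ n) y \<in> E" if x: "x \<in> E" for x
    proof -
      obtain n where n: "\<forall>v\<in>V. (bracket x ^^ n) v \<in> U"
        using nil x ED by blast
      have powU: "(bracket x ^^ i) u \<in> U" if "u \<in> U" for i u
        using funpow_mem[of U "bracket x"] stU x ED that by blast
      have powV: "(bracket x ^^ i) u \<in> V" if "u \<in> V" for i u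
        using funpow_mem[of V "bracket x"] stV x ED that by blast
      \<comment> \<open>Nilpotency of \<open>x\<close> on V/U makes ad x nilpotent only modulo
        \<open>N\<close>, which is why \<open>E\<close> was chosen to contain \<open>N\<close>. In
        each term of the expansion one of the two outer powers of \<open>x\<close> is at least
        n.\<close>
      have "(bracket x ^^ (2 * n)) y \<in> N" if y: "y \<in> D" for y
      proof -
        have "bracket ((bracket x ^^ (2 * n)) y) v \<in> U" if v: "v \<in> V" for v
        proof -
          have "bracket ((bracket x ^^ (2 * n)) y) v
              \<in> span {(bracket x ^^ i) (bracket y ((bracket x ^^ j) v)) | i j. i + j = 2 * n}"
            by (rule commutator_iterate[where act = bracket])
              (simp_all add: bracket_linear_right bracket_bracket_left)
          also have "\<dots> \<subseteq> U"
          proof (intro span_minimal subsetI U)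
            fix w assume "w \<in> {(bracket x ^^ i) (bracket y ((bracket x ^^ j) v)) | i j. i + j = 2 * n}"
            then obtain i j where ij: "i + j = 2 * n" "w = (bracket x ^^ i) (bracket y ((bracket x ^^ j) v))"
              by blast
            show "w \<in> U"
            proof (cases "n \<le> j")
              case True
              have "(bracket x ^^ j) v = (bracket x ^^ n) ((bracket x ^^ (j - n)) v)"
                using True by (metis comp_apply funpow_add le_add_diff_inverse)
              then have "(bracket x ^^ j) v \<in> U"
                using n powV[OF v] by simp
              then show ?thesis
                unfolding ij(2) using powU stU y by blast
            next
              case False
              then have "n \<le> i" using ij(1) by simp
              have "w = (bracket x ^^ n) ((bracket x ^^ (i - n)) (bracket y ((bracket x ^^ j) v)))"
                unfolding ij(2) using \<open>n \<le> i\<close> by (metis comp_apply funpow_add le_add_diff_inverse)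
              then show ?thesis
                using n powV stV y v by simp
            qed
          qed
          finally show ?thesis .
        qed
        moreover have "(bracket x ^^ (2 * n)) y \<in> D"
          using funpow_mem[of D "bracket x"] stableD[OF subalgebraD(2)[OF D]] x ED y by blast
        ultimately show ?thesis
          by (simp add: N_def)
      qed
      then show ?thesis
        using NE by blast
    qed
    then obtain y where y: "y \<in> D - E" "\<forall>x\<in>E. bracket x y \<in> E"
      using less.hyps[OF dim Ealg subalgebraD(1)[OF Ealg] subalgebraD(1)[OF D] ED]
        E subalgebraD(2)[OF Ealg] stable_mono[OF subalgebraD(2)[OF D] ED] by blast
    have spE: "span E = E"
      using subalgebraD(1)[OF Ealg] by (simp add: span_eq_iff)
    have inD: "z \<in> span (insert y E) \<longleftrightarrow> (\<exists>c. z - scale c y \<in> E)" for z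
      by (simp add: span_breakdown_eq spE)
    have closed: "bracket z z' \<in> span (insert y E)"
      if zz: "z \<in> span (insert y E)" "z' \<in> span (insert y E)" for z z'
    proof -
      obtain c c' where c: "z - scale c y \<in> E" "z' - scale c' y \<in> E"
        using zz inD by blast
      have *: "bracket y x \<in> E" if "x \<in> E" for x
        using y(2) that bracket_antisym[of y x] subspace_neg[OF subalgebraD(1)[OF Ealg]] by simp
      have "bracket z z' = bracket (z - scale c y) (z' - scale c' y)
          + scale c' (bracket (z - scale c y) y) + scale c (bracket y (z' - scale c' y))"
        by (simp add: bracket_diff_left bracket_diff_right bracket_scale_left bracket_scale_right
            bracket_self algebra_simps)
      also have "\<dots> \<in> E"
        using c y(2) * stableD[OF subalgebraD(2)[OF Ealg]] subalgebraD(1)[OF Ealg]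
        by (intro subspace_add subspace_scale) auto
      finally show ?thesis
        by (intro span_base) simp
    qed
    have "\<not> ?P (span (insert y E))"
    proof
      assume "?P (span (insert y E))"
      then have "span (insert y E) = E"
        using max[of "span (insert y E)"] span_superset[of "insert y E"] by blast
      then show False
        using y(1) span_base[of y "insert y E"] by auto
    qed
    moreover have "subalgebra (span (insert y E))" "N \<subseteq> span (insert y E)"
      using closed NE span_superset[of "insert y E"] by (auto simp: subalgebra_def)
    moreover have "span (insert y E) \<subseteq> D"
      using y(1) ED by (intro span_minimal subalgebraD(1)[OF D]) auto
    ultimately have Dspan: "D = span (insert y E)"
      by blast
    have "\<exists>v\<in>V - U. \<forall>x\<in>E. bracket x v \<in> U"
      using less.hyps[OF dim Ealg U V less.prems(4,5)] ED nil
        stable_mono[OF less.prems(6) ED] stable_mono[OF less.prems(7) ED] by blast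
    then obtain v where v: "v \<in> V" "v \<notin> U" "\<forall>x\<in>E. bracket x v \<in> U"
      by blast
    \<comment> \<open>Because [x, y] is in \<open>E\<close> for x in \<open>E\<close>, the vectors
      killed by \<open>E\<close> modulo U are carried to such vectors by y.\<close>
    have Ev: "bracket x ((bracket y ^^ i) v) \<in> U" if "x \<in> E" for x i
      using that
    proof (induction i arbitrary: x)
      case 0
      then show ?case using v by simp
    next
      case (Suc i)
      then show ?case
        using y stU by (simp add: bracket_bracket_right[of x y] subspace_add[OF U])
    qed
    have yV: "(bracket y ^^ i) v \<in> V" for i
      using funpow_mem[of V "bracket y"] stV y(1) v(1) by blast
    obtain n where "(bracket y ^^ n) v \<in> U"
      using nil y(1) v(1) by blast
    moreover have "(bracket y ^^ i) v \<notin> U"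
      if "\<And>m. (bracket y ^^ m) v \<notin> U \<Longrightarrow> (bracket y ^^ Suc m) v \<notin> U" for i
      by (induction i) (use v(2) that in simp_all)
    ultimately obtain m where m: "(bracket y ^^ m) v \<notin> U" "(bracket y ^^ Suc m) v \<in> U"
      by blast
    let ?w = "(bracket y ^^ m) v"
    have "bracket x ?w \<in> U" if xD: "x \<in> D" for x
    proof -
      obtain c where c: "x - scale c y \<in> E"
        using xD[unfolded Dspan inD] by blast
      have "bracket x ?w = bracket (x - scale c y) ?w + scale c (bracket y ?w)"
        by (simp add: bracket_diff_left bracket_scale_left)
      also have "\<dots> \<in> U"
        using subspace_add[OF U Ev[OF c] subspace_scale[OF U]] m(2) by simp
      finally show ?thesis .
    qed
    then show ?thesis
      by (intro bexI[of _ ?w]) (simp_all add: m(1) yV)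
  qed
qed

section \<open>Brackets of subspaces, derived and lower central series\<close>

lemma subspace_bracket_space: "subspace (bracket_space P Y)"
  by (simp add: bracket_space_def)

lemma bracket_space_base: "x \<in> P \<Longrightarrow> y \<in> Y \<Longrightarrow> bracket x y \<in> bracket_space P Y"
  unfolding bracket_space_def by (rule span_base) blast

lemma bracket_space_minimal:
  "subspace S \<Longrightarrow> (\<And>x y. x \<in> P \<Longrightarrow> y \<in> Y \<Longrightarrow> bracket x y \<in> S) \<Longrightarrow> bracket_space P Y \<subseteq> S"
  unfolding bracket_space_def by (rule span_minimal) auto

lemma bracket_space_mono: "P \<subseteq> Q \<Longrightarrow> Y \<subseteq> Z \<Longrightarrow> bracket_space P Y \<subseteq> bracket_space Q Z"
  unfolding bracket_space_def by (rule span_mono) auto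

lemma ideal_bracket_space:
  assumes P: "stable A P" and Y: "ideal_of A Y" and PA: "P \<subseteq> A"
  shows "ideal_of A (bracket_space P Y)"
  unfolding ideal_of_def
proof (intro conjI ballI subspace_bracket_space)
  show "bracket_space P Y \<subseteq> A"
    using bracket_space_minimal[OF ideal_ofD(1)[OF Y], of P Y] ideal_ofD[OF Y] PA
    by (meson stableD subset_iff)
  fix a s assume a: "a \<in> A" and s: "s \<in> bracket_space P Y"
  show "bracket a s \<in> bracket_space P Y"
  proof (rule span_image_subset[OF bracket_linear_right _ subspace_bracket_space])
    show "s \<in> span {bracket x y |x y. x \<in> P \<and> y \<in> Y}"
      using s by (simp add: bracket_space_def)
    fix z assume "z \<in> {bracket x y |x y. x \<in> P \<and> y \<in> Y}"
    then obtain x y where "x \<in> P" "y \<in> Y" "z = bracket x y" by blast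
    then show "bracket a z \<in> bracket_space P Y"
      using stableD[OF P a] stableD[OF ideal_ofD(3)[OF Y] a]
      by (auto simp: bracket_bracket_right[of a x] intro!: subspace_add[OF subspace_bracket_space] bracket_space_base)
  qed
qed

lemma ideal_derived_series: "ideal_of A I \<Longrightarrow> ideal_of A (derived_series I n)"
  by (induction n) (auto intro!: ideal_bracket_space dest: ideal_ofD)

lemma derived_series_mono: "I \<subseteq> J \<Longrightarrow> derived_series I n \<subseteq> derived_series J n"
  by (induction n) (auto intro: bracket_space_mono[THEN subsetD])

lemma derived_series_subset: "subalgebra I \<Longrightarrow> derived_series I n \<subseteq> I"
proof (induction n)
  case (Suc n)
  then show ?case
    using bracket_space_minimal[of I "derived_series I n" "derived_series I n"]
    by (auto simp: subalgebra_def)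
qed simp

lemma nilpotent_imp_solvable:
  assumes "nilpotent I" "subalgebra I"
  shows "solvable I"
proof -
  obtain n where n: "lower_central_series I n = {0}"
    using assms(1) by (auto simp: nilpotent_def)
  have "derived_series I n \<subseteq> lower_central_series I n" for n
    by (induction n) (auto intro: bracket_space_mono[THEN subsetD, OF derived_series_subset[OF assms(2)]])
  moreover have "subspace (derived_series I n)"
    using subalgebraD(1)[OF assms(2)] subspace_bracket_space by (cases n) auto
  ultimately have "derived_series I n = {0}"
    using n subspace_0 by blast
  then show ?thesis
    by (auto simp: solvable_def)
qed

end

section \<open>The commutator ideal of the solvable radical\<close>

context fd_lie_algebra
begin

lemma endo_bracket: "stable D (span A) \<Longrightarrow> stable D (span B) \<Longrightarrow> x \<in> D \<Longrightarrow> endo A B (bracket x)"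
  by (simp add: endo_def bracket_linear_right stable_def)

text \<open>On the quotient, tr([x, a] z) = tr(x (a z - z a)), and \<open>z\<close> commutes there
  with \<open>I\<close>.\<close>

lemma rtrace_bracket_commuting:
  assumes fr: "frame A B" and st: "stable UNIV (span A)" "stable UNIV (span B)"
    and s: "s \<in> bracket_space UNIV I" and z: "endo A B z"
    and comm: "\<And>a v. a \<in> I \<Longrightarrow> v \<in> span B \<Longrightarrow> bracket a (z v) - z (bracket a v) \<in> span A"
  shows "rtrace A B (\<lambda>v. bracket s (z v)) = 0"
proof -
  note e = endo_bracket[OF st UNIV_I]
  note ez = endo_compose[OF e z]
  have "rtrace A B (\<lambda>v. bracket s (z v)) = 0"
    if "s \<in> span {bracket x a |x a. x \<in> UNIV \<and> a \<in> I}" for s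
    using that
  proof (induction rule: span_induct_alt)
    case base
    show ?case
      by (rule rtrace_zero[OF fr]) (simp add: span_zero)
  next
    case (step c w y)
    then obtain x a where a: "a \<in> I" "w = bracket x a" by blast
    let ?az = "\<lambda>v. bracket a (z v)" and ?za = "\<lambda>v. z (bracket a v)"
    have "rtrace A B (\<lambda>v. bracket a (bracket x (z v))) = rtrace A B (\<lambda>v. bracket x (z (bracket a v)))"
      by (rule rtrace_comm[OF fr e ez])
    moreover have "rtrace A B (\<lambda>v. bracket w (z v))
        = rtrace A B (\<lambda>v. bracket x (bracket a (z v))) - rtrace A B (\<lambda>v. bracket a (bracket x (z v)))"
      unfolding a(2) bracket_bracket_left
      by (rule rtrace_diff[OF fr endo_compose[OF e ez] endo_compose[OF e ez]])
    moreover have "rtrace A B (\<lambda>v. bracket x (bracket a (z v))) - rtrace A B (\<lambda>v. bracket x (z (bracket a v)))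
        = rtrace A B (\<lambda>v. bracket x (bracket a (z v)) - bracket x (z (bracket a v)))"
      by (rule rtrace_diff[OF fr endo_compose[OF e ez] endo_compose[OF e endo_compose[OF z e]], symmetric])
    moreover have "\<dots> = 0"
      using comm[OF a(1)] stableD[OF st(1) UNIV_I]
      by (intro rtrace_zero[OF fr]) (simp flip: bracket_diff_right)
    ultimately have w: "rtrace A B (\<lambda>v. bracket w (z v)) = 0"
      by simp
    have "rtrace A B (\<lambda>v. bracket (scale c w + y) (z v))
        = rtrace A B (\<lambda>v. scale c (bracket w (z v)) + bracket y (z v))"
      by (simp add: bracket_add_left bracket_scale_left)
    also have "\<dots> = c * rtrace A B (\<lambda>v. bracket w (z v)) + rtrace A B (\<lambda>v. bracket y (z v))"
      by (simp add: rtrace_add[OF fr endo_scale[OF ez] ez] rtrace_scale[OF fr ez])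
    finally show ?case
      using w step.IH by simp
  qed
  then show ?thesis
    using s by (simp add: bracket_space_def)
qed

text \<open>On V/U the element \<open>s\<close> commutes with \<open>I\<close>, hence so do its
  powers. As \<open>s\<close> is in [L, I], the traces of s^k = s s^(k-1) vanish for k \<ge> 1 by
  \<open>rtrace_bracket_commuting\<close>, and in characteristic 0 this forces nilpotency.\<close>

lemma nilpotent_of_central_commutator:
  assumes U: "ideal_of UNIV U" and V: "ideal_of UNIV V" and UV: "U \<subseteq> V"
    and s: "s \<in> bracket_space UNIV I"
    and central: "\<And>a v. a \<in> I \<Longrightarrow> v \<in> V \<Longrightarrow> bracket (bracket a s) v \<in> U"
  shows "\<exists>n. \<forall>v\<in>V. (bracket s ^^ n) v \<in> U"
proof -
  obtain A B where fr: "frame A B" and AB: "span A = U" "span B = V"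
    using subspace_frame[OF ideal_ofD(1)[OF U] ideal_ofD(1)[OF V] UV] by metis
  have stU: "stable UNIV (span A)" and stV: "stable UNIV (span B)"
    using ideal_ofD(3)[OF U] ideal_ofD(3)[OF V] AB by auto
  note e = endo_bracket[OF stU stV UNIV_I]
  have comm: "bracket a ((bracket s ^^ k) v) - (bracket s ^^ k) (bracket a v) \<in> span A"
    if "a \<in> I" "v \<in> span B" for a v k
  proof (induction k)
    case (Suc k)
    let ?w = "(bracket s ^^ k) v"
    have "?w \<in> V"
      using funpow_mem[of V "bracket s"] stableD[OF stV UNIV_I] that(2) AB by blast
    then have "bracket (bracket a s) ?w \<in> span A"
      using central[OF that(1)] AB by simp
    moreover have "bracket s (bracket a ?w - (bracket s ^^ k) (bracket a v)) \<in> span A"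
      using stableD[OF stU UNIV_I Suc.IH] .
    moreover have "bracket a ((bracket s ^^ Suc k) v) - (bracket s ^^ Suc k) (bracket a v)
      = bracket (bracket a s) ?w + bracket s (bracket a ?w - (bracket s ^^ k) (bracket a v))"
      by (simp add: bracket_bracket_left bracket_diff_right)
    ultimately show ?case
      by (simp only: span_add)
  qed (simp add: span_zero)
  have "rtrace A B (bracket s ^^ k) = 0" if k: "k \<ge> 1" for k
  proof -
    obtain m where "k = Suc m" using k by (cases k) auto
    then show ?thesis
      using rtrace_bracket_commuting[OF fr stU stV s endo_funpow[OF e[of s], of m]] comm
      by (simp add: comp_def)
  qed
  then show ?thesis
    using nilpotent_if_rtrace_funpow_zero[OF fr e] AB by simp
qed

definition chief :: "'l set \<Rightarrow> 'l set \<Rightarrow> bool" where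
  "chief U V \<longleftrightarrow> ideal_of UNIV U \<and> ideal_of UNIV V \<and> U \<subseteq> V \<and> U \<noteq> V \<and>
     (\<forall>W. ideal_of UNIV W \<and> U \<subseteq> W \<and> W \<subseteq> V \<longrightarrow> W = U \<or> W = V)"

text \<open>The vectors of \<open>V\<close> that \<open>A\<close> sends into \<open>U\<close> form
  an ideal, because \<open>A\<close> is one. By Engel's theorem it is larger than \<open>U\<close>,
  so it is \<open>V\<close>.\<close>

lemma chief_nilpotent_trivial:
  assumes chief: "chief U V" and A: "ideal_of UNIV A"
    and nil: "\<And>a. a \<in> A \<Longrightarrow> \<exists>n. \<forall>v\<in>V. (bracket a ^^ n) v \<in> U"
    and a: "a \<in> A" and v: "v \<in> V"
  shows "bracket a v \<in> U"
proof -
  have U: "ideal_of UNIV U" and V: "ideal_of UNIV V" and UV: "U \<subseteq> V" "U \<noteq> V"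
    using chief by (auto simp: chief_def)
  note stU = stableD[OF ideal_ofD(3)[OF U] UNIV_I] and stV = stableD[OF ideal_ofD(3)[OF V] UNIV_I]
  let ?Z = "{v \<in> V. \<forall>x\<in>A. bracket x v \<in> U}"
  have "bracket x w \<in> ?Z" if "w \<in> ?Z" for x w
    using that stU stV ideal_of_right[OF A] 
    by (auto simp: bracket_bracket_right[of _ x] intro!: subspace_add[OF ideal_ofD(1)[OF U]])
  then have "ideal_of UNIV ?Z"
    using subspace_bracket_into[OF ideal_ofD(1)[OF V] ideal_ofD(1)[OF U]] by (simp add: ideal_of_def)
  moreover have "U \<subseteq> ?Z"
    using UV stU by auto
  moreover have "?Z \<noteq> U"
    using engel[OF ideal_subalgebra[OF A] ideal_ofD(1)[OF U] ideal_ofD(1)[OF V] UV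
        stable_mono[OF ideal_ofD(3)[OF U]] stable_mono[OF ideal_ofD(3)[OF V]] nil] by blast
  ultimately have "?Z = V"
    using chief unfolding chief_def by blast
  then show ?thesis
    using a v by blast
qed

text \<open>Ascent through the derived series of [L, R], which reaches 0. Suppose [A, A] acts
  trivially on V/U. An element of [L, A] commutes there with A, so it is nilpotent by traces, and
  [L, A] acts trivially. Now s in A commutes there with R, as [R, s] \<subseteq> [L, A]; and s is in
  [L, R], so it is nilpotent too and A acts trivially. Starting from [L, R] rather than R is what
  provides s \<in> [L, R].\<close>

lemma chief_bracket_solvable:
  assumes chief: "chief U V" and R: "ideal_of UNIV R" "solvable R"
    and s: "s \<in> bracket_space UNIV R" and v: "v \<in> V"
  shows "bracket s v \<in> U"
proof -
  have U: "ideal_of UNIV U" and V: "ideal_of UNIV V" and UV: "U \<subseteq> V"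
    using chief by (auto simp: chief_def)
  have UNIV: "stable UNIV UNIV"
    by (simp add: stable_def)
  let ?I = "bracket_space UNIV R"
  have I: "ideal_of UNIV ?I"
    by (rule ideal_bracket_space[OF UNIV R(1)]) simp
  have "?I \<subseteq> R"
    using bracket_space_minimal[OF ideal_ofD(1)[OF R(1)], of UNIV R] ideal_ofD(3)[OF R(1)]
    by (simp add: stable_def)
  let ?P = "\<lambda>n. \<forall>a\<in>derived_series ?I n. \<forall>v\<in>V. bracket a v \<in> U"
  obtain n where n: "?P n"
  proof -
    obtain n where "derived_series R n = {0}"
      using R(2) by (auto simp: solvable_def)
    then have "derived_series ?I n \<subseteq> {0}"
      using derived_series_mono[OF \<open>?I \<subseteq> R\<close>, of n] by simp
    then show ?thesis
      using subspace_0[OF ideal_ofD(1)[OF U]] by (intro that[of n]) auto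
  qed
  have step: "?P n" if Pn: "?P (Suc n)" for n
  proof -
    let ?A = "derived_series ?I n"
    have A: "ideal_of UNIV ?A"
      by (rule ideal_derived_series[OF I])
    let ?J = "bracket_space UNIV ?A"
    have J: "ideal_of UNIV ?J"
      by (rule ideal_bracket_space[OF UNIV A]) simp
    have JA: "?J \<subseteq> ?A"
      using bracket_space_minimal[OF ideal_ofD(1)[OF A], of UNIV ?A] ideal_ofD(3)[OF A]
      by (simp add: stable_def)
    have "\<exists>n. \<forall>v\<in>V. (bracket s ^^ n) v \<in> U" if s: "s \<in> ?J" for s
    proof (rule nilpotent_of_central_commutator[OF U V UV s])
      fix a v assume a: "a \<in> ?A" and v: "v \<in> V"
      then show "bracket (bracket a s) v \<in> U"
        using Pn JA s bracket_space_base[of a ?A s ?A] by auto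
    qed
    then have JU: "bracket s v \<in> U" if "s \<in> ?J" "v \<in> V" for s v
      using chief_nilpotent_trivial[OF chief J] that by blast
    have AI: "?A \<subseteq> ?I"
      by (rule derived_series_subset[OF ideal_subalgebra[OF I]])
    have "\<exists>n. \<forall>v\<in>V. (bracket s ^^ n) v \<in> U" if s: "s \<in> ?A" for s
    proof (rule nilpotent_of_central_commutator[OF U V UV])
      show "s \<in> ?I"
        using AI s by blast
      show "bracket (bracket a s) v \<in> U" if "v \<in> V" for a v
        by (rule JU[OF bracket_space_base[OF UNIV_I s] that])
    qed
    then show ?thesis
      using chief_nilpotent_trivial[OF chief A] by blast
  qed
  have "?P 0"
    using n
  proof (induction n)
    case (Suc n)
    then show ?case using step by blast
  qed
  then show ?thesis
    using s v by simp
qed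

text \<open>[L, R] lowers every ideal \<open>V\<close> to a maximal ideal \<open>U\<close> properly
  inside it, because V/U is a chief factor. Induction on the dimension shows that repeated action
  kills \<open>V\<close>; for V = [L, R] this is the lower central series.\<close>

lemma bracket_space_solvable_nilpotent:
  assumes R: "ideal_of UNIV R" "solvable R"
  shows "nilpotent (bracket_space UNIV R)"
proof -
  let ?I = "bracket_space UNIV R"
  let ?C = "\<lambda>k V. (bracket_space ?I ^^ k) V"
  have I: "ideal_of UNIV ?I"
    by (rule ideal_bracket_space[OF _ R(1)]) (simp_all add: stable_def)
  have mono: "?C k V \<subseteq> ?C k W" if "V \<subseteq> W" for k V W
    using that by (induction k) (auto intro: bracket_space_mono[THEN subsetD, OF order_refl])
  have "\<exists>k. ?C k V \<subseteq> {0}" if "ideal_of UNIV V" for V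
    using that
  proof (induction "dim V" arbitrary: V rule: less_induct)
    case less
    show ?case
    proof (cases "V = {0}")
      case True
      then show ?thesis by (intro exI[of _ 0]) simp
    next
      case False
      let ?P = "\<lambda>U. ideal_of UNIV U \<and> U \<subseteq> V \<and> U \<noteq> V"
      have "?P {0}"
        using False subspace_0[OF ideal_ofD(1)[OF less.prems]]
        by (auto simp: ideal_of_def)
      then obtain U where U: "?P U" and max: "\<And>W. ?P W \<Longrightarrow> U \<subseteq> W \<Longrightarrow> W = U"
        using maximal_subspace[of ?P "{0}"] ideal_ofD(1) by metis
      have chief: "chief U V"
        unfolding chief_def using U less.prems max by blast
      obtain k where k: "?C k U \<subseteq> {0}"
        using less.hyps[of U] U dim_less[of U V] ideal_ofD(1)[OF less.prems] ideal_ofD(1)[of UNIV U] by blast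
      have "bracket_space ?I V \<subseteq> U"
        using U chief_bracket_solvable[OF chief R] by (intro bracket_space_minimal ideal_ofD(1)) auto
      then have "?C (Suc k) V \<subseteq> {0}"
        using mono[of "bracket_space ?I V" U k] k by (simp add: funpow_swap1)
      then show ?thesis by blast
    qed
  qed
  from this[OF I] obtain k where k: "?C k ?I \<subseteq> {0}" by blast
  have "lower_central_series ?I n = ?C n ?I" for n
    by (induction n) auto
  moreover have "subspace (lower_central_series ?I n)" for n
    by (cases n) (simp_all add: subspace_bracket_space)
  ultimately have "lower_central_series ?I k = {0}"
    using k subspace_0 by blast
  then show ?thesis
    by (auto simp: nilpotent_def)
qed

lemma bracket_mem_nilpotent_radical:
  assumes R: "ideal_of UNIV R" "solvable R" and N: "is_nilpotent_radical UNIV N" and r: "r \<in> R"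
  shows "bracket x r \<in> N"
proof -
  have "ideal_of UNIV (bracket_space UNIV R)"
    by (rule ideal_bracket_space[OF _ R(1)]) (simp_all add: stable_def)
  then have "bracket_space UNIV R \<subseteq> N"
    using N bracket_space_solvable_nilpotent[OF R] by (simp add: is_nilpotent_radical_def)
  then show ?thesis
    using bracket_space_base[of x UNIV r R] r by blast
qed

end

section \<open>Cartan's criterion\<close>

context fd_lie_algebra
begin

text \<open>If y satisfies [y, K] \<subseteq> K for the scalar extension \<open>K\<close> of the
  operators from \<open>D\<close>, then tr([a, b] y) = tr(a [b, y]) = 0, since the trace form
  vanishes on \<open>D\<close> and hence on \<open>D\<close> against \<open>K\<close>. As x is in
  [D, D], tr(x y) = 0 for all such y, which is what
  \<open>nilpotent_if_rtrace_commutant_zero\<close> asks for.\<close>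

lemma cartan_nilpotent:
  assumes D: "subspace D" "D \<subseteq> bracket_space D D" "stable D D" and fr: "frame {} B" and st: "stable D (span B)"
    and tr: "\<And>a b. a \<in> D \<Longrightarrow> b \<in> D \<Longrightarrow> rtrace {} B (\<lambda>v. bracket a (bracket b v)) = 0"
    and x: "x \<in> D"
  shows "\<exists>n. \<forall>v\<in>span B. (bracket x ^^ n) v = 0"
proof -
  let ?r = "\<lambda>v b. representation B v b"
  note indep = frameD(3)[OF fr] and fin = frameD(2)[OF fr]
  \<comment> \<open>The extension of \<open>span B\<close> to the algebraic closure consists of the
    coordinate functions vanishing off \<open>B\<close>, with standard basis vectors
    \<open>e b\<close>.\<close>
  define sc :: "'f alg_closure \<Rightarrow> ('l \<Rightarrow> 'f alg_closure) \<Rightarrow> 'l \<Rightarrow> 'f alg_closure"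
    where "sc c p = (\<lambda>b. c * p b)" for c p
  interpret G: linear_space_alg_closed sc
    by unfold_locales (auto simp: sc_def algebra_simps fun_eq_iff)
  define e :: "'l \<Rightarrow> 'l \<Rightarrow> 'f alg_closure" where "e b = (\<lambda>c. if c = b then 1 else 0)" for b
  have e_apply: "e b c = (if c = b then 1 else 0)" for b c
    by (simp add: e_def)
  have inj_e: "inj_on e B"
    by (auto simp: inj_on_def e_def fun_eq_iff split: if_splits)
  have expand: "p = (\<Sum>b\<in>B. sc (p b) (e b))" if "\<And>c. c \<notin> B \<Longrightarrow> p c = 0" for p
    using that fin by (auto simp: fun_eq_iff sum_fun_apply sc_def e_def if_distrib cong: if_cong)
  have span_e: "p \<in> G.span (e ` B) \<longleftrightarrow> (\<forall>c. c \<notin> B \<longrightarrow> p c = 0)" for p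
  proof
    assume "p \<in> G.span (e ` B)"
    then show "\<forall>c. c \<notin> B \<longrightarrow> p c = 0"
      by (induction rule: G.span_induct_alt) (auto simp: sc_def e_def split: if_splits)
  next
    assume p: "\<forall>c. c \<notin> B \<longrightarrow> p c = 0"
    have "(\<Sum>b\<in>B. sc (p b) (e b)) \<in> G.span (e ` B)"
      by (intro G.span_sum G.span_scale G.span_base) blast
    then show "p \<in> G.span (e ` B)"
      using expand[of p] p by simp
  qed
  have indep_e: "G.independent (e ` B)"
  proof (rule G.independent_if_scalars_zero)
    show "finite (e ` B)" using fin by simp
    fix u w assume u: "(\<Sum>w\<in>e ` B. sc (u w) w) = 0" and w: "w \<in> e ` B"
    then obtain b where b: "b \<in> B" "w = e b" by blast
    have "0 = (\<Sum>w\<in>e ` B. sc (u w) w) b"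
      using u by simp
    also have "\<dots> = u (e b)"
      using b(1) fin by (simp add: sum.reindex[OF inj_e] sum_fun_apply sc_def e_apply if_distrib cong: if_cong)
    finally show "u w = 0" using b by simp
  qed
  have frG: "G.frame {} (e ` B)"
    using indep_e fin by (simp add: G.frame_empty)
  have rep_e: "G.representation (e ` B) p (e b) = p b" if p: "p \<in> G.span (e ` B)" and b: "b \<in> B" for p b
  proof -
    have "p = (\<Sum>w\<in>e ` B. sc (G.representation (e ` B) p w) w)"
      using G.sum_representation_eq[OF indep_e p] fin by simp
    then have "p b = (\<Sum>w\<in>e ` B. sc (G.representation (e ` B) p w) w) b"
      by simp
    also have "\<dots> = G.representation (e ` B) p (e b)"
      using b fin by (simp add: sum.reindex[OF inj_e] sum_fun_apply sc_def e_apply if_distrib cong: if_cong)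
    finally show ?thesis by simp
  qed

  \<comment> \<open>The matrix of \<open>f\<close> in the basis \<open>B\<close>, acting on
    coordinates. It respects composition and differences when the operators involved preserve
    \<open>span B\<close>.\<close>
  define ext :: "('l \<Rightarrow> 'l) \<Rightarrow> ('l \<Rightarrow> 'f alg_closure) \<Rightarrow> 'l \<Rightarrow> 'f alg_closure"
    where "ext f p = (\<lambda>c. if c \<in> B then \<Sum>b\<in>B. to_ac (?r (f b) c) * p b else 0)" for f p
  have ext_endo: "G.endo {} (e ` B) (ext f)" for f
    unfolding G.endo_def
  proof (intro conjI ballI)
    show "G.lin (ext f)"
      by (rule G.linI) (auto simp: ext_def sc_def fun_eq_iff algebra_simps sum.distrib sum_distrib_left)
    then show "ext f p \<in> G.span {}" if "p \<in> G.span {}" for p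
      using that by (simp add: linear_zeroD)
  qed (simp add: span_e ext_def)
  have ext_lin: "G.lin (ext f)" for f
    using ext_endo by (simp add: G.endo_def)
  have ext_compose: "ext f (ext g p) = ext (\<lambda>v. f (g v)) p"
    if f: "lin f" "\<And>v. v \<in> span B \<Longrightarrow> f v \<in> span B" and g: "\<And>v. v \<in> span B \<Longrightarrow> g v \<in> span B" for f g p
  proof (rule ext, cases)
    fix c assume c: "c \<in> B"
    have rep: "?r (f (g b)) c = (\<Sum>d\<in>B. ?r (g b) d * ?r (f d) c)" if b: "b \<in> B" for b
    proof -
      have "f (g b) = (\<Sum>d\<in>B. scale (?r (g b) d) (f d))"
        using sum_representation_eq[OF indep g[OF span_base[OF b]] fin order_refl]
        by (simp flip: linear_scaleD[OF f(1)] linear_sumD[OF f(1)])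
      then show ?thesis
        by (simp add: representation_sum representation_scale span_scale indep f(2) span_base)
    qed
    have "ext f (ext g p) c = (\<Sum>d\<in>B. \<Sum>b\<in>B. to_ac (?r (f d) c) * (to_ac (?r (g b) d) * p b))"
      using c by (simp add: ext_def sum_distrib_left)
    also have "\<dots> = (\<Sum>b\<in>B. \<Sum>d\<in>B. to_ac (?r (f d) c) * (to_ac (?r (g b) d) * p b))"
      by (rule sum.swap)
    also have "\<dots> = ext (\<lambda>v. f (g v)) p c"
      using c by (simp add: ext_def rep to_ac_sum sum_distrib_left sum_distrib_right mult_ac)
    finally show "ext f (ext g p) c = ext (\<lambda>v. f (g v)) p c" .
  qed (simp add: ext_def)
  have ext_diff: "ext (\<lambda>v. f v - g v) p = (\<lambda>c. ext f p c - ext g p c)"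
    if "\<And>v. v \<in> span B \<Longrightarrow> f v \<in> span B" "\<And>v. v \<in> span B \<Longrightarrow> g v \<in> span B" for f g p
    using that by (auto simp: ext_def fun_eq_iff representation_diff indep span_base
        left_diff_distrib sum_subtractf)
  have bl: "bracket a v \<in> span B" if "a \<in> D" "v \<in> span B" for a v
    using st that by (rule stableD)
  let ?a = "\<lambda>a. ext (bracket a)"
  have ext_bracket: "?a (bracket a b) p = ?a a (?a b p) - ?a b (?a a p)" if "a \<in> D" "b \<in> D" for a b p
  proof -
    have "bracket (bracket a b) = (\<lambda>v. bracket a (bracket b v) - bracket b (bracket a v))"
      by (simp add: fun_eq_iff bracket_bracket_left)
    then have "?a (bracket a b) p = ext (\<lambda>v. bracket a (bracket b v) - bracket b (bracket a v)) p"
      by simp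
    then show ?thesis
      using bl that by (subst (asm) ext_diff) (auto simp: ext_compose bracket_linear_right fun_diff_def)
  qed
  have ext_comb: "?a (scale c a + b) p = sc (to_ac c) (?a a p) + ?a b p" if "a \<in> D" "b \<in> D" for a b c p
    using bl that by (auto simp: ext_def fun_eq_iff sc_def bracket_add_left bracket_scale_left indep
        representation_add representation_scale span_scale span_base algebra_simps sum.distrib sum_distrib_left)
  have ext0 [simp]: "ext f (\<lambda>_. 0) = 0" "ext f 0 = 0" for f
    by (auto simp: ext_def fun_eq_iff)
  have ext_zero: "?a 0 p = 0" for p
    by (auto simp: ext_def fun_eq_iff representation_zero)

  have ext_e: "ext f (e b) c = (if c \<in> B then to_ac (?r (f b) c) else 0)" if "b \<in> B" for f b c
    using that fin by (simp add: ext_def e_apply if_distrib[of "(*) _"] cong: if_cong)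

  let ?tr = "G.rtrace {} (e ` B)"
  have tr_ext: "?tr (\<lambda>p. ext f p) = to_ac (rtrace {} B f)" for f
  proof -
    have "?tr (\<lambda>p. ext f p) = (\<Sum>b\<in>B. ext f (e b) b)"
      unfolding G.rtrace_def using ext_endo[of f]
      by (simp add: sum.reindex[OF inj_e] rep_e G.endo_def G.span_base)
    also have "\<dots> = (\<Sum>b\<in>B. to_ac (?r (f b) b))"
      by (intro sum.cong refl) (simp add: ext_e)
    finally show ?thesis
      by (simp add: rtrace_def to_ac_sum)
  qed

  define opsc where "opsc c f = (\<lambda>p. sc c (f p))"
    for c and f :: "('l \<Rightarrow> 'f alg_closure) \<Rightarrow> 'l \<Rightarrow> 'f alg_closure"
  interpret Op: linear_space opsc
    by unfold_locales (auto simp: opsc_def sc_def fun_eq_iff algebra_simps)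
  define K where "K = Op.span (?a ` D)"
  have K_base: "?a a \<in> K" if "a \<in> D" for a
    unfolding K_def using that by (intro Op.span_base) blast
  have tr_K: "G.endo {} (e ` B) k \<and> ?tr (\<lambda>p. ?a a (k p)) = 0" if a: "a \<in> D" and k: "k \<in> K" for a k
    using k unfolding K_def
  proof (induction rule: Op.span_induct_alt)
    case base
    have "?tr (\<lambda>p. ?a a ((0 :: _ \<Rightarrow> _) p)) = 0"
      by (rule G.rtrace_zero[OF frG]) (simp add: fun_eq_iff)
    then show ?case
      using G.endo_zero[of "{}" "e ` B"] by (simp add: zero_fun_def)
  next
    case (step c f g)
    then obtain b where b: "b \<in> D" "f = ?a b" by blast
    have g: "G.endo {} (e ` B) g"
      using step.IH by blast
    have "?tr (\<lambda>p. ?a a (?a b p)) = to_ac (rtrace {} B (\<lambda>v. bracket a (bracket b v)))"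
      using bl a b by (simp add: ext_compose bracket_linear_right tr_ext)
    then have f: "?tr (\<lambda>p. ?a a (f p)) = 0"
      using tr[OF a b(1)] b(2) by simp
    have "?tr (\<lambda>p. ?a a ((opsc c f + g) p)) = ?tr (\<lambda>p. sc c (?a a (f p)) + ?a a (g p))"
      by (simp add: opsc_def linear_addD[OF ext_lin] linear_scaleD[OF ext_lin])
    also have "\<dots> = c * ?tr (\<lambda>p. ?a a (f p)) + ?tr (\<lambda>p. ?a a (g p))"
      using G.endo_compose[OF ext_endo g] G.endo_compose[OF ext_endo ext_endo] b(2)
      by (simp add: G.rtrace_add[OF frG] G.rtrace_scale[OF frG] G.endo_scale)
    finally have "?tr (\<lambda>p. ?a a ((opsc c f + g) p)) = 0"
      using f step.IH by simp
    moreover have "G.endo {} (e ` B) (opsc c f + g)"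
      using G.endo_add[OF G.endo_scale[of "{}" "e ` B" f c] g] ext_endo b(2)
      by (simp add: opsc_def plus_fun_def)
    ultimately show ?case by blast
  qed
  have "\<exists>n. \<forall>p\<in>G.span (e ` B). (?a x ^^ n) p = 0"
  proof (rule G.nilpotent_if_rtrace_commutant_zero[OF frG ext_endo, where K = K])
    show "(\<lambda>v. 0) \<in> K"
      using Op.span_zero[of "?a ` D"] by (simp add: K_def zero_fun_def)
    show "(\<lambda>v. f v + g v) \<in> K" if "f \<in> K" "g \<in> K" for f g
      using Op.span_add[of f "?a ` D" g] that by (simp add: K_def plus_fun_def)
    show "(\<lambda>v. sc c (f v)) \<in> K" if "f \<in> K" for c f
      using Op.span_scale[of f "?a ` D" c] that by (simp add: K_def opsc_def)
    show "G.endo {} (e ` B) k" if "k \<in> K" for k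
      using tr_K[OF x that] by blast
    show "\<exists>k'\<in>K. \<forall>v\<in>G.span (e ` B). ?a x (k v) - k (?a x v) = k' v" if k: "k \<in> K" for k
    proof -
      have "(\<lambda>v. ?a x (k v) - k (?a x v)) \<in> K"
        using k unfolding K_def
      proof (induction rule: Op.span_induct_alt)
        case base
        show ?case
          using Op.span_zero[of "?a ` D"] by (simp add: zero_fun_def)
      next
        case (step c f g)
        then obtain b where b: "b \<in> D" "f = ?a b" by blast
        have eq: "(\<lambda>v. ?a x ((opsc c f + g) v) - (opsc c f + g) (?a x v))
            = opsc c (?a (bracket x b)) + (\<lambda>v. ?a x (g v) - g (?a x v))"
          by (rule HOL.ext) (simp add: opsc_def b linear_addD[OF ext_lin] linear_scaleD[OF ext_lin]
              ext_bracket[OF x b(1)] G.scale_right_diff_distrib)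
        have "?a (bracket x b) \<in> Op.span (?a ` D)"
          using K_base[OF stableD[OF D(3) x b(1)]] by (simp add: K_def)
        from Op.span_add[OF Op.span_scale[OF this] step.IH] show ?case
          unfolding eq .
      qed
      then show ?thesis by (rule bexI[rotated]) simp
    qed
  next
    fix y assume y: "G.endo {} (e ` B) y"
      and Ky: "\<And>k. k \<in> K \<Longrightarrow> \<exists>k'\<in>K. \<forall>v\<in>G.span (e ` B). y (k v) - k (y v) = k' v"
    \<comment> \<open>Cyclicity of the trace turns tr([a, b] y) into - tr(a (y b - b y)), and y b -
      b y agrees with an element of \<open>K\<close>.\<close>
    have br: "?tr (\<lambda>p. ?a (bracket a b) (y p)) = 0" if a: "a \<in> D" and b: "b \<in> D" for a b
    proof -
      obtain k where k: "k \<in> K" "\<forall>v\<in>G.span (e ` B). y (?a b v) - ?a b (y v) = k v"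
        using Ky[OF K_base[OF b]] by blast
      have "?tr (\<lambda>p. ?a (bracket a b) (y p)) = ?tr (\<lambda>p. ?a a (?a b (y p)) - ?a b (?a a (y p)))"
        by (simp add: ext_bracket[OF a b])
      also have "\<dots> = ?tr (\<lambda>p. ?a a (?a b (y p))) - ?tr (\<lambda>p. ?a b (?a a (y p)))"
        by (rule G.rtrace_diff[OF frG G.endo_compose[OF ext_endo G.endo_compose[OF ext_endo y]]
              G.endo_compose[OF ext_endo G.endo_compose[OF ext_endo y]]])
      also have "?tr (\<lambda>p. ?a b (?a a (y p))) = ?tr (\<lambda>p. ?a a (y (?a b p)))"
        by (rule G.rtrace_comm[OF frG ext_endo G.endo_compose[OF ext_endo y]])
      also have "?tr (\<lambda>p. ?a a (?a b (y p))) - ?tr (\<lambda>p. ?a a (y (?a b p)))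
          = - ?tr (\<lambda>p. ?a a (y (?a b p)) - ?a a (?a b (y p)))"
        by (subst G.rtrace_diff[OF frG G.endo_compose[OF ext_endo G.endo_compose[OF y ext_endo]]
              G.endo_compose[OF ext_endo G.endo_compose[OF ext_endo y]]]) simp
      also have "?tr (\<lambda>p. ?a a (y (?a b p)) - ?a a (?a b (y p))) = ?tr (\<lambda>p. ?a a (k p))"
        using k(2) by (intro G.rtrace_cong) (simp flip: linear_diffD[OF ext_lin])
      finally show ?thesis
        using tr_K[OF a k(1)] by simp
    qed
    have trz: "z \<in> D \<and> ?tr (\<lambda>p. ?a z (y p)) = 0" if "z \<in> span {bracket a b |a b. a \<in> D \<and> b \<in> D}" for z
      using that
    proof (induction rule: span_induct_alt)
      case base
      have "?tr (\<lambda>p. ?a 0 (y p)) = 0"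
        by (rule G.rtrace_zero[OF frG]) (simp add: ext_zero)
      then show ?case
        using subspace_0[OF D(1)] by blast
    next
      case (step c w z)
      then obtain a b where ab: "a \<in> D" "b \<in> D" "w = bracket a b" by blast
      have wz: "w \<in> D" "z \<in> D"
        using stableD[OF D(3) ab(1,2)] ab(3) step.IH by blast+
      then have "?tr (\<lambda>p. ?a (scale c w + z) (y p)) = ?tr (\<lambda>p. sc (to_ac c) (?a w (y p)) + ?a z (y p))"
        by (simp add: ext_comb)
      also have "\<dots> = to_ac c * ?tr (\<lambda>p. ?a w (y p)) + ?tr (\<lambda>p. ?a z (y p))"
        using G.endo_compose[OF ext_endo y]
        by (simp add: G.rtrace_add[OF frG] G.rtrace_scale[OF frG] G.endo_scale)
      also have "\<dots> = 0"
        using step.IH br[OF ab(1,2)] ab(3) by simp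
      finally show ?case
        using subspace_add[OF D(1) subspace_scale[OF D(1) wz(1)] wz(2)] by blast
    qed
    have "x \<in> span {bracket a b |a b. a \<in> D \<and> b \<in> D}"
      using D(2) x by (auto simp: bracket_space_def)
    then show "?tr (\<lambda>p. ?a x (y p)) = 0"
      using trz by blast
  qed
  then obtain n where n: "\<And>p. p \<in> G.span (e ` B) \<Longrightarrow> (?a x ^^ n) p = 0"
    by blast
  have powB: "(bracket x ^^ k) v \<in> span B" if "v \<in> span B" for k v
    using funpow_mem[of "span B" "bracket x"] bl[OF x] that by blast
  have pow: "(?a x ^^ k) (e b) = ext (bracket x ^^ k) (e b)" if b: "b \<in> B" for k b
  proof (induction k)
    case 0
    show ?case
    proof (rule HOL.ext)
      fix c
      have "e b c = (if c \<in> B then to_ac (?r b c) else 0)"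
        using b by (auto simp: representation_basis[OF indep b] e_apply)
      then show "(?a x ^^ 0) (e b) c = ext (bracket x ^^ 0) (e b) c"
        by (simp only: funpow.simps id_apply ext_e[OF b])
    qed
  next
    case (Suc k)
    then show ?case
      using bl[OF x] powB by (simp add: ext_compose bracket_linear_right comp_def)
  qed
  have "(bracket x ^^ n) b = 0" if b: "b \<in> B" for b
  proof -
    have "ext (bracket x ^^ n) (e b) c = 0" for c
      using n[of "e b"] pow[OF b, of n] b by (simp add: G.span_base)
    then have "?r ((bracket x ^^ n) b) c = 0" if "c \<in> B" for c
      using that b ext_e[OF b, of "bracket x ^^ n" c] by simp
    then show ?thesis
      using sum_representation_eq[OF indep powB[OF span_base[OF b]] fin order_refl, of n] by simp
  qed
  then have "(bracket x ^^ n) v = 0" if "v \<in> span B" for v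
    by (rule lin_zero_on_span[OF lin_funpow[OF bracket_linear_right] _ that])
  then show ?thesis by blast
qed

text \<open>\<open>D\<close> acts by nilpotent operators. If its null vectors \<open>?Z\<close> were
  not everything, Engel's theorem modulo \<open>?Z\<close> would give w outside \<open>?Z\<close>
  with D w \<subseteq> \<open>?Z\<close>. Then [a, b] w = a (b w) - b (a w) = 0, so D \<subseteq>
  [D, D] kills w, a contradiction.\<close>

lemma perfect_trace_zero_trivial:
  assumes D: "subalgebra D" "D \<subseteq> bracket_space D D" and fr: "frame {} B" and st: "stable D (span B)"
    and tr: "\<And>a b. a \<in> D \<Longrightarrow> b \<in> D \<Longrightarrow> rtrace {} B (\<lambda>v. bracket a (bracket b v)) = 0"
    and x: "x \<in> D" and v: "v \<in> span B"
  shows "bracket x v = 0"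
proof -
  let ?Z = "{v \<in> span B. \<forall>x\<in>D. bracket x v \<in> {0}}"
  have Z: "subspace ?Z"
    by (rule subspace_bracket_into) simp_all
  have "?Z = span B"
  proof (rule ccontr)
    assume ne: "?Z \<noteq> span B"
    have "\<exists>n. \<forall>v\<in>span B. (bracket a ^^ n) v \<in> ?Z" if a: "a \<in> D" for a
    proof -
      obtain n where n: "\<forall>v\<in>span B. (bracket a ^^ n) v = 0"
        using cartan_nilpotent[OF subalgebraD(1)[OF D(1)] D(2) subalgebraD(2)[OF D(1)] fr st tr a] by blast
      show ?thesis
        using n by (intro exI[of _ n]) (simp add: span_zero)
    qed
    moreover have "stable D ?Z"
      using stableD[OF st] by (auto simp: stable_def span_zero)
    ultimately obtain w where w: "w \<in> span B - ?Z" "\<forall>x\<in>D. bracket x w \<in> ?Z"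
      using engel[OF D(1) Z subspace_span _ ne _ st] by blast
    have "bracket_space D D \<subseteq> {x \<in> UNIV. \<forall>v\<in>{w}. bracket x v \<in> {0}}"
    proof (rule bracket_space_minimal)
      show "subspace {x \<in> UNIV. \<forall>v\<in>{w}. bracket x v \<in> {0}}"
        by (rule subspace_bracket_into_left) simp_all
      show "bracket a b \<in> {x \<in> UNIV. \<forall>v\<in>{w}. bracket x v \<in> {0}}" if "a \<in> D" "b \<in> D" for a b
        using w(2) that by (simp add: bracket_bracket_left)
    qed
    then show False
      using w(1) D(2) by auto
  qed
  then show ?thesis
    using x v by blast
qed

end

section \<open>Semisimple subalgebras\<close>

context fd_lie_algebra
begin

lemma decseq_subspace_stationary:
  assumes "\<And>n. subspace (S n)" "\<And>n. S (Suc n) \<subseteq> S n"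
  shows "\<exists>n. S (Suc n) = S n"
proof -
  obtain n where n: "\<And>m. dim (S n) \<le> dim (S m)"
    using ex_has_least_nat[of "\<lambda>_. True" 0 "\<lambda>n. dim (S n)"] by blast
  show ?thesis
    using subspace_dim_equal[OF assms(1,1,2) n] by blast
qed

lemma ideal_subset_stable: "ideal_of B K \<Longrightarrow> stable B W \<Longrightarrow> stable K W"
  by (auto simp: stable_def dest: ideal_ofD(2))

lemma abelian_ideal_trivial:
  assumes B: "semisimple B" and K: "ideal_of B K" and "\<And>x y. x \<in> K \<Longrightarrow> y \<in> K \<Longrightarrow> bracket x y = 0"
  shows "K = {0}"
proof -
  have "derived_series K 1 = {0}"
    using bracket_space_minimal[of "{0}" K K] assms(3) subspace_0[OF subspace_bracket_space] by auto
  then have "solvable K"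
    unfolding solvable_def by blast
  then have "K \<subseteq> {0}"
    using B K by (simp add: semisimple_def is_solvable_radical_def)
  then show ?thesis
    using subspace_0[OF ideal_ofD(1)[OF K]] by blast
qed

text \<open>The derived series of \<open>K\<close> becomes stationary at a perfect ideal. This acts
  trivially by Cartan's criterion and is 0 by faithfulness; so \<open>K\<close> is a solvable ideal
  of a semisimple algebra.\<close>

lemma trace_zero_ideal_trivial:
  assumes B: "semisimple B" and K: "ideal_of B K" and fr: "frame {} C" and st: "stable B (span C)"
    and faithful: "\<And>x. x \<in> K \<Longrightarrow> (\<And>v. v \<in> span C \<Longrightarrow> bracket x v = 0) \<Longrightarrow> x = 0"
    and tr: "\<And>a b. a \<in> K \<Longrightarrow> b \<in> K \<Longrightarrow> rtrace {} C (\<lambda>v. bracket a (bracket b v)) = 0"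
  shows "K = {0}"
proof -
  let ?S = "derived_series K"
  have S: "ideal_of B (?S n)" "?S n \<subseteq> K" for n
    using ideal_derived_series[OF K] derived_series_subset[OF ideal_subalgebra[OF K]] by auto
  have "?S (Suc n) \<subseteq> ?S n" for n
    using derived_series_subset[OF ideal_subalgebra[OF S(1)], of n 1] by simp
  then obtain n where n: "?S (Suc n) = ?S n"
    using decseq_subspace_stationary[of ?S] ideal_ofD(1)[OF S(1)] by blast
  have "x = 0" if x: "x \<in> ?S n" for x
  proof (rule faithful)
    show "x \<in> K" using x S(2) by blast
    fix v assume v: "v \<in> span C"
    show "bracket x v = 0"
    proof (rule perfect_trace_zero_trivial[OF ideal_subalgebra[OF S(1)] _ fr ideal_subset_stable[OF S(1) st] _ x v])
      show "?S n \<subseteq> bracket_space (?S n) (?S n)"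
        using n by simp
      show "rtrace {} C (\<lambda>v. bracket a (bracket b v)) = 0" if "a \<in> ?S n" "b \<in> ?S n" for a b
        using tr that S(2) by blast
    qed
  qed
  then have "?S n = {0}"
    using subspace_0[OF ideal_ofD(1)[OF S(1)]] by blast
  then have "solvable K"
    unfolding solvable_def by blast
  then have "K \<subseteq> {0}"
    using B K by (simp add: semisimple_def is_solvable_radical_def)
  then show ?thesis
    using subspace_0[OF ideal_ofD(1)[OF K]] by blast
qed

text \<open>Coordinates with respect to a basis \<open>D\<close> of the whole algebra make the trace over
  the span of \<open>C \<subseteq> D\<close> bilinear in \<open>x\<close> and \<open>y\<close> without stability assumptions.\<close>

definition form :: "'l set \<Rightarrow> 'l set \<Rightarrow> 'l \<Rightarrow> 'l \<Rightarrow> 'f" where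
  "form C D x y = (\<Sum>b\<in>C. representation D (bracket x (bracket y b)) b)"

context
  fixes D :: "'l set"
  assumes D: "independent D" "span D = UNIV"
begin

lemma form_linear_left: "form C D (x + x') y = form C D x y + form C D x' y"
  "form C D (scale c x) y = c * form C D x y"
  using D by (simp_all add: form_def bracket_add_left bracket_scale_left representation_add
      representation_scale sum.distrib sum_distrib_left)

lemma form_linear_right: "form C D x (y + y') = form C D x y + form C D x y'"
  "form C D x (scale c y) = c * form C D x y"
  using D by (simp_all add: form_def bracket_add_left bracket_scale_left bracket_add_right
      bracket_scale_right representation_add representation_scale sum.distrib sum_distrib_left)

lemma linear_form: "Vector_Spaces.linear scale (*) (\<lambda>x. form C D x y)"
  "Vector_Spaces.linear scale (*) (form C D x)"
  by (simp_all add: Vector_Spaces.linear_iff vector_space_axioms form_linear_left form_linear_right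
      vector_space_def algebra_simps)

lemma form_eq_rtrace:
  assumes "C \<subseteq> D" "stable A (span C)" "x \<in> A" "y \<in> A"
  shows "form C D x y = rtrace {} C (\<lambda>v. bracket x (bracket y v))"
  unfolding form_def rtrace_def
proof (intro sum.cong)
  fix b assume "b \<in> C - {}"
  then have "bracket x (bracket y b) \<in> span C"
    using stableD[OF assms(2,3) stableD[OF assms(2,4) span_base]] by simp
  then show "representation D (bracket x (bracket y b)) b = representation C (bracket x (bracket y b)) b"
    using representation_extend[OF D(1)] assms(1) by simp
qed simp

lemma form_invariant:
  assumes C: "C \<subseteq> D" "finite C" and st: "stable A (span C)" "stable A A" and xyz: "x \<in> A" "y \<in> A" "z \<in> A"
  shows "form C D (bracket x y) z = form C D x (bracket y z)"
proof -
  have fr: "frame {} C"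
    using C(2) independent_mono[OF D(1) C(1)] by (simp add: frame_empty)
  have e: "endo {} C (bracket a)" if "a \<in> A" for a
    using that st(1) by (intro endo_bracket[of A]) (simp_all add: stable_def)
  note ex = e[OF xyz(1)] and ey = e[OF xyz(2)] and ez = e[OF xyz(3)]
  let ?t = "rtrace {} C"
  have "form C D (bracket x y) z = ?t (\<lambda>v. bracket (bracket x y) (bracket z v))"
    using form_eq_rtrace[OF C(1) st(1) _ xyz(3)] stableD[OF st(2) xyz(1,2)] by blast
  also have "\<dots> = ?t (\<lambda>v. bracket x (bracket y (bracket z v))) - ?t (\<lambda>v. bracket y (bracket x (bracket z v)))"
    unfolding bracket_bracket_left[of x y]
    by (rule rtrace_diff[OF fr endo_compose[OF ex endo_compose[OF ey ez]] endo_compose[OF ey endo_compose[OF ex ez]]])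
  also have "?t (\<lambda>v. bracket y (bracket x (bracket z v))) = ?t (\<lambda>v. bracket x (bracket z (bracket y v)))"
    by (rule rtrace_comm[OF fr ey endo_compose[OF ex ez]])
  also have "?t (\<lambda>v. bracket x (bracket y (bracket z v))) - ?t (\<lambda>v. bracket x (bracket z (bracket y v)))
      = ?t (\<lambda>v. bracket x (bracket y (bracket z v)) - bracket x (bracket z (bracket y v)))"
    by (rule rtrace_diff[OF fr endo_compose[OF ex endo_compose[OF ey ez]]
          endo_compose[OF ex endo_compose[OF ez ey]], symmetric])
  also have "\<dots> = ?t (\<lambda>v. bracket x (bracket (bracket y z) v))"
    by (simp add: bracket_bracket_left[of y z] bracket_diff_right)
  also have "\<dots> = form C D x (bracket y z)"
    using form_eq_rtrace[OF C(1) st(1) xyz(1)] stableD[OF st(2) xyz(2,3)] by metis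
  finally show ?thesis .
qed

end

text \<open>The map \<open>T\<close> sends y to the vector with coordinates \<beta>(x, y).
  Nondegeneracy makes it injective on \<open>K\<close>, hence bijective by dimension, and the
  preimages of the basis vectors form the dual basis.\<close>

lemma dual_basis:
  assumes K: "subspace K" and lin: "\<And>x. Vector_Spaces.linear scale (*) (\<beta> x)"
    "\<And>y. Vector_Spaces.linear scale (*) (\<lambda>x. \<beta> x y)"
    and nondeg: "\<And>y. y \<in> K \<Longrightarrow> (\<And>x. x \<in> K \<Longrightarrow> \<beta> x y = 0) \<Longrightarrow> y = 0"
    and A: "frame {} A" "span A = K"
  obtains d where "\<And>x. x \<in> A \<Longrightarrow> d x \<in> K" "\<And>x x'. x \<in> A \<Longrightarrow> x' \<in> A \<Longrightarrow> \<beta> x' (d x) = (if x' = x then 1 else 0)"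
proof -
  note fin = frameD(2)[OF A(1)] and ind = frameD(3)[OF A(1)]
  define T where "T y = (\<Sum>x\<in>A. scale (\<beta> x y) x)" for y
  have T: "Vector_Spaces.linear scale scale T"
    by (rule linI) (simp_all add: T_def linear_addD[OF lin(1)] linear_scaleD[OF lin(1)]
        scale_left_distrib sum.distrib scale_sum_right)
  have zero: "\<beta> x y = 0" if "\<And>x. x \<in> A \<Longrightarrow> \<beta> x y = 0" "x \<in> span A" for x y
    using that(2)
  proof (induction rule: span_induct_alt)
    case base
    show ?case by (rule linear_zeroD[OF lin(2)])
  next
    case (step c x z)
    then show ?case
      using that(1) by (simp add: linear_addD[OF lin(2)] linear_scaleD[OF lin(2)])
  qed
  have coef: "\<And>x. x \<in> A \<Longrightarrow> u x = w x" if "(\<Sum>x\<in>A. scale (u x) x) = (\<Sum>x\<in>A. scale (w x) x)" for u w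
  proof -
    fix x assume x: "x \<in> A"
    have "(\<Sum>x\<in>A. scale (u x - w x) x) = 0"
      using that by (simp add: scale_left_diff_distrib sum_subtractf)
    from independentD[OF ind fin order_refl this x] show "u x = w x"
      by simp
  qed
  have inj: "inj_on T K"
  proof (rule inj_onI)
    fix y z assume yz: "y \<in> K" "z \<in> K" "T y = T z"
    have "\<beta> x (y - z) = 0" if "x \<in> A" for x
      using coef[OF yz(3)[unfolded T_def] that] by (simp add: linear_diffD[OF lin(1)])
    then have "y - z = 0"
      using zero A(2) subspace_diff[OF K yz(1,2)] by (intro nondeg) auto
    then show "y = z" by simp
  qed
  have TK: "T y \<in> K" for y
    unfolding T_def A(2)[symmetric] by (intro span_sum span_scale span_base)
  interpret TL: Vector_Spaces.linear scale scale T by (rule T)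
  interpret pair: finite_dimensional_vector_space_pair_1 scale Basis scale
    by unfold_locales
  have "T ` K = K"
  proof (rule subspace_dim_equal)
    show "subspace (T ` K)" by (rule TL.subspace_image[OF K])
    have spK: "span K = K" using K by (simp add: span_eq_iff)
    have "inj_on T (span K)"
      unfolding spK by (rule inj)
    then have "dim (T ` K) = dim K"
      by (rule pair.dim_image_eq[OF T])
    then show "dim K \<le> dim (T ` K)" by simp
  qed (use K TK in auto)
  have "\<exists>y\<in>K. \<forall>x'\<in>A. \<beta> x' y = (if x' = x then 1 else 0)" if x: "x \<in> A" for x
  proof -
    have "x \<in> T ` K"
      using x \<open>T ` K = K\<close> A(2) span_base by blast
    then obtain y where y: "y \<in> K" "T y = x" by blast
    have eq: "(\<Sum>z\<in>A. scale (\<beta> z y) z) = (\<Sum>z\<in>A. scale (if z = x then 1 else 0) z)"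
      using y(2) x fin by (simp add: T_def if_distrib[of "\<lambda>c. scale c _"] cong: if_cong)
    show ?thesis
      using coef[OF eq] by (intro bexI[OF _ y(1)]) simp
  qed
  then show ?thesis
    using that by metis
qed

end

context fd_lie_algebra
begin

context
  fixes B D :: "'l set"
  assumes B: "subalgebra B" "semisimple B" and D: "frame {} D" "span D = UNIV"
begin

lemmas indep_D = frameD(3)[OF D(1)]

lemmas form_rules = form_linear_left[OF indep_D D(2)] form_linear_right[OF indep_D D(2)]
  and form_inv = form_invariant[OF indep_D D(2)]

lemma form_zero: "form C D 0 y = 0" "form C D x 0 = 0"
  using form_linear_left(2)[OF indep_D D(2), of C 0 0 y] form_linear_right(2)[OF indep_D D(2), of C x 0 0]
  by simp_all

lemma form_diff_right: "form C D x (y - z) = form C D x y - form C D x z"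
  using form_linear_right(1)[OF indep_D D(2), of C x "y - z" z] by simp

lemma form_zero_on_span:
  assumes "x \<in> span P" "\<And>x. x \<in> P \<Longrightarrow> form C D x y = 0"
  shows "form C D x y = 0"
  using assms(1)
proof (induction rule: span_induct_alt)
  case base
  show ?case by (rule form_zero)
next
  case (step c x z)
  then show ?case using assms(2) by (simp add: form_rules)
qed

text \<open>By invariance the radical \<open>?Q\<close> of the form on \<open>K\<close> is an ideal
  of \<open>B\<close>. The trace form vanishes on it, so \<open>trace_zero_ideal_trivial\<close>
  applies.\<close>

lemma form_nondegenerate:
  assumes K: "ideal_of B K" and C: "C \<subseteq> D" and st: "stable B (span C)"
    and faithful: "\<And>x. x \<in> K \<Longrightarrow> (\<And>v. v \<in> span C \<Longrightarrow> bracket x v = 0) \<Longrightarrow> x = 0"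
    and y: "y \<in> K" "\<And>x. x \<in> K \<Longrightarrow> form C D x y = 0"
  shows "y = 0"
proof -
  have finC: "finite C" and frC: "frame {} C"
    using C D(1) finite_subset independent_mono by (auto simp: frame_empty)
  let ?Q = "{y \<in> K. \<forall>x\<in>K. form C D x y = 0}"
  have "subspace ?Q"
    using ideal_ofD(1)[OF K] by (auto simp: subspace_def form_zero form_rules)
  moreover have "bracket z q \<in> ?Q" if z: "z \<in> B" and q: "q \<in> ?Q" for z q
  proof -
    have "form C D x (bracket z q) = 0" if x: "x \<in> K" for x
    proof -
      have "form C D x (bracket z q) = form C D (bracket x z) q"
        by (rule form_inv[OF C finC st subalgebraD(2)[OF B(1)], symmetric])
          (use x z q ideal_ofD(2)[OF K] in auto)
      then show ?thesis
        using q ideal_of_right[OF K x z] by simp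
    qed
    then show ?thesis
      using z q stableD[OF ideal_ofD(3)[OF K]] by auto
  qed
  ultimately have Q: "ideal_of B ?Q"
    using ideal_ofD(2)[OF K] by (auto simp: ideal_of_def)
  have "?Q = {0}"
  proof (rule trace_zero_ideal_trivial[OF B(2) Q frC st])
    show "x = 0" if "x \<in> ?Q" "\<And>v. v \<in> span C \<Longrightarrow> bracket x v = 0" for x
      using faithful that by simp
    show "rtrace {} C (\<lambda>v. bracket a (bracket b v)) = 0" if "a \<in> ?Q" "b \<in> ?Q" for a b
      using form_eq_rtrace[OF indep_D D(2) C ideal_subset_stable[OF Q st] that] that by simp
  qed
  then show ?thesis
    using y by blast
qed

lemma center_trivial:
  assumes "x \<in> B" "\<And>v. v \<in> B \<Longrightarrow> bracket x v = 0"
  shows "x = 0"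
proof -
  let ?Z = "{x \<in> B. \<forall>v\<in>B. bracket x v \<in> {0}}"
  have "subspace ?Z"
    by (rule subspace_bracket_into_left[OF subalgebraD(1)[OF B(1)]]) simp
  then have "ideal_of B ?Z"
    using stableD[OF subalgebraD(2)[OF B(1)]] by (auto simp: ideal_of_def bracket_bracket_left)
  then have "?Z = {0}"
    by (rule abelian_ideal_trivial[OF B(2)]) auto
  then show ?thesis
    using assms by blast
qed

text \<open>Since \<open>D\<close> spans everything, \<open>form D D\<close> is the trace form of B
  acting on all of L. It plays the role of the Killing form; faithfulness comes from the trivial
  center of B.\<close>

definition orth :: "'l set \<Rightarrow> 'l set" where
  "orth K = {b \<in> B. \<forall>k\<in>K. form D D k b = 0}"

lemma stable_D: "stable B (span D)"
  by (simp add: stable_def D(2))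

lemma killing_nondegenerate:
  assumes K: "ideal_of B K" and y: "y \<in> K" "\<And>x. x \<in> K \<Longrightarrow> form D D x y = 0"
  shows "y = 0"
proof (rule form_nondegenerate[OF K order_refl stable_D _ y])
  show "x = 0" if "x \<in> K" "\<And>v. v \<in> span D \<Longrightarrow> bracket x v = 0" for x
    by (rule center_trivial) (use that ideal_ofD(2)[OF K] D(2) in auto)
qed

lemma killing_invariant:
  "x \<in> B \<Longrightarrow> y \<in> B \<Longrightarrow> z \<in> B \<Longrightarrow> form D D (bracket x y) z = form D D x (bracket y z)"
  by (rule form_inv[OF order_refl frameD(2)[OF D(1)] stable_D subalgebraD(2)[OF B(1)]])

lemma orth_ideal:
  assumes K: "ideal_of B K"
  shows "ideal_of B (orth K)"
proof -
  have "subspace (orth K)"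
    using subalgebraD(1)[OF B(1)] by (auto simp: orth_def subspace_def form_zero form_rules)
  moreover have "form D D k (bracket z b) = 0" if "z \<in> B" "b \<in> orth K" "k \<in> K" for z b k
    using that killing_invariant[of k z b] ideal_of_right[OF K] ideal_ofD(2)[OF K] by (auto simp: orth_def)
  ultimately show ?thesis
    using stableD[OF subalgebraD(2)[OF B(1)]] by (auto simp: ideal_of_def orth_def)
qed

lemma orth_inter: "ideal_of B K \<Longrightarrow> x \<in> K \<Longrightarrow> x \<in> orth K \<Longrightarrow> x = 0"
  by (rule killing_nondegenerate) (auto simp: orth_def)

text \<open>Nondegeneracy on \<open>K\<close> gives a dual basis, and \<open>?k\<close> is the
  orthogonal projection of \<open>b\<close> to \<open>K\<close> computed with it.\<close>

lemma orth_decomposition: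
  assumes K: "ideal_of B K" and b: "b \<in> B"
  obtains k where "k \<in> K" "b - k \<in> orth K"
proof -
  obtain P where P: "frame {} P" "span P = K"
    using subspace_basis[OF ideal_ofD(1)[OF K]] by blast
  obtain d where d: "\<And>x. x \<in> P \<Longrightarrow> d x \<in> K"
    "\<And>x x'. x \<in> P \<Longrightarrow> x' \<in> P \<Longrightarrow> form D D x' (d x) = (if x' = x then 1 else 0)"
    using dual_basis[OF ideal_ofD(1)[OF K] linear_form(2,1)[OF indep_D D(2)] killing_nondegenerate[OF K] P]
    by metis
  let ?k = "\<Sum>x\<in>P. scale (form D D x b) (d x)"
  have kK: "?k \<in> K"
    using d(1) ideal_ofD(1)[OF K] by (intro subspace_sum subspace_scale)
  have "form D D x (b - ?k) = 0" if x: "x \<in> P" for x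
  proof -
    have "form D D x ?k = (\<Sum>z\<in>P. form D D z b * form D D x (d z))"
      by (simp add: linear_sumD[OF linear_form(2)[OF indep_D D(2)]] form_rules)
    also have "\<dots> = form D D x b"
      using x d(2) frameD(2)[OF P(1)] by (simp add: if_distrib[of "(*) _"] cong: if_cong)
    finally show ?thesis
      by (simp add: form_diff_right)
  qed
  then have "form D D x (b - ?k) = 0" if "x \<in> span P" for x
    using form_zero_on_span[OF that] by blast
  then have "b - ?k \<in> orth K"
    using b kK ideal_ofD(2)[OF K] subalgebraD(1)[OF B(1)] P(2)
    by (auto simp: orth_def intro: subspace_diff)
  then show ?thesis
    using kK that by blast
qed

text \<open>Let Q be the part of K orthogonal to [K, K]. For q, q' in Q and x in K, invariance gives
  (x, [q, q']) = ([x, q], q') = 0, so Q is abelian and therefore 0. Splitting k along [K, K] leaves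
  a remainder in Q.\<close>

lemma ideal_perfect:
  assumes K: "ideal_of B K"
  shows "K \<subseteq> bracket_space K K"
proof
  fix k assume k: "k \<in> K"
  let ?I = "bracket_space K K"
  have I: "ideal_of B ?I"
    by (rule ideal_bracket_space[OF ideal_ofD(3)[OF K] K ideal_ofD(2)[OF K]])
  have IK: "?I \<subseteq> K"
    using ideal_ofD(2,3)[OF K] by (intro bracket_space_minimal[OF ideal_ofD(1)[OF K]]) (auto simp: stable_def)
  let ?Q = "K \<inter> orth ?I"
  have Q: "ideal_of B ?Q"
    using K orth_ideal[OF I] by (auto simp: ideal_of_def intro: subspace_inter)
  have "bracket q q' = 0" if q: "q \<in> ?Q" "q' \<in> ?Q" for q q'
  proof (rule killing_nondegenerate[OF K])
    have KB: "K \<subseteq> B" by (rule ideal_ofD(2)[OF K])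
    show "bracket q q' \<in> K"
      using q stableD[OF ideal_ofD(3)[OF Q]] KB by blast
    fix x assume x: "x \<in> K"
    have "form D D x (bracket q q') = form D D (bracket x q) q'"
      using x q KB by (intro killing_invariant[symmetric]) auto
    also have "\<dots> = 0"
      using x q bracket_space_base[of x K q K] by (simp add: orth_def)
    finally show "form D D x (bracket q q') = 0" .
  qed
  then have Q0: "?Q = {0}"
    by (rule abelian_ideal_trivial[OF B(2) Q])
  obtain i where i: "i \<in> ?I" "k - i \<in> orth ?I"
    using orth_decomposition[OF I] k ideal_ofD(2)[OF K] by blast
  then have "k - i \<in> ?Q"
    using k IK subspace_diff[OF ideal_ofD(1)[OF K]] by blast
  then show "k \<in> ?I"
    using i(1) Q0 by simp
qed

text \<open>The sum of x d(x) over a basis of \<open>K\<close> and its dual basis for the trace form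
  on \<open>span C\<close>; its trace there is dim K. It acts on the whole algebra because it will
  be applied to a vector outside the module, and the second property locates such values.\<close>

lemma casimir:
  assumes K: "ideal_of B K" "K \<noteq> {0}" and C: "C \<subseteq> D" and st: "stable B (span C)"
    and faithful: "\<And>x. x \<in> K \<Longrightarrow> (\<And>v. v \<in> span C \<Longrightarrow> bracket x v = 0) \<Longrightarrow> x = 0"
  obtains c where "lin c"
    "\<And>S v. stable K S \<Longrightarrow> subspace S \<Longrightarrow> (\<And>k. k \<in> K \<Longrightarrow> bracket k v \<in> S) \<Longrightarrow> c v \<in> S"
    "\<And>b v. b \<in> K \<Longrightarrow> bracket b (c v) = c (bracket b v)"
    "rtrace {} C c \<noteq> 0"
proof -
  let ?f = "form C D"
  note K1 = ideal_ofD(1)[OF K(1)]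
  have KB: "K \<subseteq> B" by (rule ideal_ofD(2)[OF K(1)])
  have finC: "finite C" and frC: "frame {} C"
    using C D(1) finite_subset independent_mono by (auto simp: frame_empty)
  note nondeg = form_nondegenerate[OF K(1) C st faithful]
  obtain P where P: "frame {} P" "span P = K"
    using subspace_basis[OF K1] by blast
  note fin = frameD(2)[OF P(1)]
  have PK: "x \<in> K" if "x \<in> P" for x
    using that P(2) span_base by blast
  obtain d where d: "\<And>x. x \<in> P \<Longrightarrow> d x \<in> K"
    "\<And>x x'. x \<in> P \<Longrightarrow> x' \<in> P \<Longrightarrow> ?f x' (d x) = (if x' = x then 1 else 0)"
    using dual_basis[OF K1 linear_form(2,1)[OF indep_D D(2), of C] nondeg P] by metis
  have expand: "z = (\<Sum>x\<in>P. scale (?f z (d x)) x)" if z: "z \<in> K" for z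
  proof -
    have z_eq: "z = (\<Sum>x\<in>P. scale (representation P z x) x)"
      using sum_representation_eq[OF frameD(3)[OF P(1)] _ fin order_refl] z P(2) by simp
    have "?f z (d x) = representation P z x" if x: "x \<in> P" for x
    proof -
      have "?f z (d x) = ?f (\<Sum>y\<in>P. scale (representation P z y) y) (d x)"
        using z_eq by simp
      also have "\<dots> = (\<Sum>y\<in>P. representation P z y * ?f y (d x))"
        by (simp add: linear_sumD[OF linear_form(1)[OF indep_D D(2)]] form_rules)
      also have "\<dots> = representation P z x"
        using x d(2) fin by (simp add: if_distrib[of "(*) _"] cong: if_cong)
      finally show ?thesis .
    qed
    then show ?thesis using z_eq by simp
  qed
  have expand': "z = (\<Sum>x\<in>P. scale (?f x z) (d x))" if z: "z \<in> K" for z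
  proof -
    let ?w = "\<Sum>x\<in>P. scale (?f x z) (d x)"
    have wK: "?w \<in> K"
      using d(1) K1 by (intro subspace_sum subspace_scale)
    have "?f x (z - ?w) = 0" if x: "x \<in> P" for x
    proof -
      have "?f x ?w = (\<Sum>y\<in>P. ?f y z * ?f x (d y))"
        by (simp add: linear_sumD[OF linear_form(2)[OF indep_D D(2)]] form_rules)
      also have "\<dots> = ?f x z"
        using x d(2) fin by (simp add: if_distrib[of "(*) _"] cong: if_cong)
      finally show ?thesis by (simp add: form_diff_right)
    qed
    then have "?f x (z - ?w) = 0" if "x \<in> K" for x
      using form_zero_on_span[of x P] that P(2) by blast
    then have "z - ?w = 0"
      using nondeg subspace_diff[OF K1 z wK] by blast
    then show ?thesis by simp
  qed
  define c where "c v = (\<Sum>x\<in>P. bracket x (bracket (d x) v))" for v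
  show ?thesis
  proof (rule that)
    show "lin c"
      unfolding c_def[abs_def] by (rule lin_sum, rule lin_compose[OF bracket_linear_right bracket_linear_right])
    show "c v \<in> S" if "stable K S" "subspace S" "\<And>k. k \<in> K \<Longrightarrow> bracket k v \<in> S" for S v
      unfolding c_def using that PK d(1) by (intro subspace_sum) (auto intro: stableD)
    show "bracket b (c v) = c (bracket b v)" if b: "b \<in> K" for b v
    proof -
      \<comment> \<open>\<open>?g\<close> is the matrix of ad b in the basis \<open>P\<close>. By
        invariance the matrix in the dual basis is its negative transpose, so the double sums
        \<open>1\<close> and \<open>2\<close> cancel.\<close>
      let ?g = "\<lambda>x y. ?f (bracket b x) (d y)"
      have 1: "(\<Sum>x\<in>P. bracket (bracket b x) (bracket (d x) v))
          = (\<Sum>x\<in>P. \<Sum>y\<in>P. scale (?g x y) (bracket y (bracket (d x) v)))"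
      proof (rule sum.cong)
        fix x assume x: "x \<in> P"
        have "bracket b x \<in> K"
          using stableD[OF ideal_ofD(3)[OF K(1)]] b PK[OF x] KB by blast
        then have "bracket b x = (\<Sum>y\<in>P. scale (?g x y) y)"
          by (rule expand)
        then have "bracket (bracket b x) (bracket (d x) v) = bracket (\<Sum>y\<in>P. scale (?g x y) y) (bracket (d x) v)"
          by simp
        then show "bracket (bracket b x) (bracket (d x) v) = (\<Sum>y\<in>P. scale (?g x y) (bracket y (bracket (d x) v)))"
          by (simp add: bracket_sum_left bracket_scale_left)
      qed simp
      have 2: "(\<Sum>x\<in>P. bracket x (bracket (bracket b (d x)) v))
          = (\<Sum>x\<in>P. \<Sum>y\<in>P. - scale (?g y x) (bracket x (bracket (d y) v)))"
      proof (rule sum.cong)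
        fix x assume x: "x \<in> P"
        have "bracket b (d x) \<in> K"
          using stableD[OF ideal_ofD(3)[OF K(1)]] b d(1)[OF x] KB by blast
        then have "bracket b (d x) = (\<Sum>y\<in>P. scale (?f y (bracket b (d x))) (d y))"
          by (rule expand')
        also have "\<dots> = (\<Sum>y\<in>P. - scale (?g y x) (d y))"
        proof (rule sum.cong)
          fix y assume y: "y \<in> P"
          have "?f y (bracket b (d x)) = ?f (bracket y b) (d x)"
            by (rule form_inv[OF C finC st subalgebraD(2)[OF B(1)], symmetric])
              (use y x b PK d(1) KB in auto)
          also have "\<dots> = - ?g y x"
            using form_linear_left(2)[OF indep_D D(2), of C "- 1" "bracket b y" "d x"]
            by (simp add: bracket_antisym[of y b])
          finally show "scale (?f y (bracket b (d x))) (d y) = - scale (?g y x) (d y)"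
            by simp
        qed simp
        finally have "bracket x (bracket (bracket b (d x)) v) = bracket x (bracket (\<Sum>y\<in>P. - scale (?g y x) (d y)) v)"
          by simp
        then show "bracket x (bracket (bracket b (d x)) v) = (\<Sum>y\<in>P. - scale (?g y x) (bracket x (bracket (d y) v)))"
          by (simp add: bracket_sum_left bracket_sum_right bracket_scale_left bracket_scale_right
              sum_negf flip: scale_minus_left)
      qed simp
      have "bracket b (c v) = (\<Sum>x\<in>P. bracket (bracket b x) (bracket (d x) v))
          + (\<Sum>x\<in>P. bracket x (bracket (bracket b (d x)) v)) + c (bracket b v)"
        unfolding c_def bracket_sum_right sum.distrib[symmetric]
        by (intro sum.cong refl)
          (simp add: bracket_bracket_right[of b] bracket_add_right add.assoc)
      also have "(\<Sum>x\<in>P. bracket (bracket b x) (bracket (d x) v))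
          + (\<Sum>x\<in>P. bracket x (bracket (bracket b (d x)) v)) = 0"
        unfolding 1 2 sum_negf by (subst sum.swap) simp
      finally show ?thesis by simp
    qed
    have eb: "endo {} C (bracket x)" if "x \<in> K" for x
      by (rule endo_bracket[of B]) (use that KB st in \<open>auto simp: stable_def\<close>)
    have e: "endo {} C (\<lambda>v. bracket x (bracket (d x) v))" if "x \<in> P" for x
      by (rule endo_compose[OF eb[OF PK[OF that]] eb[OF d(1)[OF that]]])
    have "rtrace {} C c = (\<Sum>x\<in>P. rtrace {} C (\<lambda>v. bracket x (bracket (d x) v)))"
      unfolding c_def[abs_def] by (rule rtrace_sum[OF frC e])
    also have "\<dots> = (\<Sum>x\<in>P. ?f x (d x))"
      using PK d(1) KB
      by (intro sum.cong refl form_eq_rtrace[OF indep_D D(2) C st, symmetric]) auto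
    also have "\<dots> = of_nat (card P)"
      using d(2) by simp
    finally show "rtrace {} C c \<noteq> 0"
      using K(2) P fin by auto
  qed
qed

end

end

section \<open>The complement of the nilpotent radical\<close>

context fd_lie_algebra
begin

text \<open>Whitehead's first lemma for the cocycle b \<mapsto> [b, r], by induction on dim W. A
  Fitting argument for the Casimir operator c corrects r by an element of W so that its brackets
  fall into the part of W killed by a power of c.\<close>

lemma invariant_complement:
  assumes B: "subalgebra B" "semisimple B" and "subspace W" "stable B W" "\<And>b. b \<in> B \<Longrightarrow> bracket b r \<in> W"
  shows "\<exists>w\<in>W. \<forall>b\<in>B. bracket b (r - w) = 0"
  using assms(3-5)
proof (induction "dim W" arbitrary: W r rule: less_induct)
  case less
  note W = less.prems(1) and stW = less.prems(2) and rW = less.prems(3)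
  obtain C D where CD: "frame C D" "span C = W" "span D = UNIV"
    using subspace_frame[OF W subspace_UNIV] by auto
  have D: "frame {} D" and CsubD: "C \<subseteq> D" and frC: "frame {} C" and stC: "stable B (span C)"
    using frameD[OF CD(1)] CD(2) stW by (auto simp: frame_empty)
  let ?K = "{x \<in> B. \<forall>w\<in>W. bracket x w \<in> {0}}"
  have K: "ideal_of B ?K"
  proof -
    have "subspace ?K"
      by (rule subspace_bracket_into_left[OF subalgebraD(1)[OF B(1)]]) simp
    then show ?thesis
      using stableD[OF subalgebraD(2)[OF B(1)]] stableD[OF stW]
      by (auto simp: ideal_of_def bracket_bracket_left)
  qed
  \<comment> \<open>For a, b in \<open>?K\<close>, [a, b] r = a (b r) - b (a r) = 0, because b r and
    a r are in \<open>W\<close>. Since \<open>?K\<close> is perfect, it annihilates r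
    entirely.\<close>
  have Kr: "bracket x r = 0" if x: "x \<in> ?K" for x
  proof -
    have "bracket_space ?K ?K \<subseteq> {x \<in> UNIV. \<forall>v\<in>{r}. bracket x v \<in> {0}}"
    proof (rule bracket_space_minimal)
      show "subspace {x \<in> UNIV. \<forall>v\<in>{r}. bracket x v \<in> {0}}"
        by (rule subspace_bracket_into_left) simp_all
      show "bracket a b \<in> {x \<in> UNIV. \<forall>v\<in>{r}. bracket x v \<in> {0}}" if "a \<in> ?K" "b \<in> ?K" for a b
        using that rW by (simp add: bracket_bracket_left)
    qed
    then show ?thesis
      using ideal_perfect[OF B D CD(3) K] x by blast
  qed
  define K' where "K' = orth B D ?K"
  have K': "ideal_of B K'"
    unfolding K'_def by (rule orth_ideal[OF B D CD(3) K])
  have split: "\<exists>k k'. k \<in> ?K \<and> k' \<in> K' \<and> b = k + k'" if b: "b \<in> B" for b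
  proof -
    obtain k where "k \<in> ?K" "b - k \<in> K'"
      using orth_decomposition[OF B D CD(3) K b] unfolding K'_def by blast
    then show ?thesis
      by (intro exI[of _ k] exI[of _ "b - k"]) simp
  qed
  show ?case
  proof (cases "K' = {0}")
    case True
    then have "bracket b r = 0" if "b \<in> B" for b
      using split[OF that] Kr by auto
    then show ?thesis
      using subspace_0[OF W] by (intro bexI[of _ 0]) auto
  next
    case False
    have faithful: "x = 0" if x: "x \<in> K'" "\<And>v. v \<in> span C \<Longrightarrow> bracket x v = 0" for x
    proof (rule orth_inter[OF B D CD(3) K])
      show "x \<in> ?K"
        using x ideal_ofD(2)[OF K'] CD(2) by auto
      show "x \<in> orth B D ?K"
        using x(1) by (simp add: K'_def)
    qed
    obtain c where c: "lin c"
      "\<And>S v. stable K' S \<Longrightarrow> subspace S \<Longrightarrow> (\<And>k. k \<in> K' \<Longrightarrow> bracket k v \<in> S) \<Longrightarrow> c v \<in> S"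
      "\<And>b v. b \<in> K' \<Longrightarrow> bracket b (c v) = c (bracket b v)"
      "rtrace {} C c \<noteq> 0"
      using casimir[OF B D CD(3) K' False CsubD stC faithful] by metis
    have stK': "stable K' W"
      by (rule ideal_subset_stable[OF K' stW])
    have cW: "c v \<in> W" if "v \<in> W" for v
      by (rule c(2)[OF stK' W]) (rule stableD[OF stK' _ that])
    \<comment> \<open>Here r need not be in \<open>W\<close>; its brackets with \<open>K'\<close>
      are, and that suffices for c r.\<close>
    have cr: "c r \<in> W"
      by (rule c(2)[OF stK' W]) (use rW ideal_ofD(2)[OF K'] in blast)
    note cn = lin_funpow[OF c(1)]
    let ?S = "\<lambda>n. (c ^^ n) ` W"
    have "subspace (?S n)" for n
    proof -
      interpret cn: Vector_Spaces.linear scale scale "c ^^ n" by (rule cn)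
      show ?thesis by (rule cn.subspace_image[OF W])
    qed
    moreover have "?S (Suc n) \<subseteq> ?S n" for n
      using cW by (auto simp: funpow_swap1)
    ultimately obtain n where n: "?S (Suc n) = ?S n"
      using decseq_subspace_stationary[of ?S] by blast
    \<comment> \<open>The images c^n W have become stationary, so c^n (c r) equals c^(n+1) w for
      some w in \<open>W\<close>.\<close>
    have "(c ^^ n) (c r) \<in> ?S (Suc n)"
      unfolding n using cr by (rule imageI)
    then obtain w where w: "w \<in> W" "(c ^^ n) (c r) = (c ^^ Suc n) w"
      by blast
    have r': "(c ^^ Suc n) (r - w) = 0"
    proof -
      have "(c ^^ Suc n) (r - w) = (c ^^ Suc n) r - (c ^^ Suc n) w"
        by (rule linear_diffD[OF cn])
      also have "(c ^^ Suc n) r = (c ^^ n) (c r)"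
        by (simp only: funpow_Suc_right comp_apply)
      finally show ?thesis
        using w(2) by simp
    qed
    have comm: "bracket b ((c ^^ m) v) = (c ^^ m) (bracket b v)" if "b \<in> K'" for b m v
      by (induction m) (simp_all add: c(3)[OF that])
    let ?W0 = "{v \<in> W. (c ^^ Suc n) v = 0}"
    have W0: "subspace ?W0"
      using W by (auto simp: subspace_def linear_addD[OF c(1)] linear_scaleD[OF c(1)]
          linear_zeroD[OF c(1)] linear_addD[OF cn] linear_scaleD[OF cn] linear_zeroD[OF cn])
    have act: "bracket b v \<in> ?W0"
      if b: "b \<in> B" and v: "(c ^^ Suc n) v = 0" "bracket b v \<in> W" "\<And>k. k \<in> ?K \<Longrightarrow> bracket k v = 0" for b v
    proof -
      obtain k k' where k: "k \<in> ?K" "k' \<in> K'" "b = k + k'"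
        using split[OF b] by blast
      have "bracket b v = bracket k' v"
        using v(3)[OF k(1)] by (simp add: k(3) bracket_add_left)
      moreover have "(c ^^ Suc n) (bracket k' v) = 0"
        using comm[OF k(2), of "Suc n" v] v(1) by simp
      ultimately show ?thesis
        using v(2) by simp
    qed
    have "?W0 \<noteq> W"
    proof
      assume eq: "?W0 = W"
      have "endo {} C c"
        using c(1) cW CD(2) by (simp add: endo_def linear_zeroD)
      moreover have "(c ^^ Suc n) v \<in> span {}" if "v \<in> span C" for v
        using that eq CD(2) by auto
      ultimately have "rtrace {} C c = 0"
        by (rule rtrace_nilpotent[OF frC])
      then show False using c(4) by simp
    qed
    then have "dim ?W0 < dim W"
      using dim_less[OF W0 W] by blast
    moreover have "stable B ?W0"
      unfolding stable_def
    proof (intro ballI)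
      fix b v assume b: "b \<in> B" and v: "v \<in> ?W0"
      then show "bracket b v \<in> ?W0"
        using stableD[OF stW b] by (intro act) auto
    qed
    moreover have "bracket b (r - w) \<in> ?W0" if b: "b \<in> B" for b
    proof (rule act[OF b r'])
      show "bracket b (r - w) \<in> W"
        using rW[OF b] stableD[OF stW b w(1)] W by (simp add: bracket_diff_right subspace_diff)
      show "bracket k (r - w) = 0" if "k \<in> ?K" for k
        using Kr[OF that] that w(1) by (simp add: bracket_diff_right)
    qed
    ultimately obtain w' where w': "w' \<in> ?W0" "\<forall>b\<in>B. bracket b (r - w - w') = 0"
      using less.hyps[of ?W0 "r - w"] W0 by blast
    then show ?thesis
      using w(1) W by (intro bexI[of _ "w + w'"]) (auto simp: diff_diff_eq intro: subspace_add)
  qed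
qed

section \<open>Internal direct sums of two and three subspaces\<close>

lemma internal_direct_sum_pairD:
  assumes "internal_direct_sum UNIV [U, V]"
  shows "\<exists>u\<in>U. \<exists>v\<in>V. x = u + v" "x \<in> U \<Longrightarrow> x \<in> V \<Longrightarrow> x = 0"
proof -
  have sub: "subspace U" "subspace V" and bij: "bij_betw sum_list (listset [U, V]) UNIV"
    using assms by (auto simp: internal_direct_sum_def)
  have "x \<in> sum_list ` listset [U, V]"
    using bij by (simp add: bij_betw_def)
  then obtain u v where "u \<in> U" "v \<in> V" "x = u + v"
    by (auto simp: set_Cons_def)
  then show "\<exists>u\<in>U. \<exists>v\<in>V. x = u + v"
    by blast
  assume x: "x \<in> U" "x \<in> V"
  have "[x, 0] = [0, x]"
    by (rule inj_onD[OF bij_betw_imp_inj_on[OF bij]])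
      (use x sub in \<open>auto simp: set_Cons_def subspace_0\<close>)
  then show "x = 0" by simp
qed

lemma internal_direct_sum_pairI:
  assumes "subspace U" "subspace V" "\<And>u v. u \<in> U \<Longrightarrow> v \<in> V \<Longrightarrow> u + v \<in> W"
    and "\<And>x. x \<in> W \<Longrightarrow> \<exists>u\<in>U. \<exists>v\<in>V. x = u + v"
    and zero: "\<And>u v. u \<in> U \<Longrightarrow> v \<in> V \<Longrightarrow> u + v = 0 \<Longrightarrow> u = 0 \<and> v = 0"
  shows "internal_direct_sum W [U, V]"
  unfolding internal_direct_sum_def bij_betw_def
proof (intro conjI inj_onI)
  fix p q assume "p \<in> listset [U, V]" "q \<in> listset [U, V]" and eq: "sum_list p = sum_list q"
  then obtain u v u' v' where uv: "u \<in> U" "v \<in> V" "u' \<in> U" "v' \<in> V" "p = [u, v]" "q = [u', v']"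
    by (auto simp: set_Cons_def)
  have "u - u' = 0 \<and> v - v' = 0"
    using eq uv assms(1,2) by (intro zero subspace_diff) (auto simp: algebra_simps)
  then show "p = q" using uv by simp
next
  have "x \<in> sum_list ` listset [U, V]" if "x \<in> W" for x
  proof -
    obtain u v where "u \<in> U" "v \<in> V" "x = u + v" using assms(4)[OF \<open>x \<in> W\<close>] by blast
    then show ?thesis
      by (intro image_eqI[of _ _ "[u, v]"]) (auto simp: set_Cons_def)
  qed
  then show "sum_list ` listset [U, V] = W"
    using assms(3) by (auto simp: set_Cons_def)
qed (use assms(1,2) in auto)

lemma internal_direct_sum_tripleI:
  assumes "subspace U" "subspace V" "subspace Y"
    and ex: "\<And>x. \<exists>u\<in>U. \<exists>v\<in>V. \<exists>y\<in>Y. x = u + v + y"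
    and zero: "\<And>u v y. u \<in> U \<Longrightarrow> v \<in> V \<Longrightarrow> y \<in> Y \<Longrightarrow> u + v + y = 0 \<Longrightarrow> u = 0 \<and> v = 0 \<and> y = 0"
  shows "internal_direct_sum UNIV [U, V, Y]"
  unfolding internal_direct_sum_def bij_betw_def
proof (intro conjI inj_onI)
  fix p q assume "p \<in> listset [U, V, Y]" "q \<in> listset [U, V, Y]" and eq: "sum_list p = sum_list q"
  then obtain u v y u' v' y' where uv: "u \<in> U" "v \<in> V" "y \<in> Y" "u' \<in> U" "v' \<in> V" "y' \<in> Y"
    "p = [u, v, y]" "q = [u', v', y']"
    by (auto simp: set_Cons_def)
  have "u - u' = 0 \<and> v - v' = 0 \<and> y - y' = 0"
    using eq uv assms(1-3) by (intro zero subspace_diff) (auto simp: algebra_simps)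
  then show "p = q" using uv by simp
next
  have "x \<in> sum_list ` listset [U, V, Y]" for x
  proof -
    obtain u v y where "u \<in> U" "v \<in> V" "y \<in> Y" "x = u + v + y" using ex by blast
    then show ?thesis
      by (intro image_eqI[of _ _ "[u, v, y]"]) (auto simp: set_Cons_def add.assoc)
  qed
  then show "sum_list ` listset [U, V, Y] = UNIV" by blast
qed (use assms(1-3) in auto)

text \<open>A basis \<open>A\<close> of N is extended to one of R by vectors centralizing B, which
  is possible by \<open>invariant_complement\<close>, and then to one of L by vectors of B. The
  projection fixes \<open>A\<close> and kills the other basis vectors. Equivariance is checked on
  these three kinds of vectors.\<close>

lemma equivariant_projection:
  assumes B: "subalgebra B" "semisimple B" and N: "ideal_of UNIV N" and R: "subspace R" and NR: "N \<subseteq> R"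
    and LRN: "\<And>x r. r \<in> R \<Longrightarrow> bracket x r \<in> N" and levi: "internal_direct_sum UNIV [B, R]"
  obtains p where "lin p" "range p \<subseteq> N" "\<And>x. x \<in> N \<Longrightarrow> p x = x"
    "\<And>b v. b \<in> B \<Longrightarrow> p (bracket b v) = bracket b (p v)"
proof -
  note N1 = ideal_ofD(1)[OF N] and B1 = subalgebraD(1)[OF B(1)]
  let ?Z = "{r \<in> R. \<forall>b\<in>B. bracket b r \<in> {0}}"
  obtain A where A: "frame {} A" "span A = N"
    using subspace_basis[OF N1] by blast
  have Asub: "A \<subseteq> A \<union> ?Z" by blast
  obtain E where E: "A \<subseteq> E" "E \<subseteq> A \<union> ?Z" "independent E" "A \<union> ?Z \<subseteq> span E"
    by (rule maximal_independent_subset_extend[OF Asub frameD(3)[OF A(1)]])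
  have "R \<subseteq> span E"
  proof
    fix r assume r: "r \<in> R"
    have "stable B N"
      using ideal_ofD(3)[OF N] by (rule stable_mono) simp
    then obtain w where w: "w \<in> N" "\<forall>b\<in>B. bracket b (r - w) = 0"
      using invariant_complement[OF B N1] LRN[OF r] by blast
    then have "r - w \<in> ?Z"
      using subspace_diff[OF R r] NR by auto
    then have "r - w \<in> span E"
      using E(4) by blast
    moreover have "w \<in> span E"
      using w(1) A(2) span_mono[OF E(1)] by blast
    ultimately have "(r - w) + w \<in> span E"
      by (rule span_add)
    then show "r \<in> span E" by simp
  qed
  moreover have "span E \<subseteq> R"
    using E(2) A(2) NR span_superset[of A] by (intro span_minimal[OF _ R]) blast
  ultimately have spE: "span E = R" by blast
  obtain E' where E': "E \<subseteq> E'" "E' \<subseteq> E \<union> B" "independent E'" "E \<union> B \<subseteq> span E'"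
    using maximal_independent_subset_extend[of E "E \<union> B"] E(3) by blast
  have "x \<in> span E'" for x
  proof -
    obtain b r where "b \<in> B" "r \<in> R" "x = b + r"
      using internal_direct_sum_pairD(1)[OF levi] by blast
    moreover have "r \<in> span E'"
      using \<open>r \<in> R\<close> spE span_mono[OF E'(1)] by blast
    ultimately show ?thesis
      using E'(4) by (auto intro: span_add)
  qed
  then have spE': "span E' = UNIV" by blast
  obtain p where p: "lin p" "\<And>e. e \<in> E' \<Longrightarrow> p e = (if e \<in> A then e else 0)"
    using lin_extend[OF E'(3), of "\<lambda>e. if e \<in> A then e else 0"] by blast
  have AE': "A \<subseteq> E'" using E(1) E'(1) by blast
  have pN: "p x \<in> N" for x
    by (rule span_image_subset[OF p(1) _ N1, of E'])
      (use spE' p(2) A(2) span_base subspace_0[OF N1] in auto)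
  have p_ident: "p x = x" if "x \<in> N" for x
  proof -
    have "p x - x = 0"
      by (rule lin_zero_on_span[of "\<lambda>x. p x - x" A, OF lin_diff[OF p(1) linear_ident]])
        (use that A(2) p(2) AE' in auto)
    then show ?thesis by simp
  qed
  \<comment> \<open>The added basis vectors \<open>E' - E\<close> lie in \<open>B\<close>, so the
    component of b along \<open>E\<close> lies in B \<inter> R = 0.\<close>
  have pB: "p b = 0" if b: "b \<in> B" for b
  proof -
    have "b \<in> {u + w | u w. u \<in> span E \<and> w \<in> span (E' - E)}"
      unfolding span_Un[symmetric] using spE' E'(1) by (simp add: Un_absorb1)
    then obtain u w where uw: "u \<in> span E" "w \<in> span (E' - E)" "b = u + w"
      by blast
    have "span (E' - E) \<subseteq> B"
      using E'(2) by (intro span_minimal[OF _ B1]) blast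
    then have "b - w \<in> B"
      using uw(2) b by (intro subspace_diff[OF B1]) auto
    then have "u = 0"
      using uw(1,3) spE internal_direct_sum_pairD(2)[OF levi, of u] by simp
    moreover have "p w = 0"
      by (rule lin_zero_on_span[OF p(1) _ uw(2)]) (use p(2) E(1) in auto)
    ultimately show ?thesis using uw(3) by simp
  qed
  have "p (bracket b v) = bracket b (p v)" if b: "b \<in> B" for b v
  proof -
    have lin: "lin (\<lambda>v. p (bracket b v) - bracket b (p v))"
      by (rule lin_diff[OF lin_compose[OF p(1) bracket_linear_right] lin_compose[OF bracket_linear_right p(1)]])
    have "p (bracket b e) - bracket b (p e) = 0" if e: "e \<in> E'" for e
    proof (cases "e \<in> A")
      case True
      then have "bracket b e \<in> N"
        using stableD[OF ideal_ofD(3)[OF N]] A(2) span_base by blast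
      then show ?thesis
        using p(2)[OF e] True p_ident by simp
    next
      case False
      then have "p (bracket b e) = 0"
      proof (cases "e \<in> E")
        case True
        then have "bracket b e = 0"
          using False E(2) b by blast
        then show ?thesis by (simp add: linear_zeroD[OF p(1)])
      next
        case False
        then have "e \<in> B" using e E'(2) by blast
        then show ?thesis
          using pB stableD[OF subalgebraD(2)[OF B(1)] b] by blast
      qed
      then show ?thesis
        using p(2)[OF e] False by simp
    qed
    then have "p (bracket b v) - bracket b (p v) = 0"
      using lin_zero_on_span[OF lin, of E' v] spE' by blast
    then show ?thesis by simp
  qed
  then show ?thesis
    using that[of p] p(1) pN p_ident by blast
qed

end

theorem theorem12:
  fixes scaleH :: "'f::field_char_0 \<Rightarrow> 'h::ring_1 \<Rightarrow> 'h"
    and comult :: "'h \<Rightarrow> ('h \<times> 'h) list"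
    and counit :: "'h \<Rightarrow> 'f"
    and antipode :: "'h \<Rightarrow> 'h"
    and t :: "'h \<Rightarrow> 'f"
    and scaleL :: "'f \<Rightarrow> 'l::ab_group_add \<Rightarrow> 'l"
    and bracket :: "'l \<Rightarrow> 'l \<Rightarrow> 'l"
    and coact :: "'l \<Rightarrow> ('l \<times> 'h) list"
    and N R B :: "'l set"
  assumes hopf: "hopf_algebra scaleH comult counit antipode"
    and integral: "hopf_algebra.left_integral scaleH comult t"
    and ad_inv: "hopf_algebra.ad_invariant comult counit antipode t"
    and t_one: "t 1 = 1"
    and L: "comodule_lie_algebra scaleH comult counit antipode scaleL bracket coact"
    and fin_dim: "\<exists>Basis. finite_dimensional_vector_space scaleL Basis"
    and N: "lie_algebra.is_nilpotent_radical scaleL bracket UNIV N"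
    and R: "lie_algebra.is_solvable_radical scaleL bracket UNIV R"
    and N_sub: "right_comodule.subcomodule scaleH scaleL coact N"
    and R_sub: "right_comodule.subcomodule scaleH scaleL coact R"
    and B_subalg: "lie_algebra.subalgebra scaleL bracket B"
    and B_semisimple: "lie_algebra.semisimple scaleL bracket B"
    and B_sub: "right_comodule.subcomodule scaleH scaleL coact B"
    and levi: "vector_space.internal_direct_sum scaleL UNIV [B, R]"
  shows "\<exists>S. right_comodule.subcomodule scaleH scaleL coact S \<and>
           vector_space.internal_direct_sum scaleL R [S, N] \<and>
           (\<forall>b\<in>B. \<forall>s\<in>S. bracket b s = 0) \<and>
           vector_space.internal_direct_sum scaleL UNIV [B, S, N]"
proof -
  interpret comodule_lie_algebra scaleH comult counit antipode scaleL bracket coact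
    by (rule L)
  obtain Basis where "finite_dimensional_vector_space scaleL Basis"
    using fin_dim by blast
  then interpret lie: fd_lie_algebra scaleL bracket Basis
    by (intro fd_lie_algebra.intro L.lie_algebra_axioms linear_space_char_0.intro linear_space.intro
        L.vector_space_axioms)
  have N_ideal: "L.ideal_of UNIV N" "L.nilpotent N"
    and R_ideal: "L.ideal_of UNIV R" "L.solvable R"
    using N R by (auto simp: L.is_nilpotent_radical_def L.is_solvable_radical_def)
  note N_space = lie.ideal_ofD(1)[OF N_ideal(1)] and R_space = lie.ideal_ofD(1)[OF R_ideal(1)]
  have NR: "N \<subseteq> R"
    using R N_ideal lie.nilpotent_imp_solvable[OF N_ideal(2) lie.ideal_subalgebra[OF N_ideal(1)]]
    by (simp add: L.is_solvable_radical_def)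
  have LRN: "bracket x r \<in> N" if "r \<in> R" for x r
    by (rule lie.bracket_mem_nilpotent_radical[OF R_ideal N that])
  obtain p where p: "lie.lin p" "range p \<subseteq> N" "\<And>x. x \<in> N \<Longrightarrow> p x = x"
    "\<And>b v. b \<in> B \<Longrightarrow> p (bracket b v) = bracket b (p v)"
    using lie.equivariant_projection[OF B_subalg B_semisimple N_ideal(1) R_space NR LRN levi] by blast
  have t: "Vector_Spaces.linear scaleH (*) t"
    using integral by (simp add: H.left_integral_def)
  let ?a = "average t p"
  note a_lin = linear_average[OF t p(1)]
  have aN: "?a v \<in> N" for v
    by (rule average_mem[OF t p(1) N_sub p(2)])
  have a_ident: "?a v = v" if "v \<in> N" for v
    by (rule average_ident[OF t p(1) N_sub p(3) t_one that])
  have a_bracket: "?a (bracket b v) = bracket b (?a v)" if "b \<in> B" for b v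
    by (rule average_bracket[OF t p(1) ad_inv B_sub p(4) that])
  \<comment> \<open>As the average is a projection with image in N \<subseteq> R, this image of R is
    its kernel in R; in this form it is visibly a subcomodule.\<close>
  let ?S = "(\<lambda>r. r - ?a r) ` R"
  have S_sub: "subcomodule ?S"
    by (rule subcomodule_complement[OF t p(1) integral R_sub])
  then have S_space: "L.subspace ?S"
    by (simp add: subcomodule_def)
  have SR: "s \<in> R" if "s \<in> ?S" for s
    using that aN NR L.subspace_diff[OF R_space] by blast
  have aS: "?a s = 0" if "s \<in> ?S" for s
    using that a_ident[OF aN] by (auto simp: linear_diffD[OF a_lin])
  have SN_zero: "s = 0 \<and> y = 0" if "s \<in> ?S" "y \<in> N" "s + y = 0" for s y
  proof -
    have "?a (s + y) = 0"
      using that(3) by (simp add: linear_zeroD[OF a_lin])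
    then have "y = 0"
      using aS[OF that(1)] a_ident[OF that(2)] by (simp add: linear_addD[OF a_lin])
    then show ?thesis
      using that(3) by simp
  qed
  have R_decomp: "\<exists>s\<in>?S. \<exists>y\<in>N. r = s + y" if "r \<in> R" for r
    using that aN[of r] by (intro bexI[of _ "r - ?a r"] bexI[of _ "?a r"]) auto
  have "L.internal_direct_sum R [?S, N]"
    using SR NR L.subspace_add[OF R_space] R_decomp SN_zero
    by (intro lie.internal_direct_sum_pairI S_space N_space) blast+
  moreover have "bracket b s = 0" if b: "b \<in> B" and s: "s \<in> ?S" for b s
  proof -
    obtain r where r: "r \<in> R" "s = r - ?a r"
      using s by blast
    \<comment> \<open>The average commutes with b, and it fixes [b, r], which lies in N; so the two
      terms cancel.\<close>
    have "bracket b s = bracket b r - ?a (bracket b r)"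
      by (simp add: r(2) lie.bracket_diff_right a_bracket[OF b])
    then show ?thesis
      using a_ident[OF LRN[OF r(1)]] by simp
  qed
  moreover have "L.internal_direct_sum UNIV [B, ?S, N]"
  proof (rule lie.internal_direct_sum_tripleI[OF lie.subalgebraD(1)[OF B_subalg] S_space N_space])
    show "\<exists>b\<in>B. \<exists>s\<in>?S. \<exists>y\<in>N. x = b + s + y" for x
    proof -
      obtain b r where "b \<in> B" "r \<in> R" "x = b + r"
        using lie.internal_direct_sum_pairD(1)[OF levi] by blast
      then show ?thesis
        using R_decomp[of r] by (metis add.assoc)
    qed
    fix b s y assume b: "b \<in> B" and s: "s \<in> ?S" and y: "y \<in> N" and sum: "b + s + y = 0"
    have "b = - (s + y)"
      using sum by (simp only: eq_neg_iff_add_eq_0 add.assoc)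
    then have "b \<in> R"
      using SR[OF s] y NR L.subspace_neg[OF R_space] L.subspace_add[OF R_space] by blast
    then have "b = 0"
      using lie.internal_direct_sum_pairD(2)[OF levi b] by blast
    then show "b = 0 \<and> s = 0 \<and> y = 0"
      using SN_zero[OF s y] sum by simp
  qed
  ultimately show ?thesis
    using S_sub by blast
qed

end
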